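(* Let $\mu$ be a non-trivial probability measure on $\partial\mathbb{D}$ with absolutely continuous density $w$ and Verblunsky coefficients $\{\alpha_k\}$ satisfying $\sum_{k\ge 0}|\alpha_k|^2<\infty$. For $m\ge 1$ let $w_m=\int_0^{2\pi}e^{-im\theta}\log w(\theta)\frac{d\theta}{2\pi}$. Then for every $m\ge 1$ $$w_m=\sum_{P\in M_m^\infty}N(P)\,\beta(P)=\sum_{P\in M_m^0}N(P)\sum_{k=0}^\infty\beta(P+k).$$
   Context: Measures: $\mathbb{D}=\{|z|<1\}$; a probability measure on $\partial\mathbb{D}$ is non-trivial if its support is infinite; $\partial\mathbb{D}$ is identified with $[0,2\pi)$ via $\theta\mapsto e^{i\theta}$, and $d\mu=w(\theta)\frac{d\theta}{2\pi}+d\mu_{\rm sing}$ with $\mu_{\rm sing}$ singular. $\Phi_n$ are the monic orthogonal polynomials of $\mu$, $\Phi_n^*(z)=z^n\overline{\Phi_n(1/\bar z)}$, and the Verblunsky coefficients $\alpha_n\in\mathbb{D}$ ($n\ge0$) are defined by $\Phi_{n+1}(z)=z\Phi_n(z)-\bar\alpha_n\Phi_n^*(z)$; by convention $\alpha_{-1}=-1$ and $\alpha_n=0$ for $n\le -2$. By Szegő's theorem $\sum_{k\ge0}|\alpha_k|^2<\infty$ iff $\log w\in L^1(d\theta)$. Combinatorics: a collection is a finite multiset (unordered, repetitions allowed, identical elements indistinguishable) of couples $(k,a)$ with $k\in\mathbb{Z}$, $a\in\mathbb{N}=\{1,2,\dots\}$; the union of collections is the multiset sum, and $|P|$ is the number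 of elements counted with multiplicity. $M_m$ is the set of all collections $P=\{(k_1,a_1),\dots,(k_i,a_i)\}$ with $i\ge1$, $k_l\in\mathbb{Z}$, $a_l\ge 1$, $\sum_{l=1}^i a_l=m$. Put $\beta(P)=\alpha_{k_1}\bar\alpha_{k_1-a_1}\cdots\alpha_{k_i}\bar\alpha_{k_i-a_i}$. A collection is linear if $k_u<k_v-a_v$ or $k_v<k_u-a_u$ whenever $u\ne v$. For $j\ge1$, $N_j(P)$ is the number of distinct (ordered) $j$-tuples $[P_1,\dots,P_j]$ of non-empty linear collections with $\bigcup_{\ell=1}^jP_\ell=P$ (as union of collections), and $N(P)=\sum_{j=1}^{|P|}\frac{(-1)^j}{j}N_j(P)$. An integer $K$ is a cut of $P$ if $k_l\ne K$ for all $l$, $\min_l k_l<K<\max_l k_l$, and $k_u<k_v-a_v$ for all $u,v$ with $k_u<K<k_v$. Let $\omega(P)=\max_l k_l$. For $0\le n\le\infty$, $M_m^n$ is the set of $P\in M_m$ that have no cuts and satisfy $0\le\omega(P)\le n$ (for $n=\infty$: $0\le\omega(P)<\infty$); the set $M_m^0$ is finite. Finally $P+k=\{(k_l+k,a_l)\mid (k_l,a_l)\in P\}$. *)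

theory Defs
  imports "HOL-Probability.Probability" "HOL-Computational_Algebra.Polynomial"
begin

section \<open>Measures on the unit circle\<close>

definition circle_borel :: "complex measure" where
  "circle_borel = restrict_space borel (sphere 0 1)"

definition measure_support :: "complex measure \<Rightarrow> complex set" where
  "measure_support \<mu> = {z \<in> space \<mu>. \<forall>U. open U \<and> z \<in> U \<longrightarrow> emeasure \<mu> (U \<inter> space \<mu>) > 0}"

definition nontrivial_prob_on_circle :: "complex measure \<Rightarrow> bool" where
  "nontrivial_prob_on_circle \<mu> \<longleftrightarrow>
     prob_space \<mu> \<and> sets \<mu> = sets circle_borel \<and> infinite (measure_support \<mu>)"

text \<open>The measure \<open>d\<theta> / (2 \<pi>)\<close> on \<open>[0, 2 \<pi>)\<close>. Pushing forward along \<open>cis\<close> identifies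
  \<open>[0, 2 \<pi>)\<close> with the unit circle.\<close>

definition dtheta :: "real measure" where
  "dtheta = density (restrict_space lborel {0..<2*pi}) (\<lambda>_. ennreal (1 / (2*pi)))"

definition to_circle :: "real measure \<Rightarrow> complex measure" where
  "to_circle M = distr M circle_borel cis"

definition singular_on_circle :: "complex measure \<Rightarrow> bool" where
  "singular_on_circle \<nu> \<longleftrightarrow> (\<exists>A \<in> sets circle_borel.
     emeasure (to_circle dtheta) A = 0 \<and> emeasure \<nu> (space \<nu> - A) = 0)"

text \<open>\<open>d\<mu> = w d\<theta> / (2 \<pi>) + d\<mu>\<^sub>s\<^sub>i\<^sub>n\<^sub>g\<close>; this determines \<open>w\<close> almost everywhere.
  Only the values of \<open>w\<close> on \<open>[0, 2 \<pi>)\<close> matter.\<close>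

definition is_ac_density :: "complex measure \<Rightarrow> (real \<Rightarrow> real) \<Rightarrow> bool" where
  "is_ac_density \<mu> w \<longleftrightarrow>
     w \<in> borel_measurable (restrict_space borel {0..<2*pi}) \<and>
     (\<forall>\<theta>\<in>{0..<2*pi}. w \<theta> \<ge> 0) \<and>
     (\<exists>\<mu>s. sets \<mu>s = sets circle_borel \<and> singular_on_circle \<mu>s \<and>
        (\<forall>A \<in> sets circle_borel. emeasure \<mu> A =
           emeasure (to_circle (density dtheta (\<lambda>\<theta>. ennreal (w \<theta>)))) A + emeasure \<mu>s A))"

definition log_fourier :: "(real \<Rightarrow> real) \<Rightarrow> nat \<Rightarrow> complex" where
  "log_fourier w m = (LINT \<theta>|dtheta. exp (- (\<i> * of_nat m * of_real \<theta>)) * of_real (ln (w \<theta>)))"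


section \<open>Orthogonal polynomials and Verblunsky coefficients\<close>

definition is_monic_orthogonal :: "complex measure \<Rightarrow> (nat \<Rightarrow> complex poly) \<Rightarrow> bool" where
  "is_monic_orthogonal \<mu> \<Phi> \<longleftrightarrow>
     (\<forall>n. degree (\<Phi> n) = n \<and> lead_coeff (\<Phi> n) = 1) \<and>
     (\<forall>m n. m \<noteq> n \<longrightarrow> (LINT z|\<mu>. poly (\<Phi> n) z * cnj (poly (\<Phi> m) z)) = 0)"

text \<open>For non-trivial \<open>\<mu>\<close> there is exactly one such sequence.\<close>

definition monic_OP :: "complex measure \<Rightarrow> nat \<Rightarrow> complex poly" where
  "monic_OP \<mu> = (THE \<Phi>. is_monic_orthogonal \<mu> \<Phi>)"

text \<open>The formula below is the polynomial \<open>\<Phi>\<^sub>n\<^sup>*\<close> only for \<open>z \<noteq> 0\<close> (at \<open>z = 0\<close> it involves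
  \<open>1 / 0\<close>), which is why \<open>0\<close> is left out in the Szego recurrence that follows it;
  the recurrence at the points \<open>z \<noteq> 0\<close> is the identity of polynomials.\<close>

definition monic_OP_star :: "complex measure \<Rightarrow> nat \<Rightarrow> complex \<Rightarrow> complex" where
  "monic_OP_star \<mu> n z = z ^ n * cnj (poly (monic_OP \<mu> n) (1 / cnj z))"

definition verblunsky :: "complex measure \<Rightarrow> nat \<Rightarrow> complex" where
  "verblunsky \<mu> n = (THE a. \<forall>z. z \<noteq> 0 \<longrightarrow>
     poly (monic_OP \<mu> (Suc n)) z = z * poly (monic_OP \<mu> n) z - cnj a * monic_OP_star \<mu> n z)"

definition alpha :: "complex measure \<Rightarrow> int \<Rightarrow> complex" where
  "alpha \<mu> k = (if k \<ge> 0 then verblunsky \<mu> (nat k) else if k = -1 then -1 else 0)"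


section \<open>Collections\<close>

text \<open>Collections are multisets of couples \<open>(k, a)\<close>; the requirement \<open>a \<ge> 1\<close> is part of \<open>coll\<close>
  and is inherited by the parts of a decomposition in \<open>num_lin\<close>.\<close>

type_synonym collection = "(int \<times> nat) multiset"

definition coll :: "nat \<Rightarrow> collection set" where
  "coll m = {P. P \<noteq> {#} \<and> (\<forall>(k, a) \<in># P. a \<ge> 1) \<and> (\<Sum>(k, a) \<in># P. a) = m}"

definition beta :: "complex measure \<Rightarrow> collection \<Rightarrow> complex" where
  "beta \<mu> P = (\<Prod>(k, a) \<in># P. alpha \<mu> k * cnj (alpha \<mu> (k - int a)))"

text \<open>Removing one copy of the first couple renders \<open>u \<noteq> v\<close> as distinctness of positions: a
  collection containing a couple twice is not linear.\<close>

definition linear_coll :: "collection \<Rightarrow> bool" where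
  "linear_coll P \<longleftrightarrow> (\<forall>(k, a) \<in># P. \<forall>(l, b) \<in># P - {#(k, a)#}. k < l - int b \<or> l < k - int a)"

definition num_lin :: "nat \<Rightarrow> collection \<Rightarrow> nat" where
  "num_lin j P = card {Ps :: collection list.
     length Ps = j \<and> (\<forall>Q \<in> set Ps. Q \<noteq> {#} \<and> linear_coll Q) \<and> sum_list Ps = P}"

definition N_coeff :: "collection \<Rightarrow> real" where
  "N_coeff P = (\<Sum>j = 1..size P. (-1) ^ j / real j * real (num_lin j P))"

definition omega :: "collection \<Rightarrow> int" where
  "omega P = Max (fst ` set_mset P)"

definition is_cut :: "int \<Rightarrow> collection \<Rightarrow> bool" where
  "is_cut K P \<longleftrightarrow>
     (\<forall>(k, a) \<in># P. k \<noteq> K) \<and> Min (fst ` set_mset P) < K \<and> K < Max (fst ` set_mset P) \<and>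
     (\<forall>(k, a) \<in># P. \<forall>(l, b) \<in># P. k < K \<and> K < l \<longrightarrow> k < l - int b)"

definition cutless :: "nat \<Rightarrow> enat \<Rightarrow> collection set" where
  "cutless m n =
     {P \<in> coll m. (\<nexists>K. is_cut K P) \<and> 0 \<le> omega P \<and> enat (nat (omega P)) \<le> n}"

definition shift_coll :: "collection \<Rightarrow> int \<Rightarrow> collection" where
  "shift_coll P j = image_mset (\<lambda>(k, a). (k + j, a)) P"

lemma finite_cutless_0: "finite (cutless m 0)"
proof (rule finite_subset)
  let ?A = "{- int m..0} \<times> {1..m} :: (int \<times> nat) set"
  show "finite (\<Union>s\<in>{..m}. multisets_of_size ?A s)"
    by (intro finite_UN_I finite_multisets_of_size) auto
  show "cutless m 0 \<subseteq> (\<Union>s\<in>{..m}. multisets_of_size ?A s)"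
  proof
    fix P assume P: "P \<in> cutless m 0"
    then have ne: "P \<noteq> {#}" and pos: "\<And>k a. (k, a) \<in># P \<Longrightarrow> a \<ge> 1"
      and sm: "(\<Sum>(k, a) \<in># P. a) = m" and nocut: "\<And>K. \<not> is_cut K P"
      and om: "Max (fst ` set_mset P) = 0"
      by (auto simp: cutless_def coll_def omega_def enat_0_iff)
    have "size P = (\<Sum>x \<in># P. 1)" by simp
    also have "\<dots> \<le> (\<Sum>(k, a) \<in># P. a)"
      using pos by (intro sum_mset_mono) auto
    finally have sz: "size P \<le> m" using sm by simp
    have le: "a \<le> m" if "(k, a) \<in># P" for k a
      using sm multi_member_split[OF that] by auto
    let ?S = "fst ` set_mset P"
    let ?I = "\<lambda>(k, a). {k - int a<..k}"
    have fin: "finite ?S" "?S \<noteq> {}" using ne by auto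
    have cover: "{Min ?S..0} \<subseteq> (\<Union>x\<in>set_mset P. ?I x)"
    proof
      fix K assume K: "K \<in> {Min ?S..0}"
      show "K \<in> (\<Union>x\<in>set_mset P. ?I x)"
      proof (cases "K \<in> ?S")
        case True
        then obtain a where "(K, a) \<in># P" by force
        then show ?thesis using pos[of K a] by (intro UN_I[of "(K, a)"]) auto
      next
        case False
        then have "K \<noteq> Min ?S" "K \<noteq> Max ?S"
          using Min_in[OF fin] Max_in[OF fin] by auto
        then have "Min ?S < K" "K < Max ?S" using K om by auto
        moreover have "\<forall>x \<in># P. fst x \<noteq> K" using False by auto
        ultimately obtain x y where x: "x \<in># P" "fst x < K"
            and y: "y \<in># P" "K < fst y" "\<not> fst x < fst y - int (snd y)"
          using nocut[of K] unfolding is_cut_def case_prod_unfold by blast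
        then have "K \<in> ?I y" by (simp add: case_prod_unfold)
        then show ?thesis using y(1) by (rule UN_I[rotated])
      qed
    qed
    have "card {Min ?S..0} \<le> card (\<Union>x\<in>set_mset P. ?I x)"
      using cover by (intro card_mono) auto
    also have "\<dots> \<le> (\<Sum>x\<in>set_mset P. card (?I x))" by (rule card_UN_le) auto
    also have "\<dots> = (\<Sum>x\<in>set_mset P. snd x)" by (intro sum.cong) auto
    also have "\<dots> \<le> m"
    proof -
      obtain R where "P = mset_set (set_mset P) + R"
        using mset_set_set_mset_msubset mset_subset_eq_exists_conv by blast
      then have "(\<Sum>x\<in>#P. snd x) = (\<Sum>x\<in>set_mset P. snd x) + (\<Sum>x\<in>#R. snd x)"
        by (metis image_mset_union sum_mset.union sum_unfold_sum_mset)
      then show ?thesis using sm by (simp add: case_prod_unfold)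
    qed
    finally have "Min ?S \<ge> - int m" by simp
    then have bounds: "- int m \<le> k \<and> k \<le> 0" if "(k, a) \<in># P" for k a
    proof -
      have "k \<in> ?S" using that by (rule image_eqI[rotated]) simp
      then show ?thesis
        using Min_le[OF fin(1)] Max_ge[OF fin(1)] om \<open>- int m \<le> Min ?S\<close> by (metis order_trans)
    qed
    have "set_mset P \<subseteq> ?A"
      using pos le bounds by (auto simp: subset_iff)
    then show "P \<in> (\<Union>s\<in>{..m}. multisets_of_size ?A s)"
      using sz by (auto simp: multisets_of_size_def)
  qed
qed

end

theory Submission
  imports Defs "HOL-Complex_Analysis.Complex_Analysis"
begin

text \<open>
  Let \<open>B\<^sub>n = \<Phi>\<^sub>n\<^sup>*\<close> be the reversed orthogonal polynomials; \<open>B\<^sub>n 0 = 1\<close>. The theorem is obtained by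
  computing the coefficient of \<open>z ^ m\<close> in \<open>- log B\<^sub>n\<close> in two ways and letting \<open>n\<close> tend to infinity.

  Combinatorial side. With \<open>\<alpha>\<close> at \<open>-1\<close> equal to \<open>-1\<close>, unrolling the Szego recurrence gives
  \<open>B\<^sub>n\<^sub>+\<^sub>1 = B\<^sub>n + (\<Sum>a = 1..n + 1. \<alpha>\<^sub>n * cnj \<alpha>\<^sub>n\<^sub>-\<^sub>a * z ^ a * B\<^sub>n\<^sub>-\<^sub>a)\<close>, where \<open>B\<close> at \<open>-1\<close> is read as \<open>1\<close>.
  So \<open>B\<^sub>n\<close> is the sum of \<open>beta Q * z ^ weight Q\<close> over the linear collections \<open>Q\<close> whose first entries
  lie in \<open>{0..<n}\<close> (lemma \<open>szego_rev_linear\<close>; a couple \<open>(k, a)\<close> with \<open>k - a < -1\<close> contributes \<open>0\<close>).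
  Expanding \<open>log (1 + (B\<^sub>n - 1))\<close> as a power series turns products of linear collections into
  decompositions, and the coefficient of \<open>z ^ m\<close> in \<open>- log B\<^sub>n\<close> is the sum of \<open>N(P) * beta P\<close> over
  the collections \<open>P\<close> of weight \<open>m\<close> with first entries in \<open>{0..<n}\<close> (\<open>log_szego_rev_nth_box\<close>).
  Collections with a cut drop out, because then \<open>N(P) = 0\<close> (\<open>N_coeff_cut\<close>): the number of
  decompositions of \<open>P\<close> into \<open>j\<close> possibly empty linear collections is a polynomial in \<open>j\<close> which
  vanishes at \<open>0\<close> for \<open>P \<noteq> {#}\<close> and whose linear coefficient is \<open>- N(P)\<close>; across a cut this
  polynomial is the product of the polynomials of the two parts, hence divisible by \<open>j\<^sup>2\<close>.
  Collections without cuts are translates of the finitely many ones with \<open>\<omega>(P) = 0\<close>.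

  Analytic side. The coefficient of \<open>z ^ m\<close> in \<open>log B\<^sub>n\<close> is the \<open>m\<close>-th Fourier coefficient
  of \<open>log \<bar>B\<^sub>n\<bar>\<^sup>2\<close>, since \<open>B\<^sub>n\<close> has no zeros in the closed disc (\<open>log_poly_fourier\<close>). Put
  \<open>p\<^sub>n = (\<integral>\<bar>B\<^sub>n\<bar>\<^sup>2 d\<mu>) = (\<Prod>k<n. 1 - \<bar>\<alpha>\<^sub>k\<bar>\<^sup>2)\<close>; it decreases to a limit \<open>p\<close>, which is positive
  when \<open>\<Sum>\<bar>\<alpha>\<^sub>k\<bar>\<^sup>2\<close> converges. The function \<open>g\<^sub>n = \<bar>B\<^sub>n\<bar>\<^sup>2 * w / p\<^sub>n\<close> satisfies \<open>(\<integral>g\<^sub>n) \<le> 1\<close> and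
  \<open>(\<integral>log g\<^sub>n) = (\<integral>log w) - log p\<^sub>n\<close>. Once \<open>(\<integral>log w) \<ge> log p\<close> is known, the integral of the
  nonnegative function \<open>g\<^sub>n - 1 - log g\<^sub>n\<close> is at most \<open>log p\<^sub>n - log p\<close>, which forces \<open>log g\<^sub>n\<close> to \<open>0\<close> in mean,
  and with it the \<open>m\<close>-th Fourier coefficients of \<open>log w + log \<bar>B\<^sub>n\<bar>\<^sup>2\<close> (\<open>log_fourier_eq_lim\<close>).

  The inequality \<open>(\<integral>log w) \<ge> log p\<close>, together with the integrability of \<open>log w\<close>, is
  \<open>ln_density_integrable\<close>. It rests on the variational inequality \<open>(\<integral>exp T d\<mu>) \<ge> p * exp (\<integral>T)\<close>,
  the integral of \<open>T\<close> being taken over the circle with respect to \<open>d\<theta> / (2 \<pi>)\<close>. For \<open>T = Re H\<close> with a polynomial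
  \<open>H\<close> this follows from the extremal property \<open>(\<integral>\<bar>h\<bar>\<^sup>2 d\<mu>) \<ge> p * \<bar>h 0\<bar>\<^sup>2\<close> of polynomials \<open>h\<close>, applied to
  the Taylor polynomials of \<open>exp (H / 2)\<close>. It extends to continuous \<open>T\<close> by the Stone-Weierstrass
  theorem, to bounded Borel functions \<open>T\<close> by density in mean, and to functions bounded above by
  truncation. Choosing \<open>T = - log (w + \<epsilon>)\<close> off a null set that carries the singular part of \<open>\<mu>\<close>, and
  \<open>T\<close> very negative on that set, gives \<open>p \<le> exp (\<integral>log (w + \<epsilon>))\<close>; finally \<open>\<epsilon>\<close> tends to \<open>0\<close>.
\<close>

section \<open>Decompositions into linear collections\<close>

text \<open>The linear subcollections of \<open>P\<close>, the empty one included.\<close>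

definition linear_parts :: "collection \<Rightarrow> collection set" where
  "linear_parts P = {Q. Q \<subseteq># P \<and> linear_coll Q}"

text \<open>The number of ordered decompositions into \<open>j\<close> linear collections that may be empty;
  \<open>num_lin\<close> counts those with non-empty parts.\<close>

definition num_weak :: "nat \<Rightarrow> collection \<Rightarrow> nat" where
  "num_weak j P = card {Ps :: collection list.
     length Ps = j \<and> (\<forall>Q \<in> set Ps. linear_coll Q) \<and> sum_list Ps = P}"

lemma finite_submultisets: "finite {Q. Q \<subseteq># (P :: 'a multiset)}"
proof (induction P)
  case (add x P)
  have "{Q. Q \<subseteq># add_mset x P} \<subseteq> {Q. Q \<subseteq># P} \<union> add_mset x ` {Q. Q \<subseteq># P}"
  proof
    fix Q assume "Q \<in> {Q. Q \<subseteq># add_mset x P}"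
    then have Q: "Q \<subseteq># add_mset x P" by simp
    show "Q \<in> {Q. Q \<subseteq># P} \<union> add_mset x ` {Q. Q \<subseteq># P}"
    proof (cases "x \<in># Q")
      case True
      then obtain R where "Q = add_mset x R" by (metis insert_DiffM)
      with Q show ?thesis by auto
    next
      case False
      have "count Q y \<le> count P y" for y
        using Q False mset_subset_eq_count[OF Q, of y] by (cases "y = x") (auto simp: not_in_iff)
      then show ?thesis by (simp add: subseteq_mset_def)
    qed
  qed
  then show ?case using add by (meson finite_UnI finite_imageI finite_subset)
qed simp

lemma finite_linear_parts [simp]: "finite (linear_parts P)"
  unfolding linear_parts_def by (rule finite_subset[OF _ finite_submultisets[of P]]) auto

lemma linear_coll_empty [simp]: "linear_coll {#}"
  by (simp add: linear_coll_def)

lemma finite_decompositions: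
  "finite {Ps :: 'a multiset list. length Ps = j \<and> (\<forall>Q \<in> set Ps. p Q) \<and> sum_list Ps = P}"
proof (rule finite_subset)
  show "{Ps. length Ps = j \<and> (\<forall>Q \<in> set Ps. p Q) \<and> sum_list Ps = P}
      \<subseteq> {Ps. set Ps \<subseteq> {Q. Q \<subseteq># P} \<and> length Ps = j}"
    by (auto simp: in_set_conv_decomp)
  show "finite {Ps. set Ps \<subseteq> {Q. Q \<subseteq># P} \<and> length Ps = j}"
    using finite_submultisets by (rule finite_lists_length_eq)
qed

lemma card_decompositions_Suc:
  "card {Ps :: 'a multiset list. length Ps = Suc j \<and> (\<forall>Q \<in> set Ps. p Q) \<and> sum_list Ps = P}
   = (\<Sum>Q | Q \<subseteq># P \<and> p Q.
       card {Ps. length Ps = j \<and> (\<forall>Q \<in> set Ps. p Q) \<and> sum_list Ps = P - Q})"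
proof -
  define S where "S j P = {Ps :: 'a multiset list.
    length Ps = j \<and> (\<forall>Q \<in> set Ps. p Q) \<and> sum_list Ps = P}" for j P
  have "S (Suc j) P = (\<lambda>(Q, Ps). Q # Ps) ` (SIGMA Q:{Q. Q \<subseteq># P \<and> p Q}. S j (P - Q))"
  proof (intro subset_antisym subsetI)
    fix Ps assume "Ps \<in> S (Suc j) P"
    then obtain Q Ps' where "Ps = Q # Ps'" "length Ps' = j" "p Q" "\<forall>Q\<in>set Ps'. p Q"
      "P = Q + sum_list Ps'"
      by (auto simp: S_def length_Suc_conv)
    then show "Ps \<in> (\<lambda>(Q, Ps). Q # Ps) ` (SIGMA Q:{Q. Q \<subseteq># P \<and> p Q}. S j (P - Q))"
      by (intro image_eqI[of _ _ "(Q, Ps')"]) (auto simp: S_def)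
  qed (auto simp: S_def)
  moreover have "inj_on (\<lambda>(Q, Ps). Q # Ps) (SIGMA Q:{Q. Q \<subseteq># P \<and> p Q}. S j (P - Q))"
    by (auto simp: inj_on_def)
  ultimately have "card (S (Suc j) P) = card (SIGMA Q:{Q. Q \<subseteq># P \<and> p Q}. S j (P - Q))"
    by (simp add: card_image)
  also have "\<dots> = (\<Sum>Q | Q \<subseteq># P \<and> p Q. card (S j (P - Q)))"
    using finite_submultisets[of P]
    by (intro card_SigmaI) (auto simp: S_def intro: finite_decompositions rev_finite_subset)
  finally show ?thesis by (simp add: S_def)
qed

lemma num_weak_0: "num_weak 0 P = (if P = {#} then 1 else 0)"
proof -
  have "{Ps :: collection list. length Ps = 0 \<and> (\<forall>Q \<in> set Ps. linear_coll Q) \<and> sum_list Ps = P}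
    = (if P = {#} then {[]} else {})" by auto
  then show ?thesis by (simp add: num_weak_def)
qed

lemma num_lin_0: "num_lin 0 P = (if P = {#} then 1 else 0)"
proof -
  have "{Ps :: collection list. length Ps = 0 \<and> (\<forall>Q \<in> set Ps. Q \<noteq> {#} \<and> linear_coll Q) \<and>
      sum_list Ps = P} = (if P = {#} then {[]} else {})" by auto
  then show ?thesis by (simp add: num_lin_def)
qed

lemma num_weak_Suc: "num_weak (Suc j) P = (\<Sum>Q\<in>linear_parts P. num_weak j (P - Q))"
  unfolding num_weak_def linear_parts_def by (rule card_decompositions_Suc)

lemma num_lin_Suc: "num_lin (Suc j) P = (\<Sum>Q\<in>linear_parts P - {{#}}. num_lin j (P - Q))"
  unfolding num_lin_def card_decompositions_Suc
  by (rule sum.cong) (auto simp: linear_parts_def)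

lemma num_lin_eq_0: "size P < j \<Longrightarrow> num_lin j P = 0"
proof (induction j arbitrary: P)
  case (Suc j)
  have "num_lin j (P - Q) = 0" if "Q \<in> linear_parts P - {{#}}" for Q
  proof (rule Suc.IH)
    from that have "Q \<subseteq># P" "size Q \<noteq> 0" by (auto simp: linear_parts_def)
    then show "size (P - Q) < j"
      using Suc.prems size_mset_mono[of Q P] by (simp add: size_Diff_submset del: size_eq_0_iff_empty)
  qed
  then show ?case by (simp add: num_lin_Suc)
qed simp

text \<open>A decomposition with \<open>i\<close> non-empty parts is determined by these parts and by the positions
  that they take among \<open>{..<j}\<close>. The proof is by Pascal's rule, splitting off the first part.\<close>

lemma num_weak_binomial: "num_weak j P = (\<Sum>i\<le>j. (j choose i) * num_lin i P)"
proof (induction j arbitrary: P)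
  case 0
  show ?case by (simp add: num_weak_0 num_lin_0)
next
  case (Suc j)
  have "linear_parts P = insert {#} (linear_parts P - {{#}})"
    by (auto simp: linear_parts_def)
  then have "num_weak (Suc j) P = num_weak j P + (\<Sum>Q\<in>linear_parts P - {{#}}. num_weak j (P - Q))"
    unfolding num_weak_Suc by (subst (1) \<open>linear_parts P = _\<close>, subst sum.insert) auto
  also have "(\<Sum>Q\<in>linear_parts P - {{#}}. num_weak j (P - Q))
      = (\<Sum>i\<le>j. (j choose i) * num_lin (Suc i) P)"
    unfolding Suc.IH num_lin_Suc sum_distrib_left by (rule sum.swap)
  also have "num_weak j P = num_lin 0 P + (\<Sum>i\<le>j. (j choose Suc i) * num_lin (Suc i) P)"
    unfolding Suc.IH
    using sum.atMost_Suc_shift[of "\<lambda>i. (j choose i) * num_lin i P" j]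
    by (simp add: binomial_eq_0)
  finally have "num_weak (Suc j) P
      = num_lin 0 P + (\<Sum>i\<le>j. (Suc j choose Suc i) * num_lin (Suc i) P)"
    by (simp add: sum.distrib algebra_simps)
  also have "\<dots> = (\<Sum>i\<le>Suc j. (Suc j choose i) * num_lin i P)"
    by (subst sum.atMost_Suc_shift) simp
  finally show ?case .
qed

text \<open>The binomial coefficient as a polynomial in its upper argument.\<close>

definition binom_poly :: "nat \<Rightarrow> real poly" where
  "binom_poly i = smult (1 / fact i) (\<Prod>k<i. [:- of_nat k, 1:])"

lemma poly_binom_poly: "poly (binom_poly i) (of_nat j) = of_nat (j choose i)"
  by (simp add: binom_poly_def poly_prod binomial_gbinomial gbinomial_prod_rev atLeast0LessThan)

lemma coeff_binom_poly:
  "coeff (binom_poly (Suc i)) 0 = 0"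
  "coeff (binom_poly (Suc i)) (Suc 0) = (-1) ^ i / of_nat (Suc i)"
proof -
  have *: "(\<Prod>k<Suc i. [:- of_nat k, 1 :: real:]) = pCons 0 (\<Prod>k<i. [:- of_nat (Suc k), 1:])"
    by (subst prod.lessThan_Suc_shift) simp
  have **: "coeff (\<Prod>k<i. [:- of_nat (Suc k), 1 :: real:]) 0 = (-1) ^ i * fact i"
  proof -
    have "coeff (\<Prod>k<i. [:- of_nat (Suc k), 1 :: real:]) 0 = (\<Prod>k<i. - of_nat (Suc k))"
      by (simp add: poly_0_coeff_0[symmetric] poly_prod)
    also have "\<dots> = (-1) ^ i * fact i"
      by (induction i) (auto simp: algebra_simps)
    finally show ?thesis .
  qed
  show "coeff (binom_poly (Suc i)) 0 = 0"
    unfolding binom_poly_def * by simp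
  have "coeff (binom_poly (Suc i)) (Suc 0) = (-1) ^ i * fact i / fact (Suc i)"
    unfolding binom_poly_def * coeff_smult coeff_pCons_Suc ** by simp
  also have "\<dots> = (-1) ^ i / of_nat (Suc i)"
    unfolding fact_Suc by (simp del: of_nat_Suc)
  finally show "coeff (binom_poly (Suc i)) (Suc 0) = (-1) ^ i / of_nat (Suc i)" .
qed

text \<open>The polynomial whose value at \<open>j\<close> is \<open>num_weak j P\<close>.\<close>

definition weak_poly :: "collection \<Rightarrow> real poly" where
  "weak_poly P = (\<Sum>i\<le>size P. smult (of_nat (num_lin i P)) (binom_poly i))"

lemma poly_weak_poly: "poly (weak_poly P) (of_nat j) = of_nat (num_weak j P)"
proof -
  have "poly (weak_poly P) (of_nat j) = of_nat (\<Sum>i\<le>size P. (j choose i) * num_lin i P)"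
    by (simp add: weak_poly_def poly_sum poly_binom_poly mult.commute)
  also have "(\<Sum>i\<le>size P. (j choose i) * num_lin i P) = (\<Sum>i\<le>size P + j. (j choose i) * num_lin i P)"
    by (rule sum.mono_neutral_left) (auto simp: num_lin_eq_0)
  also have "\<dots> = (\<Sum>i\<le>j. (j choose i) * num_lin i P)"
    by (rule sum.mono_neutral_right) auto
  finally show ?thesis by (simp add: num_weak_binomial)
qed

text \<open>The derivative of \<open>x \<mapsto> x gchoose i\<close> at \<open>0\<close> is \<open>(-1) ^ (i - 1) / i\<close>, so that, up to
  the sign, the linear coefficient collects the weights in the definition of \<open>N_coeff\<close>.\<close>

lemma coeff_weak_poly:
  assumes "P \<noteq> {#}"
  shows "coeff (weak_poly P) 0 = 0" "coeff (weak_poly P) (Suc 0) = - N_coeff P"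
proof -
  obtain s where s: "size P = Suc s" using assms by (cases "size P") auto
  have *: "weak_poly P = (\<Sum>i\<le>s. smult (of_nat (num_lin (Suc i) P)) (binom_poly (Suc i)))"
    unfolding weak_poly_def s by (subst sum.atMost_Suc_shift) (simp add: num_lin_0 assms)
  show "coeff (weak_poly P) 0 = 0" by (simp add: * coeff_sum coeff_binom_poly)
  have "N_coeff P = (\<Sum>i\<le>s. (-1) ^ Suc i / real (Suc i) * real (num_lin (Suc i) P))"
    unfolding N_coeff_def s One_nat_def sum.shift_bounds_cl_Suc_ivl atLeast0AtMost ..
  then show "coeff (weak_poly P) (Suc 0) = - N_coeff P"
    unfolding * by (simp add: coeff_sum coeff_binom_poly sum_negf[symmetric] mult.commute)
qed

text \<open>The condition on two couples in the definition of a linear collection, as a symmetric relation.\<close>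

definition separated :: "(int \<times> nat) \<Rightarrow> (int \<times> nat) \<Rightarrow> bool" where
  "separated x y \<longleftrightarrow> fst x < fst y - int (snd y) \<or> fst y < fst x - int (snd x)"

lemma separated_sym: "separated x y = separated y x"
  by (auto simp: separated_def)

lemma linear_coll_separated:
  "linear_coll P \<longleftrightarrow> (\<forall>x\<in>#P. \<forall>y \<in># P - {#x#}. separated x y)"
  unfolding linear_coll_def separated_def by (auto simp: case_prod_unfold)

lemma linear_coll_add_mset:
  "linear_coll (add_mset x P) \<longleftrightarrow> (\<forall>y\<in>#P. separated x y) \<and> linear_coll P"
proof (intro iffI conjI ballI)
  assume L: "linear_coll (add_mset x P)"
  then show "separated x y" if "y \<in># P" for y
    using that by (auto simp: linear_coll_separated)
  show "linear_coll P"
    unfolding linear_coll_separated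
  proof (intro ballI)
    fix y z assume "y \<in># P" "z \<in># P - {#y#}"
    then have "y \<in># add_mset x P" "z \<in># add_mset x P - {#y#}"
      by (auto simp: diff_add_mset_swap in_diff_count split: if_splits)
    then show "separated y z" using L by (auto simp: linear_coll_separated)
  qed
next
  assume A: "(\<forall>y\<in>#P. separated x y) \<and> linear_coll P"
  show "linear_coll (add_mset x P)"
    unfolding linear_coll_separated
  proof (intro ballI)
    fix y z assume y: "y \<in># add_mset x P" and z: "z \<in># add_mset x P - {#y#}"
    show "separated y z"
    proof (cases "y = x")
      case True
      then show ?thesis using A z by simp
    next
      case False
      then have yP: "y \<in># P" using y by simp
      then have "add_mset x P - {#y#} = add_mset x (P - {#y#})"
        using False by simp
      then have "z = x \<or> z \<in># P - {#y#}" using z by auto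
      then show ?thesis
        using A yP separated_sym by (auto simp: linear_coll_separated)
    qed
  qed
qed

lemma linear_coll_union:
  "linear_coll (P + Q) \<longleftrightarrow> linear_coll P \<and> linear_coll Q \<and> (\<forall>x\<in>#P. \<forall>y\<in>#Q. separated x y)"
  by (induction P) (auto simp: linear_coll_add_mset)

text \<open>If all couples of \<open>P\<close> are separated from all couples of \<open>Q\<close>, linear subcollections of \<open>P + Q\<close>
  are the same as pairs of linear subcollections of \<open>P\<close> and of \<open>Q\<close>.\<close>

lemma num_weak_separated:
  assumes "\<forall>x\<in>#P. \<forall>y\<in>#Q. separated x y" "set_mset P \<inter> set_mset Q = {}"
  shows "num_weak j (P + Q) = num_weak j P * num_weak j Q"
  using assms
proof (induction j arbitrary: P Q)
  case 0
  show ?case by (simp add: num_weak_0)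
next
  case (Suc j)
  let ?f = "\<lambda>(A, B). A + B :: collection"
  have inj: "inj_on ?f (linear_parts P \<times> linear_parts Q)"
  proof (rule inj_on_inverseI[where g = "\<lambda>R. (R \<inter># P, R \<inter># Q)"])
    fix AB assume "AB \<in> linear_parts P \<times> linear_parts Q"
    then obtain A B where AB: "AB = (A, B)" "A \<in> linear_parts P" "B \<in> linear_parts Q" by auto
    then have sub: "A \<subseteq># P" "B \<subseteq># Q" by (auto simp: linear_parts_def)
    have c: "count P x = 0 \<or> count Q x = 0" for x
      using Suc.prems(2) by (metis IntI count_eq_zero_iff empty_iff)
    have le: "count A x \<le> count P x" "count B x \<le> count Q x" for x
      using sub by (auto intro: mset_subset_eq_count)
    have "count ((A + B) \<inter># P) x = count A x" "count ((A + B) \<inter># Q) x = count B x" for x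
      using c[of x] le[of x] by (auto simp: min_def)
    then have "(A + B) \<inter># P = A" "(A + B) \<inter># Q = B" by (auto intro: multiset_eqI)
    then show "(?f AB \<inter># P, ?f AB \<inter># Q) = AB" by (simp add: AB)
  qed
  have img: "?f ` (linear_parts P \<times> linear_parts Q) = linear_parts (P + Q)"
  proof (intro subset_antisym subsetI)
    fix R assume "R \<in> ?f ` (linear_parts P \<times> linear_parts Q)"
    then obtain A B where R: "R = A + B" "A \<subseteq># P" "B \<subseteq># Q" "linear_coll A" "linear_coll B"
      by (auto simp: linear_parts_def)
    have "\<forall>x\<in>#A. \<forall>y\<in>#B. separated x y"
      using R Suc.prems(1) by (meson mset_subset_eqD)
    then show "R \<in> linear_parts (P + Q)"
      using R by (simp add: linear_parts_def linear_coll_union subset_mset.add_mono)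
  next
    fix R assume "R \<in> linear_parts (P + Q)"
    then have R: "R \<subseteq># P + Q" "linear_coll R" by (auto simp: linear_parts_def)
    define A B where "A = R \<inter># P" and "B = R - A"
    have RAB: "R = A + B" unfolding B_def A_def by (rule multiset_eqI) simp
    have "count B x \<le> count Q x" for x
      using mset_subset_eq_count[OF R(1), of x] by (simp add: B_def A_def)
    then have "B \<subseteq># Q" by (simp add: subseteq_mset_def)
    moreover have "A \<subseteq># P" by (simp add: A_def)
    moreover have "linear_coll A" "linear_coll B" using R(2) RAB linear_coll_union by auto
    ultimately show "R \<in> ?f ` (linear_parts P \<times> linear_parts Q)"
      using RAB by (auto simp: linear_parts_def)
  qed
  have "num_weak (Suc j) (P + Q)
      = (\<Sum>(A, B)\<in>linear_parts P \<times> linear_parts Q. num_weak j (P + Q - (A + B)))"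
    unfolding num_weak_Suc img[symmetric] sum.reindex[OF inj] by (simp add: case_prod_unfold)
  also have "\<dots> = (\<Sum>(A, B)\<in>linear_parts P \<times> linear_parts Q. num_weak j (P - A) * num_weak j (Q - B))"
  proof (rule sum.cong, simp, clarify)
    fix A B assume AB: "A \<in> linear_parts P" "B \<in> linear_parts Q"
    then have sub: "A \<subseteq># P" "B \<subseteq># Q" by (auto simp: linear_parts_def)
    then have "count (P + Q - (A + B)) x = count ((P - A) + (Q - B)) x" for x
      using mset_subset_eq_count[OF sub(1), of x] mset_subset_eq_count[OF sub(2), of x] by simp
    then have "P + Q - (A + B) = (P - A) + (Q - B)" by (rule multiset_eqI)
    moreover have "num_weak j ((P - A) + (Q - B)) = num_weak j (P - A) * num_weak j (Q - B)"
      using Suc.prems by (intro Suc.IH) (auto dest!: in_diffD)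
    ultimately show "num_weak j (P + Q - (A + B)) = num_weak j (P - A) * num_weak j (Q - B)" by simp
  qed
  also have "\<dots> = num_weak (Suc j) P * num_weak (Suc j) Q"
    by (simp add: num_weak_Suc sum_product sum.cartesian_product)
  finally show ?case .
qed

text \<open>The polynomial of \<open>P + Q\<close> is a product of two polynomials without constant term, so it has
  no linear term.\<close>

lemma N_coeff_separated:
  assumes "\<forall>x\<in>#P. \<forall>y\<in>#Q. separated x y" "set_mset P \<inter> set_mset Q = {}" "P \<noteq> {#}" "Q \<noteq> {#}"
  shows "N_coeff (P + Q) = 0"
proof -
  have "weak_poly (P + Q) = weak_poly P * weak_poly Q"
  proof (rule ccontr)
    let ?d = "weak_poly (P + Q) - weak_poly P * weak_poly Q"
    assume "weak_poly (P + Q) \<noteq> weak_poly P * weak_poly Q"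
    then have "finite {x. poly ?d x = 0}" by (intro poly_roots_finite) simp
    moreover have "range (of_nat :: nat \<Rightarrow> real) \<subseteq> {x. poly ?d x = 0}"
      using num_weak_separated[OF assms(1,2)] by (auto simp: poly_weak_poly)
    moreover have "infinite (range (of_nat :: nat \<Rightarrow> real))"
      by (rule range_inj_infinite) (simp add: inj_on_def)
    ultimately show False using finite_subset by blast
  qed
  then have "coeff (weak_poly (P + Q)) (Suc 0) = 0"
    using assms(3,4) by (simp add: coeff_mult coeff_weak_poly)
  then show ?thesis using assms(3) by (simp add: coeff_weak_poly)
qed

lemma N_coeff_cut:
  assumes "is_cut K P" "P \<noteq> {#}"
  shows "N_coeff P = 0"
proof -
  \<comment> \<open>No couple has first entry \<open>K\<close>, so the cut splits \<open>P\<close> into two parts.\<close>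
  define A B where "A = filter_mset (\<lambda>x. fst x < K) P" and "B = filter_mset (\<lambda>x. \<not> fst x < K) P"
  have P: "P = A + B" by (simp add: A_def B_def multiset_partition)
  have fin: "finite (fst ` set_mset P)" "fst ` set_mset P \<noteq> {}" using assms(2) by auto
  obtain x where x: "Min (fst ` set_mset P) = fst x" "x \<in># P"
    using Min_in[OF fin] by (rule imageE)
  obtain y where y: "Max (fst ` set_mset P) = fst y" "y \<in># P"
    using Max_in[OF fin] by (rule imageE)
  have "fst x < K" "K < fst y" using assms(1) x(1) y(1) by (auto simp: is_cut_def)
  then have "x \<in># A" "y \<in># B" using x y by (auto simp: A_def B_def)
  then have "A \<noteq> {#}" "B \<noteq> {#}" by auto
  moreover have "set_mset A \<inter> set_mset B = {}" by (auto simp: A_def B_def)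
  moreover have "separated x y" if "x \<in># A" "y \<in># B" for x y
  proof -
    from that have "x \<in># P" "y \<in># P" "fst x < K" "\<not> fst y < K" by (auto simp: A_def B_def)
    moreover from this have "fst y \<noteq> K" using assms(1) by (auto simp: is_cut_def)
    ultimately have "fst x < fst y - int (snd y)"
      using assms(1) unfolding is_cut_def case_prod_unfold by (metis linorder_neqE_linordered_idom)
    then show ?thesis by (simp add: separated_def)
  qed
  ultimately show ?thesis unfolding P by (intro N_coeff_separated) auto
qed

section \<open>Translations of collections\<close>

lemma shift_coll_add [simp]: "shift_coll (P + Q) j = shift_coll P j + shift_coll Q j"
  by (simp add: shift_coll_def)

lemma shift_coll_empty [simp]: "shift_coll {#} j = {#}"
  by (simp add: shift_coll_def)

lemma shift_coll_shift_coll: "shift_coll (shift_coll P i) j = shift_coll P (i + j)"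
  by (simp add: shift_coll_def multiset.map_comp comp_def case_prod_unfold add.assoc)

lemma shift_coll_0 [simp]: "shift_coll P 0 = P"
  by (simp add: shift_coll_def case_prod_unfold)

lemma size_shift_coll [simp]: "size (shift_coll P j) = size P"
  by (simp add: shift_coll_def)

lemma shift_coll_eq_empty_iff [simp]: "shift_coll P j = {#} \<longleftrightarrow> P = {#}"
  by (simp add: shift_coll_def)

lemma linear_coll_shift [simp]: "linear_coll (shift_coll P j) = linear_coll P"
proof (induction P)
  case (add x P)
  have "shift_coll (add_mset x P) j = add_mset (fst x + j, snd x) (shift_coll P j)"
    by (simp add: shift_coll_def case_prod_unfold)
  then show ?case
    using add by (auto simp: linear_coll_add_mset shift_coll_def separated_def)
qed simp

lemma sum_list_shift: "sum_list (map (\<lambda>Q. shift_coll Q k) Ps) = shift_coll (sum_list Ps) k"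
  by (induction Ps) auto

lemma num_lin_shift [simp]: "num_lin j (shift_coll P k) = num_lin j P"
proof -
  have "bij_betw (map (\<lambda>Q. shift_coll Q k))
    {Ps. length Ps = j \<and> (\<forall>Q \<in> set Ps. Q \<noteq> {#} \<and> linear_coll Q) \<and> sum_list Ps = P}
    {Ps. length Ps = j \<and> (\<forall>Q \<in> set Ps. Q \<noteq> {#} \<and> linear_coll Q) \<and> sum_list Ps = shift_coll P k}"
    by (rule bij_betw_byWitness[where f' = "map (\<lambda>Q. shift_coll Q (- k))"])
       (auto simp: sum_list_shift shift_coll_shift_coll comp_def)
  then show ?thesis unfolding num_lin_def by (rule bij_betw_same_card[symmetric])
qed

lemma N_coeff_shift [simp]: "N_coeff (shift_coll P k) = N_coeff P"
  by (simp add: N_coeff_def)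

lemma fst_shift_coll: "fst ` set_mset (shift_coll P k) = (\<lambda>i. i + k) ` fst ` set_mset P"
  by (force simp: shift_coll_def)

lemma Max_shift_coll:
  assumes "P \<noteq> {#}"
  shows "Max (fst ` set_mset (shift_coll P k)) = Max (fst ` set_mset P) + k"
  unfolding fst_shift_coll
  by (rule mono_Max_commute[symmetric]) (simp_all add: monoI assms)

lemma Min_shift_coll:
  assumes "P \<noteq> {#}"
  shows "Min (fst ` set_mset (shift_coll P k)) = Min (fst ` set_mset P) + k"
  unfolding fst_shift_coll
  by (rule mono_Min_commute[symmetric]) (simp_all add: monoI assms)

lemma is_cut_shift: "P \<noteq> {#} \<Longrightarrow> is_cut K (shift_coll P k) \<longleftrightarrow> is_cut (K - k) P"
proof -
  have "fst x + k \<noteq> K \<longleftrightarrow> fst x \<noteq> K - k"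
    "(fst x + k < K \<and> K < fst y + k \<longrightarrow> fst x + k < fst y + k - int (snd y)) \<longleftrightarrow>
     (fst x < K - k \<and> K - k < fst y \<longrightarrow> fst x < fst y - int (snd y))"
    "Min (fst ` set_mset P) + k < K \<longleftrightarrow> Min (fst ` set_mset P) < K - k"
    "K < Max (fst ` set_mset P) + k \<longleftrightarrow> K - k < Max (fst ` set_mset P)"
    for x y :: "int \<times> nat"
    by linarith+
  moreover assume "P \<noteq> {#}"
  ultimately show ?thesis
    unfolding is_cut_def by (simp add: Max_shift_coll Min_shift_coll)
      (simp add: shift_coll_def case_prod_unfold)
qed

lemma coll_shift [simp]: "shift_coll P k \<in> coll m \<longleftrightarrow> P \<in> coll m"
  by (simp add: coll_def shift_coll_def case_prod_unfold multiset.map_comp comp_def)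

text \<open>A collection without cuts is a translate of exactly one with \<open>\<omega> = 0\<close>, the shift being its \<open>\<omega>\<close>.\<close>

lemma bij_betw_shift_cutless:
  "bij_betw (\<lambda>(P, k). shift_coll P (int k)) (cutless m 0 \<times> {k. k < n}) {P \<in> cutless m \<infinity>. omega P < int n}"
  "bij_betw (\<lambda>(P, k). shift_coll P (int k)) (cutless m 0 \<times> UNIV) (cutless m \<infinity>)"
proof -
  let ?f = "\<lambda>(P, k). shift_coll P (int k)"
  let ?g = "\<lambda>P. (shift_coll P (- omega P), nat (omega P))"
  have ne: "P \<noteq> {#}" if "P \<in> cutless m N" for P N
    using that by (auto simp: cutless_def coll_def)
  have om0: "omega P = 0" if "P \<in> cutless m 0" for P
    using that by (auto simp: cutless_def enat_0_iff)
  have om: "omega (shift_coll P k) = omega P + k" if "P \<noteq> {#}" for P k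
    using that by (simp add: omega_def Max_shift_coll)
  have gf: "?g (?f x) = x" if "x \<in> cutless m 0 \<times> UNIV" for x
    using that by (auto simp: om om0 ne shift_coll_shift_coll)
  have fg: "?f (?g P) = P" if "P \<in> cutless m \<infinity>" for P
    using that by (auto simp: shift_coll_shift_coll cutless_def)
  have f: "?f x \<in> cutless m \<infinity>" "omega (?f x) = int (snd x)" if x: "x \<in> cutless m 0 \<times> UNIV" for x
  proof -
    obtain P k where xk: "x = (P, k)" and P: "P \<in> cutless m 0" using x by auto
    have o: "omega (shift_coll P (int k)) = int k"
      unfolding om[OF ne[OF P]] om0[OF P] by (rule add_0)
    have "shift_coll P (int k) \<in> coll m" "\<not> is_cut K (shift_coll P (int k))" for K
      unfolding coll_shift is_cut_shift[OF ne[OF P]] using P unfolding cutless_def by blast+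
    then show "?f x \<in> cutless m \<infinity>" "omega (?f x) = int (snd x)"
      unfolding xk cutless_def by (simp_all add: o)
  qed
  have g: "?g P \<in> cutless m 0 \<times> UNIV" "int (snd (?g P)) = omega P" if "P \<in> cutless m \<infinity>" for P
  proof -
    have o: "omega (shift_coll P (- omega P)) = 0"
      unfolding om[OF ne[OF that]] by simp
    have "shift_coll P (- omega P) \<in> coll m" "\<not> is_cut K (shift_coll P (- omega P))" for K
      unfolding coll_shift is_cut_shift[OF ne[OF that]]
      using that unfolding cutless_def by blast+
    then show "?g P \<in> cutless m 0 \<times> UNIV"
      by (simp add: cutless_def o zero_enat_def[symmetric])
    show "int (snd (?g P)) = omega P" using that by (simp add: cutless_def)
  qed
  show "bij_betw ?f (cutless m 0 \<times> {k. k < n}) {P \<in> cutless m \<infinity>. omega P < int n}"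
  proof (rule bij_betw_byWitness[where f' = ?g])
    show "\<forall>x\<in>cutless m 0 \<times> {k. k < n}. ?g (?f x) = x"
      by (rule ballI, rule gf) auto
    show "\<forall>P\<in>{P \<in> cutless m \<infinity>. omega P < int n}. ?f (?g P) = P"
      by (rule ballI, rule fg) blast
    show "?f ` (cutless m 0 \<times> {k. k < n}) \<subseteq> {P \<in> cutless m \<infinity>. omega P < int n}"
    proof (rule image_subsetI)
      fix x assume "x \<in> cutless m 0 \<times> {k. k < n}"
      then show "?f x \<in> {P \<in> cutless m \<infinity>. omega P < int n}" using f[of x] by auto
    qed
    show "?g ` {P \<in> cutless m \<infinity>. omega P < int n} \<subseteq> cutless m 0 \<times> {k. k < n}"
    proof (rule image_subsetI)
      fix P assume "P \<in> {P \<in> cutless m \<infinity>. omega P < int n}"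
      then show "?g P \<in> cutless m 0 \<times> {k. k < n}" using g[of P]
        by (auto simp del: int_nat_eq)
    qed
  qed
  show "bij_betw ?f (cutless m 0 \<times> UNIV) (cutless m \<infinity>)"
  proof (rule bij_betw_byWitness[where f' = ?g])
    show "\<forall>x\<in>cutless m 0 \<times> UNIV. ?g (?f x) = x" by (rule ballI, rule gf)
    show "\<forall>P\<in>cutless m \<infinity>. ?f (?g P) = P" by (rule ballI, rule fg)
    show "?f ` (cutless m 0 \<times> UNIV) \<subseteq> cutless m \<infinity>" by (rule image_subsetI) (rule f(1))
    show "?g ` cutless m \<infinity> \<subseteq> cutless m 0 \<times> UNIV" by (rule image_subsetI) (rule g(1))
  qed
qed

section \<open>Reversed polynomials as sums over linear collections\<close>

text \<open>The Szego recurrence for coefficients \<open>v\<close>, run on the monic polynomials and the reversed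
  polynomials simultaneously. This makes the reversed polynomial a genuine polynomial, also at \<open>0\<close>.\<close>

primrec szego_pair :: "(nat \<Rightarrow> complex) \<Rightarrow> nat \<Rightarrow> complex poly \<times> complex poly" where
  "szego_pair v 0 = (1, 1)"
| "szego_pair v (Suc n) =
    (pCons 0 (fst (szego_pair v n)) - smult (cnj (v n)) (snd (szego_pair v n)),
     snd (szego_pair v n) - smult (v n) (pCons 0 (fst (szego_pair v n))))"

abbreviation "szego_poly v n \<equiv> fst (szego_pair v n)"
abbreviation "szego_rev v n \<equiv> snd (szego_pair v n)"

text \<open>The exponent \<open>\<Sum>a\<close> attached to a collection.\<close>

definition weight :: "collection \<Rightarrow> nat" where
  "weight P = (\<Sum>(k, a) \<in># P. a)"

lemma weight_simps [simp]:
  "weight {#} = 0" "weight (add_mset x P) = snd x + weight P" "weight (P + Q) = weight P + weight Q"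
  by (simp_all add: weight_def case_prod_unfold)

lemma beta_simps [simp]:
  "beta \<mu> {#} = 1"
  "beta \<mu> (add_mset x P) = alpha \<mu> (fst x) * cnj (alpha \<mu> (fst x - int (snd x))) * beta \<mu> P"
  "beta \<mu> (P + Q) = beta \<mu> P * beta \<mu> Q"
  by (simp_all add: beta_def case_prod_unfold)

text \<open>The couples \<open>(k, a)\<close> with \<open>a \<ge> 1\<close>, \<open>0 \<le> k < n\<close> and \<open>k - a \<ge> -1\<close>. All other couples with \<open>a \<ge> 1\<close>
  and \<open>k < n\<close> contribute a factor \<open>0\<close> to \<open>beta\<close>.\<close>

definition index_box :: "nat \<Rightarrow> (int \<times> nat) set" where
  "index_box n = {(k, a). 0 \<le> k \<and> k < int n \<and> 1 \<le> a \<and> int a \<le> k + 1}"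

text \<open>The linear collections with couples in \<open>index_box n\<close>, the empty one included.\<close>

definition lin_box :: "nat \<Rightarrow> collection set" where
  "lin_box n = {Q. linear_coll Q \<and> set_mset Q \<subseteq> index_box n}"

lemma finite_index_box [simp]: "finite (index_box n)"
  by (rule finite_subset[of _ "{0..int n} \<times> {..n}"]) (auto simp: index_box_def)

lemma linear_coll_count: 
  assumes "linear_coll Q" shows "count Q x \<le> 1"
proof (rule ccontr)
  assume "\<not> count Q x \<le> 1"
  then have "x \<in># Q" "x \<in># Q - {#x#}" by (auto simp: count_greater_zero_iff[symmetric] simp del: count_greater_zero_iff)
  then have "separated x x" using assms by (auto simp: linear_coll_separated)
  then show False by (simp add: separated_def)
qed

lemma finite_lin_box [simp]: "finite (lin_box n)"
proof (rule finite_subset)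
  show "lin_box n \<subseteq> {Q. Q \<subseteq># mset_set (index_box n)}"
  proof (clarify)
    fix Q assume Q: "Q \<in> lin_box n"
    have "count Q x \<le> count (mset_set (index_box n)) x" for x
    proof (cases "x \<in> index_box n")
      case False
      then have "x \<notin># Q" using Q by (auto simp: lin_box_def)
      then show ?thesis by (simp add: not_in_iff)
    qed (use Q linear_coll_count[of Q x] in \<open>simp add: lin_box_def\<close>)
    then show "Q \<subseteq># mset_set (index_box n)" by (simp add: subseteq_mset_def)
  qed
qed (rule finite_submultisets)

lemma index_box_Suc: "index_box (Suc n) = index_box n \<union> Pair (int n) ` {1..Suc n}"
  by (auto simp: index_box_def image_iff)

text \<open>A linear collection contains at most one couple \<open>(n, a)\<close> with the largest admissible first
  entry; the remaining couples then have first entries below \<open>n - a\<close>. For \<open>a = n + 1\<close> nothing remains,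
  in accordance with \<open>n - a = 0\<close> on the natural numbers.\<close>

lemma lin_box_Suc:
  "lin_box (Suc n) = lin_box n \<union> (\<Union>a\<in>{1..Suc n}. add_mset (int n, a) ` lin_box (n - a))"
proof (intro subset_antisym subsetI)
  fix Q assume Q: "Q \<in> lin_box (Suc n)"
  show "Q \<in> lin_box n \<union> (\<Union>a\<in>{1..Suc n}. add_mset (int n, a) ` lin_box (n - a))"
  proof (cases "Q \<in> lin_box n")
    case False
    then obtain x where "x \<in># Q" "x \<in> index_box (Suc n)" "x \<notin> index_box n"
      using Q by (auto simp: lin_box_def)
    then obtain a R where a: "a \<in> {1..Suc n}" and R: "Q = add_mset (int n, a) R"
      unfolding index_box_Suc by (metis Un_iff imageE mset_add)
    have "linear_coll R" and sep: "\<forall>y\<in>#R. separated (int n, a) y" and sub: "set_mset R \<subseteq> index_box (Suc n)"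
      using Q by (auto simp: R lin_box_def linear_coll_add_mset)
    moreover have "set_mset R \<subseteq> index_box (n - a)"
    proof
      fix y assume "y \<in># R"
      then have "separated (int n, a) y" "y \<in> index_box (Suc n)" using sep sub by auto
      then show "y \<in> index_box (n - a)"
        by (auto simp: separated_def index_box_def)
    qed
    ultimately have "R \<in> lin_box (n - a)" by (simp add: lin_box_def)
    then show ?thesis using a R by blast
  qed simp
next
  fix Q assume "Q \<in> lin_box n \<union> (\<Union>a\<in>{1..Suc n}. add_mset (int n, a) ` lin_box (n - a))"
  then consider "Q \<in> lin_box n" | a R where "a \<in> {1..Suc n}" "R \<in> lin_box (n - a)" "Q = add_mset (int n, a) R"
    by blast
  then show "Q \<in> lin_box (Suc n)"
  proof cases
    case 1
    then show ?thesis by (auto simp: lin_box_def index_box_def)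
  next
    case 2
    then have R: "linear_coll R" "set_mset R \<subseteq> index_box (n - a)" by (auto simp: lin_box_def)
    have "separated (int n, a) y" if "y \<in># R" for y
      using R(2) that by (auto simp: separated_def index_box_def)
    moreover have "set_mset R \<subseteq> index_box (Suc n)"
      using R(2) by (force simp: index_box_def)
    ultimately show ?thesis using 2 R
      by (auto simp: lin_box_def linear_coll_add_mset index_box_def)
  qed
qed

lemma pCons_0_sum: "pCons 0 (sum f A) = (\<Sum>x\<in>A. pCons 0 (f x :: 'a :: comm_semiring_1 poly))"
proof -
  have "pCons 0 (sum f A) = [:0, 1:] * sum f A" by simp
  also have "\<dots> = (\<Sum>x\<in>A. [:0, 1:] * f x)" by (rule sum_distrib_left)
  finally show ?thesis by simp
qed

text \<open>The recurrence unrolled down to the monic polynomial \<open>1\<close>. The summand \<open>a = n + 1\<close> is the initial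
  value: its coefficient is \<open>cnj (\<alpha>\<^sub>-\<^sub>1) = -1\<close>, and the truncated difference \<open>n - a = 0\<close> selects the
  reversed polynomial \<open>1\<close>.\<close>

lemma szego_poly_expand:
  "szego_poly (verblunsky \<mu>) n =
     - (\<Sum>a=1..Suc n. monom (cnj (alpha \<mu> (int n - int a))) (a - 1) * szego_rev (verblunsky \<mu>) (n - a))"
proof (induction n)
  case 0
  show ?case by (simp add: alpha_def monom_0 one_pCons)
next
  case (Suc n)
  let ?t = "\<lambda>n a. monom (cnj (alpha \<mu> (int n - int a))) (a - 1) * szego_rev (verblunsky \<mu>) (n - a)"
  have "pCons 0 (?t n a) = ?t (Suc n) (Suc a)" if "a \<ge> 1" for a
    using that by (cases a) (simp_all add: monom_Suc algebra_simps)
  then have "(\<Sum>a=1..Suc n. pCons 0 (?t n a)) = (\<Sum>a=1..Suc n. ?t (Suc n) (Suc a))"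
    by (intro sum.cong refl) simp
  then have "pCons 0 (szego_poly (verblunsky \<mu>) n) = - (\<Sum>a=1..Suc n. ?t (Suc n) (Suc a))"
  proof -
    have "pCons 0 (- p) = - pCons 0 p" for p :: "complex poly" by simp
    then show ?thesis
      unfolding Suc.IH using \<open>(\<Sum>a=1..Suc n. pCons 0 (?t n a)) = _\<close> by (simp only: pCons_0_sum)
  qed
  moreover have "(\<Sum>a=1..Suc (Suc n). ?t (Suc n) a) = ?t (Suc n) 1 + (\<Sum>a=1..Suc n. ?t (Suc n) (Suc a))"
  proof -
    have "{1..Suc (Suc n)} = insert 1 (Suc ` {1..Suc n})" by (simp add: image_Suc_atLeastAtMost atLeastAtMost_insertL)
    moreover have "sum (?t (Suc n)) (insert 1 (Suc ` {1..Suc n}))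
        = ?t (Suc n) 1 + sum (?t (Suc n)) (Suc ` {1..Suc n})"
      by (rule sum.insert) auto
    ultimately show ?thesis by (simp only: sum.reindex[OF inj_Suc[THEN inj_on_subset, OF subset_UNIV]] comp_def)
  qed
  moreover have "?t (Suc n) 1 = smult (cnj (verblunsky \<mu> n)) (szego_rev (verblunsky \<mu>) n)"
    by (simp add: alpha_def monom_0)
  ultimately show ?case by (simp del: sum.cl_ivl_Suc)
qed

lemma szego_rev_step:
  "szego_rev (verblunsky \<mu>) (Suc n) = szego_rev (verblunsky \<mu>) n +
     (\<Sum>a=1..Suc n. monom (alpha \<mu> (int n) * cnj (alpha \<mu> (int n - int a))) a * szego_rev (verblunsky \<mu>) (n - a))"
proof -
  let ?t = "\<lambda>a. monom (cnj (alpha \<mu> (int n - int a))) (a - 1) * szego_rev (verblunsky \<mu>) (n - a)"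
  have "smult (verblunsky \<mu> n) (pCons 0 (?t a))
      = monom (alpha \<mu> (int n) * cnj (alpha \<mu> (int n - int a))) a * szego_rev (verblunsky \<mu>) (n - a)"
    if "a \<ge> 1" for a
  proof -
    have "pCons 0 (?t a) = monom (cnj (alpha \<mu> (int n - int a))) a * szego_rev (verblunsky \<mu>) (n - a)"
      using that by (cases a) (simp_all add: monom_Suc algebra_simps)
    then show ?thesis by (simp add: smult_monom mult_smult_left[symmetric] alpha_def del: mult_smult_left)
  qed
  then have "(\<Sum>a=1..Suc n. smult (verblunsky \<mu> n) (pCons 0 (?t a)))
    = (\<Sum>a=1..Suc n. monom (alpha \<mu> (int n) * cnj (alpha \<mu> (int n - int a))) a * szego_rev (verblunsky \<mu>) (n - a))"
    by (intro sum.cong refl) simp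
  moreover have "(\<Sum>a=1..Suc n. smult (verblunsky \<mu> n) (pCons 0 (?t a)))
      = - smult (verblunsky \<mu> n) (pCons 0 (szego_poly (verblunsky \<mu>) n))"
  proof -
    have "(\<Sum>a=1..Suc n. smult (verblunsky \<mu> n) (pCons 0 (?t a)))
        = (\<Sum>a=1..Suc n. [:0, verblunsky \<mu> n:] * ?t a)"
      by (intro sum.cong refl) simp
    also have "\<dots> = [:0, verblunsky \<mu> n:] * - szego_poly (verblunsky \<mu>) n"
      unfolding szego_poly_expand minus_minus by (rule sum_distrib_left[symmetric])
    finally show ?thesis by simp
  qed
  ultimately show ?thesis by simp
qed

lemma szego_rev_linear:
  "szego_rev (verblunsky \<mu>) n = (\<Sum>Q\<in>lin_box n. monom (beta \<mu> Q) (weight Q))"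
proof (induction n rule: less_induct)
  case (less n)
  show ?case
  proof (cases n)
    case 0
    have "index_box 0 = {}" by (auto simp: index_box_def)
    then have "lin_box 0 = {{#}}" by (auto simp: lin_box_def)
    then show ?thesis by (simp add: 0 one_pCons monom_0)
  next
    case (Suc k)
    let ?g = "\<lambda>Q. monom (beta \<mu> Q) (weight Q)"
    have "sum ?g (lin_box n) = sum ?g (lin_box k) + sum ?g (\<Union>a\<in>{1..Suc k}. add_mset (int k, a) ` lin_box (k - a))"
      unfolding Suc lin_box_Suc
    proof (rule sum.union_disjoint)
      show "lin_box k \<inter> (\<Union>a\<in>{1..Suc k}. add_mset (int k, a) ` lin_box (k - a)) = {}"
        by (auto simp: lin_box_def index_box_def)
    qed simp_all
    also have "sum ?g (\<Union>a\<in>{1..Suc k}. add_mset (int k, a) ` lin_box (k - a))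
        = (\<Sum>a=1..Suc k. sum ?g (add_mset (int k, a) ` lin_box (k - a)))"
    proof (rule sum.UNION_disjoint, simp, simp, intro ballI impI)
      fix a b :: nat assume "a \<noteq> b"
      show "add_mset (int k, a) ` lin_box (k - a) \<inter> add_mset (int k, b) ` lin_box (k - b) = {}"
      proof (rule ccontr)
        assume "add_mset (int k, a) ` lin_box (k - a) \<inter> add_mset (int k, b) ` lin_box (k - b) \<noteq> {}"
        then obtain Q R where "Q \<in> lin_box (k - a)" "add_mset (int k, a) Q = add_mset (int k, b) R"
          by blast
        then have "(int k, b) \<in># Q" using \<open>a \<noteq> b\<close>
          by (metis Pair_inject insert_noteq_member union_single_eq_member)
        then show False using \<open>Q \<in> lin_box (k - a)\<close> by (auto simp: lin_box_def index_box_def)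
      qed
    qed
    also have "\<dots> = (\<Sum>a=1..Suc k. monom (alpha \<mu> (int k) * cnj (alpha \<mu> (int k - int a))) a * szego_rev (verblunsky \<mu>) (k - a))"
    proof (rule sum.cong[OF refl])
      fix a
      have "sum ?g (add_mset (int k, a) ` lin_box (k - a))
          = (\<Sum>Q\<in>lin_box (k - a). ?g (add_mset (int k, a) Q))"
        by (subst sum.reindex) (auto simp: inj_on_def)
      also have "\<dots> = (\<Sum>Q\<in>lin_box (k - a). monom (alpha \<mu> (int k) * cnj (alpha \<mu> (int k - int a))) a * ?g Q)"
        by (simp add: mult_monom mult.assoc)
      also have "\<dots> = monom (alpha \<mu> (int k) * cnj (alpha \<mu> (int k - int a))) a * szego_rev (verblunsky \<mu>) (k - a)"
        using less.IH[of "k - a"] Suc by (simp add: sum_distrib_left)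
      finally show "sum ?g (add_mset (int k, a) ` lin_box (k - a)) = \<dots>" .
    qed
    finally show ?thesis using less.IH[of k] Suc by (simp only: szego_rev_step lessI)
  qed
qed

text \<open>The collections of weight \<open>m\<close> with couples in \<open>index_box n\<close>.\<close>

definition box_coll :: "nat \<Rightarrow> nat \<Rightarrow> collection set" where
  "box_coll n m = {P. set_mset P \<subseteq> index_box n \<and> weight P = m}"

lemma size_le_weight:
  assumes "\<And>x. x \<in># P \<Longrightarrow> snd x \<ge> 1" shows "size P \<le> weight P"
  using assms by (induction P) (auto, fastforce)

lemma size_le_box_coll: "P \<in> box_coll n m \<Longrightarrow> size P \<le> m"
  using size_le_weight[of P] by (force simp: box_coll_def index_box_def)

lemma finite_box_coll [simp]: "finite (box_coll n m)"
proof (rule finite_subset)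
  show "box_coll n m \<subseteq> (\<Union>s\<in>{..m}. multisets_of_size (index_box n) s)"
    using size_le_box_coll by (auto simp: multisets_of_size_def box_coll_def)
qed (auto intro: finite_multisets_of_size)

lemma szego_rev_minus_1_nth:
  "fps_nth (fps_of_poly (szego_rev (verblunsky \<mu>) n) - 1) i
     = (\<Sum>Q\<in>{Q \<in> lin_box n. Q \<noteq> {#} \<and> weight Q = i}. beta \<mu> Q)"
proof -
  have "{#} \<in> lin_box n" by (simp add: lin_box_def)
  then have "fps_of_poly (szego_rev (verblunsky \<mu>) n) - 1
      = (\<Sum>Q\<in>lin_box n - {{#}}. fps_of_poly (monom (beta \<mu> Q) (weight Q)))"
    unfolding szego_rev_linear fps_of_poly_sum
    by (subst sum.remove[of _ "{#}"]) (auto simp: monom_0 fps_of_poly_const)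
  then have "fps_nth (fps_of_poly (szego_rev (verblunsky \<mu>) n) - 1) i
      = (\<Sum>Q\<in>lin_box n - {{#}}. if weight Q = i then beta \<mu> Q else 0)"
    by (simp add: fps_sum_nth fps_of_poly_nth del: fps_of_poly_monom)
  also have "\<dots> = (\<Sum>Q\<in>{Q \<in> lin_box n - {{#}}. weight Q = i}. beta \<mu> Q)"
    by (rule sum.inter_filter[symmetric]) simp
  finally show ?thesis by (simp add: conj_assoc Diff_iff cong: conj_cong)
qed

text \<open>A product of \<open>j\<close> non-constant terms of the reversed polynomial is a decomposition into \<open>j\<close>
  non-empty linear collections.\<close>

lemma szego_rev_minus_1_power_nth:
  "fps_nth ((fps_of_poly (szego_rev (verblunsky \<mu>) n) - 1) ^ j) m
     = (\<Sum>P\<in>box_coll n m. of_nat (num_lin j P) * beta \<mu> P)"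
proof (induction j arbitrary: m)
  case 0
  have "(\<Sum>P\<in>box_coll n m. of_nat (num_lin 0 P) * beta \<mu> P)
      = (\<Sum>P\<in>box_coll n m. if P = {#} then 1 else 0)"
    by (intro sum.cong) (auto simp: num_lin_0)
  also have "\<dots> = (if m = 0 then 1 else 0)"
    by (subst sum.delta[OF finite_box_coll]) (auto simp: box_coll_def)
  finally show ?case by simp
next
  case (Suc j)
  define LI where "LI i = {Q \<in> lin_box n. Q \<noteq> {#} \<and> weight Q = i}" for i
  have fin [simp]: "finite (LI i)" for i by (simp add: LI_def)
  have "fps_nth ((fps_of_poly (szego_rev (verblunsky \<mu>) n) - 1) ^ Suc j) m
     = (\<Sum>i=0..m. (\<Sum>Q\<in>LI i. beta \<mu> Q) *
           (\<Sum>R\<in>box_coll n (m - i). of_nat (num_lin j R) * beta \<mu> R))"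
    by (simp only: power_Suc fps_mult_nth Suc.IH szego_rev_minus_1_nth LI_def)
  also have "\<dots> = (\<Sum>i=0..m. \<Sum>Q\<in>LI i. \<Sum>R\<in>box_coll n (m - i). of_nat (num_lin j R) * beta \<mu> (Q + R))"
    by (intro sum.cong refl, subst sum_product) (simp add: mult_ac)
  also have "\<dots> = (\<Sum>(i, Q, R)\<in>(SIGMA i:{0..m}. SIGMA Q:LI i. box_coll n (m - i)).
      of_nat (num_lin j R) * beta \<mu> (Q + R))"
    by (simp add: sum.Sigma case_prod_unfold)
  also have "\<dots> = (\<Sum>(P, Q)\<in>(SIGMA P:box_coll n m. linear_parts P - {{#}}).
      of_nat (num_lin j (P - Q)) * beta \<mu> P)"
  proof (rule sum.reindex_bij_witness[where i = "\<lambda>(P, Q). (weight Q, Q, P - Q)"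
        and j = "\<lambda>(i, Q, R). (Q + R, Q)"])
    fix x assume "x \<in> (SIGMA P:box_coll n m. linear_parts P - {{#}})"
    then obtain P Q where x: "x = (P, Q)" "P \<in> box_coll n m" "Q \<subseteq># P" "linear_coll Q" "Q \<noteq> {#}"
      by (auto simp: linear_parts_def)
    have "weight P = weight Q + weight (P - Q)"
      using x(3) by (metis subset_mset.add_diff_inverse weight_simps(3))
    then show "(case x of (P, Q) \<Rightarrow> (weight Q, Q, P - Q)) \<in> (SIGMA i:{0..m}. SIGMA Q:LI i. box_coll n (m - i))"
      using x by (auto simp: LI_def box_coll_def lin_box_def dest: in_diffD mset_subset_eqD)
    show "(case case x of (P, Q) \<Rightarrow> (weight Q, Q, P - Q) of (i, Q, R) \<Rightarrow> (Q + R, Q)) = x"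
      using x by simp
  qed (auto simp: LI_def box_coll_def lin_box_def linear_parts_def)
  also have "\<dots> = (\<Sum>P\<in>box_coll n m. \<Sum>Q\<in>linear_parts P - {{#}}. of_nat (num_lin j (P - Q)) * beta \<mu> P)"
    by (subst sum.Sigma) auto
  also have "\<dots> = (\<Sum>P\<in>box_coll n m. of_nat (num_lin (Suc j) P) * beta \<mu> P)"
    by (simp add: num_lin_Suc sum_distrib_right)
  finally show ?case .
qed

lemma log_szego_rev_nth_box:
  assumes "m \<ge> 1"
  shows "fps_nth (fps_ln 1 oo (fps_of_poly (szego_rev (verblunsky \<mu>) n) - 1)) m
     = - (\<Sum>P\<in>box_coll n m. of_real (N_coeff P) * beta \<mu> P)"
proof -
  have ln: "fps_nth (fps_ln (1 :: complex)) i = - ((-1) ^ i / of_nat i)" for i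
    by (cases i) (simp_all add: fps_ln_def)
  have "fps_nth (fps_ln 1 oo (fps_of_poly (szego_rev (verblunsky \<mu>) n) - 1)) m
     = (\<Sum>i=0..m. - ((-1) ^ i / of_nat i) * (\<Sum>P\<in>box_coll n m. of_nat (num_lin i P) * beta \<mu> P))"
    by (simp only: fps_compose_nth szego_rev_minus_1_power_nth ln)
  also have "\<dots> = (\<Sum>P\<in>box_coll n m. \<Sum>i=0..m. - ((-1) ^ i / of_nat i) * (of_nat (num_lin i P) * beta \<mu> P))"
    unfolding sum_distrib_left by (rule sum.swap)
  also have "\<dots> = (\<Sum>P\<in>box_coll n m. - (of_real (N_coeff P) * beta \<mu> P))"
  proof (rule sum.cong[OF refl])
    fix P assume P: "P \<in> box_coll n m"
    have "N_coeff P = (\<Sum>i=0..m. (-1) ^ i / real i * real (num_lin i P))"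
      unfolding N_coeff_def
      by (rule sum.mono_neutral_left)
         (use size_le_box_coll[OF P] in \<open>auto simp: num_lin_eq_0 not_less_eq_eq\<close>)
    then have "of_real (N_coeff P) * beta \<mu> P
        = (\<Sum>i=0..m. (-1) ^ i / of_nat i * of_nat (num_lin i P) * beta \<mu> P)"
      by (simp add: sum_distrib_right)
    then show "(\<Sum>i=0..m. - ((-1) ^ i / of_nat i) * (of_nat (num_lin i P) * beta \<mu> P))
        = - (of_real (N_coeff P) * beta \<mu> P)"
      by (simp add: sum_negf[symmetric] mult_ac)
  qed
  finally show ?thesis by (simp add: sum_negf)
qed

lemma beta_eq_0:
  assumes "x \<in># P" "snd x \<ge> 1" "fst x < 0 \<or> int (snd x) > fst x + 1"
  shows "beta \<mu> P = 0"
proof -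
  obtain R where R: "P = add_mset x R" using assms(1) by (metis insert_DiffM)
  have "alpha \<mu> (fst x) = 0 \<or> alpha \<mu> (fst x - int (snd x)) = 0"
    using assms(2,3) by (auto simp: alpha_def)
  then show ?thesis by (auto simp: R)
qed

text \<open>In the sum over \<open>box_coll n m\<close> the collections with a cut have \<open>N(P) = 0\<close>, and the collections with
  \<open>\<omega>(P) < n\<close> that are not in the box have \<open>beta P = 0\<close>; what remains is grouped by translates.\<close>

lemma log_szego_rev_nth:
  assumes "m \<ge> 1"
  shows "fps_nth (fps_ln 1 oo (fps_of_poly (szego_rev (verblunsky \<mu>) n) - 1)) m
     = - (\<Sum>P\<in>cutless m 0. of_real (N_coeff P) * (\<Sum>k<n. beta \<mu> (shift_coll P (int k))))"
proof -
  let ?g = "\<lambda>P. of_real (N_coeff P) * beta \<mu> P"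
  let ?D = "{P \<in> cutless m \<infinity>. omega P < int n}"
  have finD: "finite ?D"
    using bij_betw_finite[OF bij_betw_shift_cutless(1)[of m n]] finite_cutless_0[of m] by simp
  have "sum ?g (box_coll n m) = sum ?g (box_coll n m \<inter> ?D)"
  proof (rule sum.mono_neutral_right)
    show "\<forall>P\<in>box_coll n m - box_coll n m \<inter> ?D. ?g P = 0"
    proof
      fix P assume P: "P \<in> box_coll n m - box_coll n m \<inter> ?D"
      then have sub: "set_mset P \<subseteq> index_box n" and w: "weight P = m" by (auto simp: box_coll_def)
      then have ne: "P \<noteq> {#}" using assms by auto
      have c: "P \<in> coll m" using sub w ne by (auto simp: coll_def index_box_def weight_def)
      have "omega P \<in> fst ` set_mset P" unfolding omega_def by (rule Max_in) (use ne in auto)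
      then have "0 \<le> omega P" "omega P < int n" using sub by (auto simp: index_box_def)
      then have "\<exists>K. is_cut K P" using P c by (auto simp: cutless_def)
      then show "?g P = 0" using N_coeff_cut ne by auto
    qed
  qed auto
  also have "\<dots> = sum ?g ?D"
  proof (rule sum.mono_neutral_left[OF finD])
    show "\<forall>P\<in>?D - box_coll n m \<inter> ?D. ?g P = 0"
    proof
      fix P assume P: "P \<in> ?D - box_coll n m \<inter> ?D"
      then have c: "P \<in> coll m" and o: "omega P < int n" by (auto simp: cutless_def)
      then have "\<not> set_mset P \<subseteq> index_box n" using P by (auto simp: box_coll_def coll_def weight_def)
      then obtain x where x: "x \<in># P" "x \<notin> index_box n" by auto
      have "snd x \<ge> 1" using c x(1) by (auto simp: coll_def)
      moreover have "fst x \<le> omega P" unfolding omega_def by (rule Max_ge) (use x in auto)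
      ultimately have "beta \<mu> P = 0"
        using x o by (intro beta_eq_0[of x]) (auto simp: index_box_def case_prod_unfold)
      then show "?g P = 0" by simp
    qed
  qed auto
  also have "\<dots> = (\<Sum>(P, k)\<in>cutless m 0 \<times> {k. k < n}. ?g (shift_coll P (int k)))"
    unfolding sum.reindex_bij_betw[OF bij_betw_shift_cutless(1), symmetric] by (simp add: case_prod_unfold)
  also have "\<dots> = (\<Sum>P\<in>cutless m 0. of_real (N_coeff P) * (\<Sum>k<n. beta \<mu> (shift_coll P (int k))))"
    by (simp add: sum.cartesian_product[symmetric] sum_distrib_left lessThan_def)
  finally show ?thesis using log_szego_rev_nth_box[OF assms] by simp
qed

section \<open>Summation over collections without cuts\<close>

lemma summable_int_shift:
  fixes f :: "int \<Rightarrow> real"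
  assumes "summable (\<lambda>k. f (int k))"
  shows "summable (\<lambda>k. f (int k + j))"
proof (cases "j \<ge> 0")
  case True
  then show ?thesis using summable_ignore_initial_segment[OF assms, of "nat j"] by simp
next
  case False
  have "summable (\<lambda>k. f (int (k + nat (- j)) + j))" using False assms by simp
  then show ?thesis by (rule summable_iff_shift[THEN iffD1])
qed

text \<open>Already one couple \<open>(k, a)\<close> yields two factors \<open>\<alpha>\<close>, whose product is dominated by a sum of squares.\<close>

lemma summable_beta_shift:
  assumes le: "\<And>k. norm (alpha \<mu> k) \<le> 1" and sum: "summable (\<lambda>k. (norm (verblunsky \<mu> k))\<^sup>2)"
    and "P \<noteq> {#}"
  shows "summable (\<lambda>k. norm (beta \<mu> (shift_coll P (int k))))"
proof -
  obtain x R where P: "P = add_mset x R" using assms(3) by (metis multiset_cases)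
  have b1: "norm (beta \<mu> Q) \<le> 1" for Q
    by (induction Q) (auto simp: norm_mult intro!: mult_le_one le)
  have "(\<lambda>k. (norm (alpha \<mu> (int k)))\<^sup>2) = (\<lambda>k. (norm (verblunsky \<mu> k))\<^sup>2)"
    by (simp add: alpha_def)
  then have s: "summable (\<lambda>k. (norm (alpha \<mu> (int k + j)))\<^sup>2)" for j
    using sum summable_int_shift[of "\<lambda>k. (norm (alpha \<mu> k))\<^sup>2" j] by simp
  show ?thesis
  proof (rule summable_comparison_test')
    show "summable (\<lambda>k. (norm (alpha \<mu> (int k + fst x)))\<^sup>2 + (norm (alpha \<mu> (int k + (fst x - int (snd x)))))\<^sup>2)"
      by (intro summable_add s)
    fix k :: nat assume "k \<ge> 0"
    let ?a = "norm (alpha \<mu> (int k + fst x))" and ?b = "norm (alpha \<mu> (int k + (fst x - int (snd x))))"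
    have "shift_coll P (int k) = add_mset (fst x + int k, snd x) (shift_coll R (int k))"
      by (simp add: P shift_coll_def case_prod_unfold)
    then have "norm (beta \<mu> (shift_coll P (int k))) = ?a * ?b * norm (beta \<mu> (shift_coll R (int k)))"
      by (simp add: norm_mult algebra_simps)
    also have "\<dots> \<le> ?a * ?b * 1" by (intro mult_left_mono b1) simp
    also have "\<dots> \<le> ?a\<^sup>2 + ?b\<^sup>2"
    proof -
      have "2 * (?a * ?b) \<le> ?a\<^sup>2 + ?b\<^sup>2" using sum_squares_bound[of ?a ?b] by (simp add: mult.assoc)
      moreover have "0 \<le> ?a * ?b" by simp
      ultimately show ?thesis by linarith
    qed
    finally show "norm (norm (beta \<mu> (shift_coll P (int k)))) \<le> ?a\<^sup>2 + ?b\<^sup>2" by simp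
  qed
qed

lemma has_sum_cutless:
  assumes le: "\<And>k. norm (alpha \<mu> k) \<le> 1" and sum: "summable (\<lambda>k. (norm (verblunsky \<mu> k))\<^sup>2)"
  shows "((\<lambda>P. of_real (N_coeff P) * beta \<mu> P) has_sum
    (\<Sum>P \<in> cutless m 0. of_real (N_coeff P) * (\<Sum>k. beta \<mu> (shift_coll P (int k))))) (cutless m \<infinity>)"
proof -
  let ?f = "\<lambda>(P, k). of_real (N_coeff P) * beta \<mu> (shift_coll P (int k))"
  have ne: "P \<noteq> {#}" if "P \<in> cutless m 0" for P using that by (auto simp: cutless_def coll_def)
  have sn: "summable (\<lambda>k. norm (?f (P, k)))" if "P \<in> cutless m 0" for P
    using summable_mult[OF summable_beta_shift[OF assms ne[OF that]], of "\<bar>N_coeff P\<bar>"]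
    by (simp add: norm_mult)
  have hs: "((\<lambda>k. ?f (P, k)) has_sum of_real (N_coeff P) * (\<Sum>k. beta \<mu> (shift_coll P (int k)))) UNIV"
    if "P \<in> cutless m 0" for P
  proof (rule norm_summable_imp_has_sum[OF sn[OF that]])
    show "(\<lambda>k. ?f (P, k)) sums (of_real (N_coeff P) * (\<Sum>k. beta \<mu> (shift_coll P (int k))))"
      using summable_norm_cancel[OF summable_beta_shift[OF assms ne[OF that]]]
      by (simp add: sums_mult summable_sums)
  qed
  have an: "(\<lambda>k. norm (?f (P, k))) summable_on UNIV" if "P \<in> cutless m 0" for P
    using norm_summable_imp_summable_on[of "\<lambda>k. norm (?f (P, k))"] sn[OF that] by simp
  have "(\<lambda>x. norm (?f x)) summable_on (cutless m 0 \<times> UNIV)"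
    by (rule summable_on_SigmaI[where g = "\<lambda>P. \<Sum>\<^sub>\<infinity>k. norm (?f (P, k))"])
       (auto intro!: has_sum_infsum an[unfolded prod.case] simp: finite_cutless_0)
  then have "?f summable_on (cutless m 0 \<times> UNIV)"
    by (rule abs_summable_summable)
  then have "(?f has_sum (\<Sum>P \<in> cutless m 0. of_real (N_coeff P) * (\<Sum>k. beta \<mu> (shift_coll P (int k)))))
      (cutless m 0 \<times> UNIV)"
    by (rule has_sum_SigmaI[OF hs, rotated 2]) (simp_all add: has_sum_finite finite_cutless_0)
  also have "?f = (\<lambda>x. (\<lambda>P. of_real (N_coeff P) * beta \<mu> P) ((\<lambda>(P, k). shift_coll P (int k)) x))"
    by (auto simp: fun_eq_iff)
  finally show ?thesis
    by (rule has_sum_reindex_bij_betw[OF bij_betw_shift_cutless(2), THEN iffD1])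
qed

section \<open>Szego recurrence in the disc\<close>

lemma szego_rev_eq_star:
  "z \<noteq> 0 \<Longrightarrow> poly (szego_rev v n) z = z ^ n * cnj (poly (szego_poly v n) (1 / cnj z))"
  "z \<noteq> 0 \<Longrightarrow> poly (szego_poly v n) z = z ^ n * cnj (poly (szego_rev v n) (1 / cnj z))"
  by (induction n arbitrary: z) (auto simp: field_simps)

lemma szego_rev_on_circle:
  assumes "norm z = 1"
  shows "poly (szego_rev v n) z = z ^ n * cnj (poly (szego_poly v n) z)"
proof -
  have "z * cnj z = 1" using assms by (simp add: complex_norm_square[symmetric])
  then have "1 / cnj z = z" by (metis mult_eq_0_iff nonzero_eq_divide_eq zero_neq_one)
  moreover have "z \<noteq> 0" using assms by auto
  ultimately show ?thesis using szego_rev_eq_star(1)[of z v n] by simp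
qed

lemma szego_pair_degree:
  "degree (szego_rev v n) \<le> n" "degree (szego_poly v n) = n" "lead_coeff (szego_poly v n) = 1"
proof -
  have "degree (szego_rev v n) \<le> n \<and> degree (szego_poly v n) = n \<and> coeff (szego_poly v n) n = 1"
  proof (induction n)
    case (Suc n)
    let ?A = "szego_poly v n" and ?B = "szego_rev v n"
    have 1: "degree (pCons 0 ?A) = Suc n" using Suc by (auto simp: degree_pCons_eq_if)
    have 2: "degree (smult (cnj (v n)) ?B) < degree (pCons 0 ?A)"
      using Suc degree_smult_le[of "cnj (v n)" ?B] unfolding 1 by linarith
    have "degree (szego_poly v (Suc n)) = Suc n"
      using degree_add_eq_left[of "- smult (cnj (v n)) ?B" "pCons 0 ?A"] 2 1 by simp
    moreover have "coeff (szego_poly v (Suc n)) (Suc n) = 1"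
      using Suc 2 1 by (simp add: coeff_eq_0)
    moreover have "degree (szego_rev v (Suc n)) \<le> Suc n"
      using Suc 1 degree_smult_le[of "v n" "pCons 0 ?A"]
      by (auto intro!: degree_diff_le simp del: smult_pCons)
    ultimately show ?case by simp
  qed auto
  then show "degree (szego_rev v n) \<le> n" "degree (szego_poly v n) = n" "lead_coeff (szego_poly v n) = 1"
    by auto
qed

lemma coeff_szego_rev_0: "coeff (szego_rev v n) 0 = 1"
  by (induction n) auto

text \<open>The difference of \<open>\<bar>B\<^sub>n\<^sub>+\<^sub>1\<bar>\<^sup>2\<close> and \<open>\<bar>\<Phi>\<^sub>n\<^sub>+\<^sub>1\<bar>\<^sup>2\<close> is \<open>(1 - \<bar>v n\<bar>\<^sup>2) * (\<bar>B\<^sub>n\<bar>\<^sup>2 - \<bar>z * \<Phi>\<^sub>n\<bar>\<^sup>2)\<close>,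
  which is nonnegative in the closed disc.\<close>

lemma szego_rev_nonzero:
  assumes "\<And>n. norm (v n) < 1" "norm z \<le> 1"
  shows "poly (szego_rev v n) z \<noteq> 0" "norm (poly (szego_poly v n) z) \<le> norm (poly (szego_rev v n) z)"
proof -
  have "poly (szego_rev v n) z \<noteq> 0 \<and> norm (poly (szego_poly v n) z) \<le> norm (poly (szego_rev v n) z)"
  proof (induction n)
    case (Suc n)
    define a b c where "a = z * poly (szego_poly v n) z" and "b = poly (szego_rev v n) z" and "c = v n"
    have c: "norm c < 1" using assms by (simp add: c_def)
    have ab: "norm a \<le> norm b" and b: "norm b > 0"
      using Suc assms(2) mult_mono[of "norm z" 1 "norm (poly (szego_poly v n) z)" "norm b"]
      by (auto simp: a_def b_def norm_mult)
    have "norm (c * a) < norm b"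
      using mult_left_mono[OF ab, of "norm c"] mult_strict_right_mono[OF c b] by (simp add: norm_mult)
    then have "b - c * a \<noteq> 0" by auto
    moreover have "(norm (a - cnj c * b))\<^sup>2 \<le> (norm (b - c * a))\<^sup>2"
    proof -
      have "(norm (b - c * a))\<^sup>2 - (norm (a - cnj c * b))\<^sup>2
          = (1 - (norm c)\<^sup>2) * ((norm b)\<^sup>2 - (norm a)\<^sup>2)"
        by (simp add: cmod_power2) (simp add: power2_eq_square algebra_simps)
      also have "\<dots> \<ge> 0"
        using c ab by (intro mult_nonneg_nonneg) (auto simp: power_le_one intro: power_mono)
      finally show ?thesis by simp
    qed
    then have "norm (a - cnj c * b) \<le> norm (b - c * a)"
      by (rule power2_le_imp_le) simp
    ultimately show ?case by (simp add: a_def b_def c_def algebra_simps)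
  qed simp
  then show "poly (szego_rev v n) z \<noteq> 0"
    "norm (poly (szego_poly v n) z) \<le> norm (poly (szego_rev v n) z)" by auto
qed

section \<open>Orthogonal polynomials of a measure on the circle\<close>

text \<open>A fixed non-trivial probability measure on the unit circle.\<close>

locale nontrivial_circle_measure =
  fixes \<mu> :: "complex measure"
  assumes nontrivial: "nontrivial_prob_on_circle \<mu>"
begin

lemma sets_mu [measurable_cong]: "sets \<mu> = sets circle_borel"
  using nontrivial by (simp add: nontrivial_prob_on_circle_def)

lemma space_mu: "space \<mu> = sphere 0 1"
  using sets_eq_imp_space_eq[OF sets_mu] by (simp add: circle_borel_def space_restrict_space)

sublocale prob_space \<mu>
  using nontrivial by (simp add: nontrivial_prob_on_circle_def)

lemma measurable_mu_borel:
  assumes "f \<in> borel_measurable borel" shows "f \<in> borel_measurable \<mu>"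
proof -
  have "f \<in> borel_measurable circle_borel"
    unfolding circle_borel_def by (rule measurable_restrict_space1) (rule assms)
  then show ?thesis by (simp cong: measurable_cong_sets add: measurable_cong_sets[OF sets_mu refl])
qed

lemma integrable_continuous:
  fixes f :: "complex \<Rightarrow> 'b :: {banach, second_countable_topology}"
  assumes "continuous_on UNIV f"
  shows "integrable \<mu> f"
proof -
  have "compact (f ` sphere 0 1)"
    using assms by (intro compact_continuous_image compact_sphere) (rule continuous_on_subset, auto)
  then obtain B where "\<forall>y\<in>f ` sphere 0 1. norm y \<le> B"
    using compact_imp_bounded bounded_iff by metis
  then have "AE x in \<mu>. norm (f x) \<le> B" by (intro AE_I2) (auto simp: space_mu)
  moreover have "f \<in> borel_measurable \<mu>"
    by (intro measurable_mu_borel borel_measurable_continuous_onI assms)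
  ultimately show ?thesis by (rule integrable_const_bound)
qed

text \<open>The inner product and the squared norm of polynomials in \<open>L\<^sup>2(\<mu>)\<close>.\<close>

definition ip :: "complex poly \<Rightarrow> complex poly \<Rightarrow> complex" where
  "ip p q = (LINT z|\<mu>. poly p z * cnj (poly q z))"

definition nsq :: "complex poly \<Rightarrow> real" where
  "nsq p = (LINT z|\<mu>. (norm (poly p z))\<^sup>2)"

lemma ip_integrable: "integrable \<mu> (\<lambda>z. poly p z * cnj (poly q z))"
  by (intro integrable_continuous continuous_intros)

lemma nsq_integrable: "integrable \<mu> (\<lambda>z. (norm (poly p z))\<^sup>2)"
  by (intro integrable_continuous continuous_intros)

lemma ip_add_left: "ip (p + q) r = ip p r + ip q r"
  unfolding ip_def by (simp add: ring_distribs Bochner_Integration.integral_add[OF ip_integrable ip_integrable])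

lemma ip_smult_left: "ip (smult c p) r = c * ip p r"
  unfolding ip_def by (simp add: mult.assoc)

lemma ip_cnj: "ip q p = cnj (ip p q)"
proof -
  have "cnj (ip p q) = (LINT z|\<mu>. cnj (poly p z * cnj (poly q z)))"
    unfolding ip_def by (rule Bochner_Integration.integral_cnj[symmetric])
  then show ?thesis by (simp add: ip_def mult.commute)
qed

lemma ip_add_right: "ip r (p + q) = ip r p + ip r q"
  using ip_add_left[of p q r] by (metis ip_cnj complex_cnj_add)

lemma ip_smult_right: "ip r (smult c p) = cnj c * ip r p"
  using ip_smult_left[of c p r] by (metis ip_cnj complex_cnj_mult)

lemma ip_diff_left: "ip (p - q) r = ip p r - ip q r"
  using ip_add_left[of "p - q" q r] by simp

lemma ip_diff_right: "ip r (p - q) = ip r p - ip r q"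
  using ip_add_right[of r "p - q" q] by simp

lemma ip_0_right [simp]: "ip p 0 = 0" by (simp add: ip_def)

lemma ip_shift: "ip (pCons 0 p) (pCons 0 q) = ip p q"
  unfolding ip_def
proof (rule Bochner_Integration.integral_cong[OF refl])
  fix z assume "z \<in> space \<mu>"
  then have "z * cnj z = 1" by (simp add: space_mu complex_norm_square[symmetric])
  moreover have "poly (pCons 0 p) z * cnj (poly (pCons 0 q) z) = (z * cnj z) * (poly p z * cnj (poly q z))"
    by (simp add: mult_ac)
  ultimately show "poly (pCons 0 p) z * cnj (poly (pCons 0 q) z) = poly p z * cnj (poly q z)"
    by simp
qed

lemma ip_self: "ip p p = of_real (nsq p)"
  unfolding ip_def nsq_def complex_norm_square[symmetric] of_real_power[symmetric]
  by (rule integral_complex_of_real)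

lemma nsq_nonneg: "nsq p \<ge> 0"
  unfolding nsq_def by (intro integral_nonneg_AE) simp

text \<open>A polynomial that vanishes almost everywhere confines the support to its finitely many roots.\<close>

lemma nsq_pos:
  assumes "p \<noteq> 0"
  shows "nsq p > 0"
proof (rule ccontr)
  assume "\<not> nsq p > 0"
  then have "nsq p = 0" using nsq_nonneg[of p] by simp
  then have ae: "AE z in \<mu>. poly p z = 0"
    unfolding nsq_def using integral_nonneg_eq_0_iff_AE[OF nsq_integrable[of p]] by simp
  have "measure_support \<mu> \<subseteq> {z. poly p z = 0}"
  proof (rule subsetI, rule ccontr)
    fix z assume z: "z \<in> measure_support \<mu>" and "z \<notin> {z. poly p z = 0}"
    define U where "U = {z. poly p z \<noteq> 0}"
    have "open U" unfolding U_def by (intro open_Collect_neq continuous_intros)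
    moreover have "z \<in> U" using \<open>z \<notin> _\<close> by (simp add: U_def)
    ultimately have "emeasure \<mu> (U \<inter> space \<mu>) > 0" using z by (simp add: measure_support_def)
    moreover have "U \<inter> space \<mu> \<in> null_sets \<mu>"
      using ae \<open>open U\<close> by (subst AE_iff_null_sets)
        (auto simp: U_def sets_mu circle_borel_def sets_restrict_space space_mu)
    ultimately show False by auto
  qed
  moreover have "finite {z. poly p z = 0}" using assms by (rule poly_roots_finite)
  moreover have "infinite (measure_support \<mu>)" using nontrivial by (simp add: nontrivial_prob_on_circle_def)
  ultimately show False using finite_subset by blast
qed

lemma nsq_add_orthogonal: "ip p q = 0 \<Longrightarrow> nsq (p + q) = nsq p + nsq q"
proof -
  assume "ip p q = 0"
  then have "ip q p = 0" using ip_cnj[of q p] by simp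
  then have "ip (p + q) (p + q) = ip p p + ip q q" using \<open>ip p q = 0\<close>
    by (simp add: ip_add_left ip_add_right)
  then show ?thesis unfolding ip_self by (simp flip: of_real_add)
qed

lemma nsq_smult: "nsq (smult c p) = (norm c)\<^sup>2 * nsq p"
  unfolding nsq_def by (simp add: norm_mult power_mult_distrib)

lemma ip_monoms_eq_0:
  assumes "\<And>k. k < n \<Longrightarrow> ip p (monom 1 k) = 0" "\<And>k. k \<ge> n \<Longrightarrow> coeff q k = 0"
  shows "ip p q = 0"
proof -
  have "ip p (\<Sum>k<j. monom (coeff q k) k) = 0" if "j \<le> n" for j
    using that
  proof (induction j)
    case (Suc j)
    have "monom (coeff q j) j = smult (coeff q j) (monom 1 j)" by (simp add: smult_monom)
    then show ?case using Suc assms(1)[of j] by (simp add: ip_add_right ip_smult_right)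
  qed simp
  moreover have "q = (\<Sum>k<n. monom (coeff q k) k)"
    using assms(2) by (intro poly_eqI) (auto simp: coeff_sum not_less)
  ultimately show ?thesis by (metis order_refl)
qed

text \<open>The monic orthogonal polynomials and their reversals, by the recurrence itself: the
  coefficient is the one that makes the next polynomial orthogonal to \<open>1\<close>. No Gram-Schmidt process
  is needed, since orthogonality to the higher powers is inherited. The sequence \<open>vb\<close> will turn out
  to be the sequence of Verblunsky coefficients (lemma \<open>verblunsky_eq\<close>).\<close>

primrec opuc :: "nat \<Rightarrow> complex poly \<times> complex poly" where
  "opuc 0 = (1, 1)"
| "opuc (Suc n) = (let A = fst (opuc n); B = snd (opuc n); c = ip (pCons 0 A) 1 / ip B 1
     in (pCons 0 A - smult c B, B - smult (cnj c) (pCons 0 A)))"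

definition vb :: "nat \<Rightarrow> complex" where
  "vb n = cnj (ip (pCons 0 (fst (opuc n))) 1 / ip (snd (opuc n)) 1)"

lemma opuc_eq: "opuc n = szego_pair vb n"
  by (induction n) (auto simp: vb_def Let_def)

lemma ip_szego_rev_monom:
  assumes "k \<le> n"
  shows "ip (szego_rev vb n) (monom 1 k) = cnj (ip (szego_poly vb n) (monom 1 (n - k)))"
  unfolding ip_cnj[of "monom 1 (n - k)", symmetric] unfolding ip_def
proof (rule Bochner_Integration.integral_cong[OF refl])
  fix z assume "z \<in> space \<mu>"
  then have z: "norm z = 1" "z * cnj z = 1" by (simp_all add: space_mu complex_norm_square[symmetric])
  have "z ^ n * cnj z ^ k = z ^ (n - k) * (z * cnj z) ^ k"
    using assms by (simp add: power_mult_distrib flip: power_add mult.assoc)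
  then show "poly (szego_rev vb n) z * cnj (poly (monom 1 k) z)
      = poly (monom 1 (n - k)) z * cnj (poly (szego_poly vb n) z)"
    using z by (simp add: szego_rev_on_circle poly_monom mult_ac)
qed

lemma szego_poly_orthogonal_monom: "k < n \<Longrightarrow> ip (szego_poly vb n) (monom 1 k) = 0"
proof (induction n arbitrary: k)
  case (Suc n)
  have B: "ip (szego_rev vb n) (monom 1 k) = 0" if "1 \<le> k" "k \<le> n" for k
    using that Suc.IH[of "n - k"] by (simp add: ip_szego_rev_monom)
  have lead: "ip (szego_poly vb n) (monom 1 n) = of_real (nsq (szego_poly vb n))"
  proof -
    have "ip (szego_poly vb n) (monom 1 n - szego_poly vb n) = 0"
      by (rule ip_monoms_eq_0[OF Suc.IH]) (use szego_pair_degree[of vb n] in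
        \<open>auto simp: le_less coeff_eq_0\<close>)
    then show ?thesis by (simp add: ip_diff_right ip_self)
  qed
  have "nsq (szego_poly vb n) > 0" using szego_pair_degree(3)[of vb n] by (intro nsq_pos) auto
  then have nz: "ip (szego_rev vb n) 1 \<noteq> 0"
    using ip_szego_rev_monom[of 0 n] lead by (simp add: monom_0 one_pCons[symmetric])
  show ?case
  proof (cases k)
    case 0
    have "cnj (vb n) = ip (pCons 0 (szego_poly vb n)) 1 / ip (szego_rev vb n) 1"
      by (simp add: vb_def opuc_eq)
    then show ?thesis using nz
      by (simp add: 0 monom_0 one_pCons[symmetric] ip_diff_left ip_smult_left)
  next
    case (Suc j)
    then have "ip (pCons 0 (szego_poly vb n)) (monom 1 k) = 0"
      using Suc.IH[of j] Suc.prems by (simp add: monom_Suc ip_shift)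
    then show ?thesis using B[of k] Suc.prems Suc
      by (simp add: ip_diff_left ip_smult_left)
  qed
qed simp

lemma szego_poly_orthogonal: "degree q < n \<Longrightarrow> ip (szego_poly vb n) q = 0"
  by (rule ip_monoms_eq_0[OF szego_poly_orthogonal_monom]) (auto intro: coeff_eq_0)

lemma is_monic_orthogonal_szego: "is_monic_orthogonal \<mu> (szego_poly vb)"
proof -
  have "ip (szego_poly vb n) (szego_poly vb m) = 0" if "m < n" for m n
    using that by (intro szego_poly_orthogonal) (simp add: szego_pair_degree)
  then have "ip (szego_poly vb n) (szego_poly vb m) = 0" if "m \<noteq> n" for m n
    using that ip_cnj[of "szego_poly vb n" "szego_poly vb m"] by (cases m n rule: linorder_cases) auto
  then show ?thesis
    using szego_pair_degree(2,3) unfolding is_monic_orthogonal_def ip_def by blast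
qed

lemma is_monic_orthogonal_unique:
  assumes "is_monic_orthogonal \<mu> \<Psi>"
  shows "\<Psi> = szego_poly vb"
proof
  fix n
  have deg: "degree (\<Psi> n) = n" "lead_coeff (\<Psi> n) = 1" for n
    using assms unfolding is_monic_orthogonal_def by blast+
  have orth: "ip (\<Psi> n) (\<Psi> m) = 0" if "m \<noteq> n" for m n
    using assms that by (auto simp: is_monic_orthogonal_def ip_def)
  have low: "ip (\<Psi> n) q = 0" if "degree q < n" for q
    using that
  proof (induction "degree q" arbitrary: q rule: less_induct)
    case less
    define d where "d = degree q"
    define r where "r = q - smult (lead_coeff q) (\<Psi> d)"
    have q: "q = r + smult (lead_coeff q) (\<Psi> d)" by (simp add: r_def)
    have "ip (\<Psi> n) r = 0"
    proof (cases "d = 0")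
      case True
      have "coeff r k = 0" for k
        using True deg[of 0] by (cases k) (auto simp: r_def d_def coeff_eq_0)
      then have "r = 0" by (intro poly_eqI) simp
      then show ?thesis by simp
    next
      case False
      have "coeff r k = 0" if "k \<ge> d" for k
        using that deg[of d] by (cases "k = d") (auto simp: r_def d_def coeff_eq_0)
      then have "degree r \<le> d - 1" by (intro degree_le) (use False in auto)
      then have "degree r < d" using False by linarith
      then show ?thesis using less by (simp add: d_def)
    qed
    then show "ip (\<Psi> n) q = 0"
      using orth[of d n] less.prems by (subst q) (simp add: ip_add_right ip_smult_right d_def)
  qed
  define D where "D = \<Psi> n - szego_poly vb n"
  have c: "coeff D k = 0" if "k \<ge> n" for k
    using that deg[of n] szego_pair_degree(2,3)[of vb n]
    by (cases "k = n") (auto simp: D_def coeff_eq_0)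
  show "\<Psi> n = szego_poly vb n"
  proof (rule ccontr)
    assume "\<Psi> n \<noteq> szego_poly vb n"
    then have "D \<noteq> 0" by (simp add: D_def)
    then have "degree D < n" using c[of "degree D"] by (metis leading_coeff_0_iff not_less)
    then have "ip D D = 0"
      using low[of D] szego_poly_orthogonal[of D n] by (simp add: D_def ip_diff_left)
    then show False using nsq_pos[OF \<open>D \<noteq> 0\<close>] by (simp add: ip_self)
  qed
qed

lemma monic_OP_eq: "monic_OP \<mu> = szego_poly vb"
  unfolding monic_OP_def
  using is_monic_orthogonal_szego is_monic_orthogonal_unique by (rule the_equality)

lemma verblunsky_eq: "verblunsky \<mu> = vb"
proof
  fix n
  have star: "monic_OP_star \<mu> n z = poly (szego_rev vb n) z" if "z \<noteq> 0" for z
    using szego_rev_eq_star(1)[OF that] by (simp add: monic_OP_star_def monic_OP_eq)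
  have "szego_rev vb n \<noteq> 0" using coeff_szego_rev_0[of vb n] by auto
  then have "finite (insert 0 {z. poly (szego_rev vb n) z = 0})" by (simp add: poly_roots_finite)
  then obtain z where z: "z \<noteq> 0" "poly (szego_rev vb n) z \<noteq> 0"
    by (metis (mono_tags, lifting) ex_new_if_finite infinite_UNIV_char_0 insertCI mem_Collect_eq)
  show "verblunsky \<mu> n = vb n"
    unfolding verblunsky_def
  proof (rule the_equality)
    show "\<forall>z. z \<noteq> 0 \<longrightarrow> poly (monic_OP \<mu> (Suc n)) z
        = z * poly (monic_OP \<mu> n) z - cnj (vb n) * monic_OP_star \<mu> n z"
      by (simp add: star monic_OP_eq)
  next
    fix a assume "\<forall>z. z \<noteq> 0 \<longrightarrow> poly (monic_OP \<mu> (Suc n)) z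
        = z * poly (monic_OP \<mu> n) z - cnj a * monic_OP_star \<mu> n z"
    then have "poly (szego_poly vb (Suc n)) z
        = z * poly (szego_poly vb n) z - cnj a * poly (szego_rev vb n) z"
      using z(1) star[OF z(1)] unfolding monic_OP_eq by metis
    then show "a = vb n" using z(2) by auto
  qed
qed

text \<open>The reversed polynomial is orthogonal to \<open>z\<close>, ..., \<open>z ^ n\<close>.\<close>

lemma szego_rev_orthogonal:
  assumes "coeff q 0 = 0" "degree q \<le> n" shows "ip (szego_rev vb n) q = 0"
proof -
  have "ip (szego_rev vb n) q = cnj (ip (szego_poly vb n) (\<Sum>k=1..n. monom (cnj (coeff q k)) (n - k)))"
  proof -
    have m: "monom c k = smult c (monom 1 k)" for c :: complex and k by (simp add: smult_monom)
    have sumr: "ip p (sum f S) = (\<Sum>k\<in>S. ip p (f k))" for p f and S :: "nat set"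
      by (induction S rule: infinite_finite_induct) (auto simp: ip_add_right)
    have "q = (\<Sum>k=1..n. monom (coeff q k) k)"
      using assms by (intro poly_eqI) (auto simp: coeff_sum not_less_eq_eq coeff_eq_0)
    then have "ip (szego_rev vb n) q = (\<Sum>k=1..n. ip (szego_rev vb n) (monom (coeff q k) k))"
      by (metis sumr)
    also have "\<dots> = (\<Sum>k=1..n. cnj (ip (szego_poly vb n) (monom (cnj (coeff q k)) (n - k))))"
      by (intro sum.cong refl) (subst (1 2) m, simp add: ip_smult_right ip_szego_rev_monom)
    finally show ?thesis by (simp add: sumr)
  qed
  moreover have "ip (szego_poly vb n) (\<Sum>k=1..n. monom (cnj (coeff q k)) (n - k)) = 0"
    by (rule ip_monoms_eq_0[OF szego_poly_orthogonal_monom]) (auto simp: coeff_sum intro!: sum.neutral)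
  ultimately show ?thesis by simp
qed

lemma nsq_szego_rev: "nsq (szego_rev vb n) = nsq (szego_poly vb n)"
  unfolding nsq_def
  by (rule Bochner_Integration.integral_cong)
     (auto simp: space_mu szego_rev_on_circle norm_mult norm_power)

lemma nsq_szego_poly_Suc: "nsq (szego_poly vb (Suc n)) = (1 - (norm (vb n))\<^sup>2) * nsq (szego_poly vb n)"
proof -
  have "nsq (szego_poly vb n) = nsq (pCons 0 (szego_poly vb n))"
    using ip_shift[of "szego_poly vb n" "szego_poly vb n"] by (simp add: ip_self)
  also have "pCons 0 (szego_poly vb n) = szego_poly vb (Suc n) + smult (cnj (vb n)) (szego_rev vb n)"
    by simp
  also have "nsq \<dots> = nsq (szego_poly vb (Suc n)) + nsq (smult (cnj (vb n)) (szego_rev vb n))"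
    by (rule nsq_add_orthogonal, subst ip_smult_right, subst szego_poly_orthogonal)
       (simp_all add: szego_pair_degree(1) less_Suc_eq_le del: szego_pair.simps)
  finally have "nsq (szego_poly vb n)
      = nsq (szego_poly vb (Suc n)) + (norm (vb n))\<^sup>2 * nsq (szego_poly vb n)"
    unfolding nsq_smult nsq_szego_rev complex_mod_cnj .
  then show ?thesis unfolding left_diff_distrib mult_1_left by linarith
qed

lemma nsq_szego_poly_pos: "nsq (szego_poly vb n) > 0"
  using szego_pair_degree(3)[of vb n] by (intro nsq_pos) auto

lemma norm_vb_less_1: "norm (vb n) < 1"
proof -
  have "(1 - (norm (vb n))\<^sup>2) * nsq (szego_poly vb n) > 0"
    using nsq_szego_poly_pos[of "Suc n"] unfolding nsq_szego_poly_Suc .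
  then have "(norm (vb n))\<^sup>2 < 1"
    using nsq_szego_poly_pos[of n] by (simp add: zero_less_mult_iff)
  then show ?thesis by (simp add: power_less_one_iff abs_square_less_1)
qed

lemma nsq_szego_poly: "nsq (szego_poly vb n) = (\<Prod>k<n. 1 - (norm (vb k))\<^sup>2)"
proof (induction n)
  case 0
  show ?case by (simp add: nsq_def prob_space)
qed (simp add: nsq_szego_poly_Suc mult.commute del: szego_pair.simps)

text \<open>Extremal property: among the polynomials of degree at most \<open>n\<close> with value \<open>1\<close> at \<open>0\<close>, the reversed
  polynomial has the smallest norm.\<close>

lemma nsq_ge:
  assumes "degree h \<le> n"
  shows "nsq h \<ge> (norm (coeff h 0))\<^sup>2 * nsq (szego_rev vb n)"
proof -
  define r where "r = h - smult (coeff h 0) (szego_rev vb n)"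
  have "degree r \<le> n"
    unfolding r_def using assms szego_pair_degree(1)[of vb n] degree_smult_le
    by (intro degree_diff_le) (auto intro: order_trans)
  moreover have "coeff r 0 = 0" by (simp add: r_def coeff_szego_rev_0)
  ultimately have "ip (smult (coeff h 0) (szego_rev vb n)) r = 0"
    by (simp add: ip_smult_left szego_rev_orthogonal)
  then have "nsq (smult (coeff h 0) (szego_rev vb n) + r) = (norm (coeff h 0))\<^sup>2 * nsq (szego_rev vb n) + nsq r"
    by (simp add: nsq_add_orthogonal nsq_smult)
  then show ?thesis using nsq_nonneg[of r] by (simp add: r_def)
qed

lemma norm_alpha_le_1: "norm (alpha \<mu> k) \<le> 1"
  using norm_vb_less_1[of "nat k"] by (simp add: alpha_def verblunsky_eq)

text \<open>The infimum of the squared norms of the reversed polynomials. These norms decrease, so it is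
  also their limit, the infinite product of the numbers \<open>1 - \<bar>\<alpha>\<^sub>k\<bar>\<^sup>2\<close>.\<close>

definition szego_const :: real where
  "szego_const = (INF n. nsq (szego_rev vb n))"

lemma szego_const_le: "szego_const \<le> nsq (szego_rev vb n)"
  unfolding szego_const_def by (rule cINF_lower) (auto intro: bdd_belowI2 nsq_nonneg)

lemma nsq_szego_rev_tendsto: "(\<lambda>n. nsq (szego_rev vb n)) \<longlonglongrightarrow> szego_const"
  unfolding szego_const_def
proof (rule LIMSEQ_decseq_INF)
  show "bdd_below (range (\<lambda>n. nsq (szego_rev vb n)))" by (auto intro: bdd_belowI2 nsq_nonneg)
  show "decseq (\<lambda>n. nsq (szego_rev vb n))"
    unfolding decseq_Suc_iff nsq_szego_rev nsq_szego_poly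
    using prod_nonneg[of "{..<_}" "\<lambda>k. 1 - (norm (vb k))\<^sup>2"] norm_vb_less_1
    by (auto simp: power_le_one less_imp_le intro!: mult_right_le_one_le)
qed

lemma szego_const_pos:
  assumes "summable (\<lambda>k. (norm (verblunsky \<mu> k))\<^sup>2)"
  shows "szego_const > 0"
proof -
  let ?x = "\<lambda>k. (norm (vb k))\<^sup>2"
  have x: "0 \<le> ?x k" "?x k < 1" for k
    using norm_vb_less_1[of k] by (auto simp: abs_square_less_1)
  have s: "summable ?x" using assms by (simp add: verblunsky_eq)
  \<comment> \<open>From an index on where the tail is below \<open>1 / 2\<close>, the product loses at most a factor \<open>1 / 2\<close>.\<close>
  then obtain K where K: "(\<Sum>k. ?x (k + K)) < 1 / 2"
  proof -
    obtain N where "\<forall>n\<ge>N. norm (\<Sum>i. ?x (i + n)) < 1 / 2"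
      using suminf_exist_split[OF _ s, of "1/2"] by auto
    then show ?thesis using that[of N] by (auto simp: abs_less_iff)
  qed
  let ?p = "\<lambda>n. nsq (szego_rev vb n)"
  have low: "?p (n + K) \<ge> ?p K / 2" for n
  proof -
    have "?p (n + K) = ?p K * (\<Prod>k<n. 1 - ?x (k + K))"
      by (induction n) (simp_all add: nsq_szego_rev nsq_szego_poly_Suc mult_ac del: szego_pair.simps)
    moreover have "(\<Prod>k<n. 1 - ?x (k + K)) \<ge> 1 - (\<Sum>k<n. ?x (k + K))"
      by (rule Weierstrass_prod_ineq) (use x in \<open>auto simp: less_imp_le\<close>)
    moreover have "(\<Sum>k<n. ?x (k + K)) \<le> (\<Sum>k. ?x (k + K))"
      using s by (intro sum_le_suminf) (auto intro: summable_ignore_initial_segment)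
    ultimately show ?thesis
      using K nsq_nonneg[of "szego_rev vb K"] mult_left_mono[of "1/2" "\<Prod>k<n. 1 - ?x (k + K)" "?p K"]
      by linarith
  qed
  have "szego_const \<ge> ?p K / 2"
    by (rule LIMSEQ_le_const[OF nsq_szego_rev_tendsto]) (use low in \<open>metis le_add_diff_inverse2\<close>)
  then show ?thesis using nsq_szego_poly_pos[of K] by (simp add: nsq_szego_rev)
qed

lemma nsq_ge_szego_const: "nsq h \<ge> (norm (coeff h 0))\<^sup>2 * szego_const"
  using nsq_ge[of h "degree h"] mult_left_mono[OF szego_const_le[of "degree h"], of "(norm (coeff h 0))\<^sup>2"]
  by simp

end

section \<open>The uniform measure\<close>

lemma space_dtheta: "space dtheta = {0..<2*pi}"
  by (simp add: dtheta_def space_restrict_space)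

lemma sets_dtheta [measurable_cong]: "sets dtheta = sets (restrict_space borel {0..<2*pi})"
  by (simp add: dtheta_def sets_restrict_space)

lemma measurable_dtheta: "f \<in> borel_measurable borel \<Longrightarrow> f \<in> borel_measurable dtheta"
  by (subst measurable_cong_sets[OF sets_dtheta refl]) (rule measurable_restrict_space1)

lemma prob_space_dtheta: "prob_space dtheta"
proof
  have "emeasure dtheta (space dtheta)
      = ennreal (1 / (2*pi)) * emeasure (restrict_space lborel {0..<2*pi}) {0..<2*pi}"
    unfolding space_dtheta unfolding dtheta_def
    by (rule emeasure_density_const) (simp add: sets_restrict_space_iff)
  also have "\<dots> = ennreal (1 / (2*pi)) * ennreal (2 * pi)"
    by (simp add: emeasure_restrict_space)
  also have "\<dots> = 1" by (simp add: ennreal_mult[symmetric])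
  finally show "emeasure dtheta (space dtheta) = 1" .
qed

interpretation dtheta: prob_space dtheta
  by (rule prob_space_dtheta)

lemma integrable_dtheta_continuous:
  fixes f :: "real \<Rightarrow> 'b :: {banach, second_countable_topology}"
  assumes "continuous_on UNIV f"
  shows "integrable dtheta f"
proof -
  have "compact (f ` {0..2*pi})"
    using assms by (intro compact_continuous_image) (auto intro: continuous_on_subset)
  then obtain B where "\<forall>y\<in>f ` {0..2*pi}. norm y \<le> B"
    using compact_imp_bounded bounded_iff by metis
  then have "AE x in dtheta. norm (f x) \<le> B" by (intro AE_I2) (auto simp: space_dtheta)
  moreover have "f \<in> borel_measurable dtheta"
    by (intro measurable_dtheta borel_measurable_continuous_onI assms)
  ultimately show ?thesis by (rule dtheta.integrable_const_bound)
qed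

lemma integral_dtheta:
  fixes f :: "real \<Rightarrow> complex"
  assumes "f \<in> borel_measurable borel"
  shows "(LINT \<theta>|dtheta. f \<theta>) = (LINT \<theta>|lborel. indicator {0..2*pi} \<theta> *\<^sub>R f \<theta>) / (2 * pi)"
proof -
  have "(LINT \<theta>|dtheta. f \<theta>) = (LINT \<theta>|restrict_space lborel {0..<2*pi}. (1 / (2*pi)) *\<^sub>R f \<theta>)"
    unfolding dtheta_def using assms
    by (intro integral_density) (auto intro: measurable_restrict_space1)
  also have "\<dots> = (LINT \<theta>|lborel. indicator {0..<2*pi} \<theta> *\<^sub>R ((1 / (2*pi)) *\<^sub>R f \<theta>))"
    by (subst integral_restrict_space) (auto simp: set_lebesgue_integral_def)
  also have "\<dots> = (LINT \<theta>|lborel. (1 / (2*pi)) *\<^sub>R (indicator {0..2*pi} \<theta> *\<^sub>R f \<theta>))"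
  proof (rule integral_cong_AE)
    show "AE \<theta> in lborel. indicat_real {0..<2*pi} \<theta> *\<^sub>R ((1 / (2*pi)) *\<^sub>R f \<theta>)
        = (1 / (2*pi)) *\<^sub>R (indicat_real {0..2*pi} \<theta> *\<^sub>R f \<theta>)"
      using AE_lborel_singleton[of "2*pi"] by eventually_elim (auto simp: indicator_def)
  qed (use assms in measurable)
  also have "\<dots> = (LINT \<theta>|lborel. indicator {0..2*pi} \<theta> *\<^sub>R f \<theta>) / (2 * pi)"
    by (simp add: scaleR_conv_of_real)
  finally show ?thesis .
qed

lemma integral_dtheta_cis_power: "(LINT \<theta>|dtheta. cis \<theta> ^ k) = (if k = 0 then 1 else 0)"
proof (cases "k = 0")
  case True
  then show ?thesis by (simp add: dtheta.prob_space)
next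
  case False
  have "has_bochner_integral lborel (\<lambda>\<theta>. indicator {0..2*pi} \<theta> *\<^sub>R (cis \<theta> ^ k))
      (cis (real k * (2*pi)) / (\<i> * k) - cis (real k * 0) / (\<i> * k))"
  proof (rule has_bochner_integral_FTC_Icc)
    fix x :: real
    have "((\<lambda>u. exp (\<i> * of_nat k * u) / (\<i> * k)) has_field_derivative
        exp (\<i> * of_nat k * of_real x)) (at (of_real x))"
      using False by (auto intro!: derivative_eq_intros)
    from has_vector_derivative_real_field[OF this, of "{0..2*pi}"]
    have "((\<lambda>\<theta>. exp (\<i> * of_nat k * of_real \<theta>) / (\<i> * k)) has_vector_derivative
        exp (\<i> * of_nat k * of_real x)) (at x within {0..2*pi})" by simp
    then show "((\<lambda>\<theta>. cis (real k * \<theta>) / (\<i> * k)) has_vector_derivative cis x ^ k) (at x within {0..2*pi})"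
      by (simp only: Complex.DeMoivre) (simp add: cis_conv_exp mult_ac)
  qed (auto intro!: continuous_intros)
  moreover have "cis (real k * (2*pi)) = 1"
    using cis_multiple_2pi[of "of_nat k"] by (simp add: mult_ac)
  ultimately have "(LINT \<theta>|lborel. indicator {0..2*pi} \<theta> *\<^sub>R (cis \<theta> ^ k)) = 0"
    by (simp add: has_bochner_integral_integral_eq)
  then show ?thesis using False
    by (subst integral_dtheta) (auto intro!: borel_measurable_continuous_onI continuous_intros)
qed

lemma integral_dtheta_poly: "(LINT \<theta>|dtheta. poly p (cis \<theta>)) = coeff p 0"
proof -
  have "(LINT \<theta>|dtheta. poly p (cis \<theta>)) = (LINT \<theta>|dtheta. (\<Sum>i\<le>degree p. coeff p i * cis \<theta> ^ i))"
    by (simp add: poly_altdef)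
  also have "\<dots> = (\<Sum>i\<le>degree p. LINT \<theta>|dtheta. coeff p i * cis \<theta> ^ i)"
    by (intro Bochner_Integration.integral_sum integrable_dtheta_continuous continuous_intros)
  also have "\<dots> = (\<Sum>i\<le>degree p. if i = 0 then coeff p 0 else 0)"
    by (intro sum.cong refl) (simp add: integral_dtheta_cis_power)
  also have "\<dots> = coeff p 0" by simp
  finally show ?thesis .
qed

section \<open>Trigonometric polynomials\<close>

text \<open>Real trigonometric polynomials, as functions on the unit circle, are the real parts of
  polynomials.\<close>

definition trig_poly :: "(complex \<Rightarrow> real) \<Rightarrow> bool" where
  "trig_poly f \<longleftrightarrow> (\<exists>H. \<forall>z. norm z = 1 \<longrightarrow> f z = Re (poly H z))"

lemma Re_mult_cnj_poly: "\<exists>H. \<forall>z. norm z = 1 \<longrightarrow> Re (poly p z * cnj (poly q z)) = Re (poly H z)"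
proof (induction q arbitrary: p)
  case 0
  show ?case by (rule exI[of _ 0]) simp
next
  case (pCons c q)
  obtain a p' where p: "p = pCons a p'" by (cases p)
  obtain H where H: "Re (poly p' z * cnj (poly q z)) = Re (poly H z)" if "norm z = 1" for z
    using pCons.IH[of p'] by blast
  show ?case
  proof (intro exI[of _ "smult (cnj c) p + (H + smult (cnj a) (pCons 0 q))"] allI impI)
    fix z :: complex assume z: "norm z = 1"
    then have zz: "z * cnj z = 1" by (simp add: complex_norm_square[symmetric])
    have "poly p z * cnj (poly (pCons c q) z)
        = cnj c * poly p z + (a * cnj (z * poly q z) + (z * cnj z) * (poly p' z * cnj (poly q z)))"
      by (simp add: p algebra_simps)
    also have "Re \<dots> = Re (cnj c * poly p z) + (Re (cnj (a * cnj (z * poly q z))) + Re (poly H z))"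
      unfolding zz by (simp only: plus_complex.simps mult_1_left H[OF z] cnj.simps)
    also have "\<dots> = Re (poly (smult (cnj c) p + (H + smult (cnj a) (pCons 0 q))) z)"
      by (simp add: algebra_simps)
    finally show "Re (poly p z * cnj (poly (pCons c q) z))
        = Re (poly (smult (cnj c) p + (H + smult (cnj a) (pCons 0 q))) z)" .
  qed
qed

text \<open>Only closure under products is not immediate: \<open>Re p * Re q\<close> is half of \<open>Re (p * q) + Re (p * cnj q)\<close>.\<close>

lemma trig_poly_real_polynomial_function:
  assumes "real_polynomial_function g"
  shows "trig_poly g"
  using assms
proof (induction rule: real_polynomial_function.induct)
  case (linear f)
  have "f z = Re (poly [:0, of_real (f 1) - \<i> * of_real (f \<i>):] z)" for z
  proof -
    interpret bounded_linear f by (rule linear)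
    have "f z = f (Re z *\<^sub>R 1 + Im z *\<^sub>R \<i>)"
      by (simp add: scaleR_conv_of_real complex_eq[symmetric] mult.commute)
    also have "\<dots> = Re z * f 1 + Im z * f \<i>" by (simp only: add scaleR real_scaleR_def)
    finally show ?thesis by (simp add: algebra_simps)
  qed
  then show ?case unfolding trig_poly_def by blast
next
  case (const c)
  show ?case unfolding trig_poly_def by (rule exI[of _ "[:of_real c:]"]) simp
next
  case (add f g)
  then obtain F G where "\<forall>z. norm z = 1 \<longrightarrow> f z = Re (poly F z)" "\<forall>z. norm z = 1 \<longrightarrow> g z = Re (poly G z)"
    by (auto simp: trig_poly_def)
  then show ?case unfolding trig_poly_def by (intro exI[of _ "F + G"]) simp
next
  case (mult f g)
  then obtain F G where FG: "\<forall>z. norm z = 1 \<longrightarrow> f z = Re (poly F z)" "\<forall>z. norm z = 1 \<longrightarrow> g z = Re (poly G z)"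
    by (auto simp: trig_poly_def)
  obtain H where H: "\<forall>z. norm z = 1 \<longrightarrow> Re (poly F z * cnj (poly G z)) = Re (poly H z)"
    using Re_mult_cnj_poly[of F G] by blast
  show ?case unfolding trig_poly_def
  proof (intro exI[of _ "smult (1/2) (F * G) + smult (1/2) H"] allI impI)
    fix z :: complex assume z: "norm z = 1"
    have "Re a * Re b = Re (a * b) / 2 + Re (a * cnj b) / 2" for a b
      by (simp add: field_simps)
    then have "f z * g z = Re (poly F z * poly G z) / 2 + Re (poly H z) / 2"
      using FG H z by metis
    then show "f z * g z = Re (poly (smult (1/2) (F * G) + smult (1/2) H) z)" by simp
  qed
qed

lemma approx_by_Re_poly:
  fixes T :: "complex \<Rightarrow> real"
  assumes "continuous_on UNIV T" "e > 0"
  obtains H where "\<And>z. norm z = 1 \<Longrightarrow> \<bar>T z - Re (poly H z)\<bar> < e"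
proof -
  obtain g where g: "real_polynomial_function g" "\<And>z. z \<in> sphere 0 1 \<Longrightarrow> \<bar>T z - g z\<bar> < e"
    using Stone_Weierstrass_real_polynomial_function[OF compact_sphere _ assms(2), of 0 1 T]
      continuous_on_subset[OF assms(1)] by auto
  then show ?thesis
    using trig_poly_real_polynomial_function[OF g(1)] that unfolding trig_poly_def by force
qed

section \<open>The variational inequality for continuous functions\<close>

context nontrivial_circle_measure
begin

text \<open>The extremal property applied to the Taylor polynomials of \<open>exp (H / 2)\<close>, whose squared modulus
  tends to \<open>exp (Re H)\<close>. The value \<open>Re (coeff H 0)\<close> is the mean of \<open>Re H\<close> over the circle.\<close>

lemma szego_exp_Re_poly:
  "(LINT z|\<mu>. exp (Re (poly H z))) \<ge> szego_const * exp (Re (coeff H 0))"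
proof -
  define h where "h N = (\<Sum>k<N. smult (1 / fact k) (smult (1/2) H ^ k))" for N
  have h: "poly (h N) z = (\<Sum>k<N. (poly H z / 2) ^ k /\<^sub>R fact k)" for N z
    by (simp add: h_def poly_sum poly_power scaleR_conv_of_real field_simps)
  have lim: "(\<lambda>N. poly (h N) z) \<longlonglongrightarrow> exp (poly H z / 2)" for z
    unfolding h using exp_converges[of "poly H z / 2"] by (simp add: sums_def)
  have sq: "(norm (exp (x / 2)))\<^sup>2 = exp (Re x)" for x :: complex
    by (simp add: norm_exp_eq_Re power2_eq_square flip: exp_add)
  have bnd: "norm (poly (h N) z) \<le> exp (norm (poly H z) / 2)" for N z
  proof -
    have "norm (poly (h N) z) \<le> (\<Sum>k<N. (norm (poly H z) / 2) ^ k /\<^sub>R fact k)"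
      unfolding h by (rule order_trans[OF norm_sum]) (simp add: norm_power norm_divide)
    also have "\<dots> \<le> exp (norm (poly H z) / 2)"
      unfolding exp_def by (intro sum_le_suminf summable_exp_generic) auto
    finally show ?thesis .
  qed
  have "(\<lambda>N. LINT z|\<mu>. (norm (poly (h N) z))\<^sup>2) \<longlonglongrightarrow> (LINT z|\<mu>. exp (Re (poly H z)))"
  proof (rule integral_dominated_convergence[where w = "\<lambda>z. (exp (norm (poly H z) / 2))\<^sup>2"])
    show "integrable \<mu> (\<lambda>z. (exp (norm (poly H z) / 2))\<^sup>2)"
      by (intro integrable_continuous continuous_intros) auto
    show "AE z in \<mu>. (\<lambda>N. (norm (poly (h N) z))\<^sup>2) \<longlonglongrightarrow> exp (Re (poly H z))"
      unfolding sq[symmetric] by (intro AE_I2 tendsto_power tendsto_norm lim)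
    show "AE z in \<mu>. norm ((norm (poly (h N) z))\<^sup>2) \<le> (exp (norm (poly H z) / 2))\<^sup>2" for N
      using bnd by (intro AE_I2) (auto intro: power_mono)
  qed (intro measurable_mu_borel borel_measurable_continuous_onI continuous_intros)+
  moreover have "(\<lambda>N. (norm (coeff (h N) 0))\<^sup>2 * szego_const) \<longlonglongrightarrow> exp (Re (coeff H 0)) * szego_const"
    using lim[of 0] unfolding sq[symmetric] poly_0_coeff_0
    by (intro tendsto_mult tendsto_power tendsto_norm tendsto_const)
  ultimately have "exp (Re (coeff H 0)) * szego_const \<le> (LINT z|\<mu>. exp (Re (poly H z)))"
    using nsq_ge_szego_const[unfolded nsq_def] by (intro LIMSEQ_le) auto
  then show ?thesis by (simp add: mult.commute)
qed

lemma szego_const_nonneg: "szego_const \<ge> 0"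
  by (rule LIMSEQ_le_const[OF nsq_szego_rev_tendsto]) (auto intro: nsq_nonneg)

lemma szego_exp_continuous:
  assumes T: "continuous_on UNIV T"
  shows "(LINT z|\<mu>. exp (T z)) \<ge> szego_const * exp (LINT \<theta>|dtheta. T (cis \<theta>))"
proof -
  have le: "(LINT z|\<mu>. exp (T z)) \<ge> exp (- (2 * e)) * (szego_const * exp (LINT \<theta>|dtheta. T (cis \<theta>)))"
    if e: "e > 0" for e
  proof -
    obtain H where H: "\<And>z. norm z = 1 \<Longrightarrow> \<bar>T z - Re (poly H z)\<bar> < e"
      using approx_by_Re_poly[OF T e] by metis
    have "exp (- e) * (szego_const * exp (Re (coeff H 0))) \<le> exp (- e) * (LINT z|\<mu>. exp (Re (poly H z)))"
      using szego_exp_Re_poly by (intro mult_left_mono) auto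
    also have "\<dots> = (LINT z|\<mu>. exp (- e) * exp (Re (poly H z)))" by simp
    also have "\<dots> \<le> (LINT z|\<mu>. exp (T z))"
    proof (rule integral_mono)
      fix z assume "z \<in> space \<mu>"
      then have "- e + Re (poly H z) \<le> T z" using H[of z] by (simp add: space_mu abs_less_iff)
      then show "exp (- e) * exp (Re (poly H z)) \<le> exp (T z)" by (simp flip: exp_add)
    qed (intro integrable_continuous continuous_intros T)+
    finally have 1: "exp (- e) * (szego_const * exp (Re (coeff H 0))) \<le> (LINT z|\<mu>. exp (T z))" .
    have "(LINT \<theta>|dtheta. T (cis \<theta>)) \<le> (LINT \<theta>|dtheta. e + Re (poly H (cis \<theta>)))"
    proof (rule integral_mono)
      show "T (cis \<theta>) \<le> e + Re (poly H (cis \<theta>))" for \<theta>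
        using H[of "cis \<theta>"] by (simp add: abs_less_iff)
    qed (intro integrable_dtheta_continuous continuous_intros continuous_on_compose2[OF T] subset_UNIV)+
    also have "\<dots> = e + (LINT \<theta>|dtheta. Re (poly H (cis \<theta>)))"
      by (subst Bochner_Integration.integral_add)
         (auto intro!: integrable_dtheta_continuous continuous_intros simp: dtheta.prob_space)
    also have "(LINT \<theta>|dtheta. Re (poly H (cis \<theta>))) = Re (coeff H 0)"
      unfolding integral_dtheta_poly[symmetric]
      by (intro integral_Re integrable_dtheta_continuous continuous_intros)
    finally have "exp (LINT \<theta>|dtheta. T (cis \<theta>)) \<le> exp (e + Re (coeff H 0))" by simp
    then have "exp (- (2 * e)) * (szego_const * exp (LINT \<theta>|dtheta. T (cis \<theta>)))
        \<le> exp (- (2 * e)) * (szego_const * exp (e + Re (coeff H 0)))"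
      using szego_const_nonneg by (intro mult_left_mono) auto
    also have "\<dots> = exp (- e) * (szego_const * exp (Re (coeff H 0)))"
      by (simp add: mult_ac flip: exp_add)
    finally show ?thesis using 1 by linarith
  qed
  have "((\<lambda>e. exp (- (2 * e)) * (szego_const * exp (LINT \<theta>|dtheta. T (cis \<theta>)))) \<longlongrightarrow>
    exp (- (2 * 0)) * (szego_const * exp (LINT \<theta>|dtheta. T (cis \<theta>)))) (at_right 0)"
    by (intro tendsto_intros)
  moreover have "\<forall>\<^sub>F e in at_right 0.
      exp (- (2 * e)) * (szego_const * exp (LINT \<theta>|dtheta. T (cis \<theta>))) \<le> (LINT z|\<mu>. exp (T z))"
    using le by (auto simp: eventually_at_right_field intro!: exI[of _ 1])
  ultimately have "exp (- (2 * 0)) * (szego_const * exp (LINT \<theta>|dtheta. T (cis \<theta>))) \<le> (LINT z|\<mu>. exp (T z))"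
    by (intro tendsto_upperbound) auto
  then show ?thesis by simp
qed

end

section \<open>Approximation by continuous functions\<close>

text \<open>Outer regularity of the set and of its complement, and a continuous function that separates
  the complements of the two approximating open sets.\<close>

lemma indicator_approx_continuous:
  fixes N :: "'a :: euclidean_space measure"
  assumes "finite_measure N" and N: "sets N = sets borel" and A: "A \<in> sets N" and e: "e > 0"
  obtains g where "continuous_on UNIV g" "\<And>x. 0 \<le> g x" "\<And>x. g x \<le> (1 :: real)"
    "(LINT x|N. \<bar>indicator A x - g x\<bar>) < e"
proof -
  interpret finite_measure N by fact
  have [measurable_cong]: "sets N = sets borel" by fact
  have sp: "space N = UNIV" using sets_eq_imp_space_eq[OF N] by simp
  have outer: "\<exists>U. B \<subseteq> U \<and> open U \<and> measure N (U - B) < e / 2" if B: "B \<in> sets borel" for B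
  proof -
    have "emeasure N B = (INF U \<in> {U. B \<subseteq> U \<and> open U}. emeasure N U)"
      using outer_regular[OF N, of B] B by (simp add: emeasure_eq_measure)
    moreover have "emeasure N B < emeasure N B + ennreal (e / 2)"
      using e by (auto simp: emeasure_eq_measure simp flip: ennreal_plus intro!: ennreal_lessI add_nonneg_pos)
    ultimately obtain U where U: "B \<subseteq> U" "open U" "emeasure N U < emeasure N B + ennreal (e / 2)"
      by (auto simp: INF_less_iff)
    have "measure N U < measure N B + e / 2"
      using U(3) e by (simp add: emeasure_eq_measure ennreal_less_iff flip: ennreal_plus)
    moreover have "measure N (U - B) = measure N U - measure N B"
      using U B by (intro finite_measure_Diff) (auto simp: N)
    ultimately show ?thesis using U by (intro exI[of _ U]) auto
  qed
  obtain U where U: "A \<subseteq> U" "open U" "measure N (U - A) < e / 2"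
    using outer[of A] A N by blast
  obtain V where V: "- A \<subseteq> V" "open V" "measure N (V - - A) < e / 2"
    using outer[of "- A"] A N by auto
  have "closed (- U)" "closed (- V)" "- U \<inter> - V = {}" using U V by auto
  then obtain g where g: "continuous_on UNIV g" "\<And>x. g x \<in> closed_segment 0 (1 :: real)"
    "\<And>x. x \<in> - U \<Longrightarrow> g x = 0" "\<And>x. x \<in> - V \<Longrightarrow> g x = 1"
    using Urysohn[of "- U" "- V" 0 "1 :: real"] by metis
  have g01: "0 \<le> g x" "g x \<le> 1" for x using g(2)[of x] by (auto simp: closed_segment_eq_real_ivl)
  have [measurable]: "g \<in> borel_measurable borel" by (rule borel_measurable_continuous_onI) (rule g)
  have [measurable]: "U \<in> sets borel" "V \<in> sets borel" "A \<in> sets borel" using U V A N by auto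
  have le: "\<bar>indicator A x - g x\<bar> \<le> indicator ((U - A) \<union> (V - - A)) x" for x
    using g01[of x] g(3)[of x] g(4)[of x] U(1) V(1) by (auto simp: indicator_def split: if_splits)
  have "(LINT x|N. \<bar>indicator A x - g x\<bar>) \<le> (LINT x|N. indicator ((U - A) \<union> (V - - A)) x)"
  proof (rule integral_mono)
    show "integrable N (\<lambda>x. \<bar>indicator A x - g x\<bar>)"
    proof (rule integrable_const_bound[where B = 1])
      have "\<bar>indicator A x - g x\<bar> \<le> 1" for x using g01[of x] by (simp add: indicator_def)
      then show "AE x in N. norm \<bar>indicator A x - g x\<bar> \<le> 1" by simp
    qed measurable
    show "integrable N (indicat_real ((U - A) \<union> (V - - A)))"
      by (intro integrable_real_indicator) (auto simp: emeasure_eq_measure)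
  qed (rule le)
  also have "\<dots> = measure N ((U - A) \<union> (V - - A))" by (simp add: sp)
  also have "\<dots> \<le> measure N (U - A) + measure N (V - - A)"
    by (rule measure_subadditive) (auto simp: emeasure_eq_measure)
  also have "\<dots> < e" using U V by simp
  finally show ?thesis using that g(1) g01 by blast
qed

text \<open>Continuous functions are dense in \<open>L\<^sup>1\<close> of a finite Borel measure.\<close>

lemma integrable_approx_continuous:
  fixes f :: "'a :: euclidean_space \<Rightarrow> real"
  assumes "finite_measure N" "sets N = sets borel" "integrable N f"
  shows "\<forall>e>0. \<exists>g. continuous_on UNIV g \<and> integrable N g \<and> (LINT x|N. \<bar>f x - g x\<bar>) < e"
  using assms(3)
proof (induction rule: integrable_induct)
  case (base A c)
  interpret finite_measure N by fact
  have [measurable_cong]: "sets N = sets borel" by fact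
  show ?case
  proof (intro allI impI)
    fix e :: real assume e: "e > 0"
    then have e': "e / (\<bar>c\<bar> + 1) > 0" by simp
    obtain g where g: "continuous_on UNIV g" "\<And>x. 0 \<le> g x" "\<And>x. g x \<le> 1"
      "(LINT x|N. \<bar>indicator A x - g x\<bar>) < e / (\<bar>c\<bar> + 1)"
      using indicator_approx_continuous[OF assms(1,2) base(1) e'] by blast
    have [measurable]: "g \<in> borel_measurable borel" by (rule borel_measurable_continuous_onI) (rule g)
    have "integrable N g" using g by (intro integrable_const_bound[where B = 1]) auto
    moreover have "(LINT x|N. \<bar>indicator A x *\<^sub>R c - g x * c\<bar>) < e"
    proof -
      have "(LINT x|N. \<bar>indicator A x *\<^sub>R c - g x * c\<bar>) = (LINT x|N. \<bar>c\<bar> * \<bar>indicator A x - g x\<bar>)"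
        by (intro Bochner_Integration.integral_cong refl)
           (simp add: algebra_simps flip: abs_mult)
      also have "\<dots> = \<bar>c\<bar> * (LINT x|N. \<bar>indicator A x - g x\<bar>)" by simp
      also have "\<dots> \<le> \<bar>c\<bar> * (e / (\<bar>c\<bar> + 1))" using g(4) by (intro mult_left_mono) auto
      also have "\<dots> < e" using e by (simp add: field_simps)
      finally show ?thesis .
    qed
    ultimately show "\<exists>g. continuous_on UNIV g \<and> integrable N g \<and>
        (LINT x|N. \<bar>indicat_real A x *\<^sub>R c - g x\<bar>) < e"
      using g(1) by (intro exI[of _ "\<lambda>x. g x * c"]) (auto intro!: continuous_intros)
  qed
next
  case (add f1 f2)
  show ?case
  proof (intro allI impI)
    fix e :: real assume e: "e > 0"
    obtain g1 where g1: "continuous_on UNIV g1" "integrable N g1" "(LINT x|N. \<bar>f1 x - g1 x\<bar>) < e / 2"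
      using add.IH(1)[rule_format, of "e / 2"] e by auto
    obtain g2 where g2: "continuous_on UNIV g2" "integrable N g2" "(LINT x|N. \<bar>f2 x - g2 x\<bar>) < e / 2"
      using add.IH(2)[rule_format, of "e / 2"] e by auto
    have "(LINT x|N. \<bar>f1 x + f2 x - (g1 x + g2 x)\<bar>) \<le> (LINT x|N. \<bar>f1 x - g1 x\<bar> + \<bar>f2 x - g2 x\<bar>)"
      using add g1 g2 by (intro integral_mono) auto
    also have "\<dots> = (LINT x|N. \<bar>f1 x - g1 x\<bar>) + (LINT x|N. \<bar>f2 x - g2 x\<bar>)"
      using add g1 g2 by (intro Bochner_Integration.integral_add) auto
    also have "\<dots> < e" using g1 g2 by simp
    finally show "\<exists>g. continuous_on UNIV g \<and> integrable N g \<and> (LINT x|N. \<bar>f1 x + f2 x - g x\<bar>) < e"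
      using g1 g2 by (intro exI[of _ "\<lambda>x. g1 x + g2 x"]) (auto intro!: continuous_intros)
  qed
next
  case (lim f s)
  show ?case
  proof (intro allI impI)
    fix e :: real assume e: "e > 0"
    have "(\<lambda>i. LINT x|N. \<bar>f x - s i x\<bar>) \<longlonglongrightarrow> (LINT x|N. 0)"
    proof (rule integral_dominated_convergence[where w = "\<lambda>x. 3 * \<bar>f x\<bar>"])
      show "AE x in N. (\<lambda>i. \<bar>f x - s i x\<bar>) \<longlonglongrightarrow> 0"
      proof (rule AE_I2)
        fix x assume "x \<in> space N"
        then have "(\<lambda>i. \<bar>f x - s i x\<bar>) \<longlonglongrightarrow> \<bar>f x - f x\<bar>" by (intro tendsto_intros lim)
        then show "(\<lambda>i. \<bar>f x - s i x\<bar>) \<longlonglongrightarrow> 0" by simp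
      qed
      show "AE x in N. norm \<bar>f x - s i x\<bar> \<le> 3 * \<bar>f x\<bar>" for i
      proof (rule AE_I2)
        fix x assume "x \<in> space N"
        then have "norm (s i x) \<le> 2 * norm (f x)" by (rule lim)
        then have "\<bar>s i x\<bar> \<le> 2 * \<bar>f x\<bar>" by simp
        then show "norm \<bar>f x - s i x\<bar> \<le> 3 * \<bar>f x\<bar>" by simp
      qed
    qed (use lim in auto)
    then have "\<forall>\<^sub>F i in sequentially. (LINT x|N. \<bar>f x - s i x\<bar>) < e / 2"
      using e by (auto simp: tendsto_iff dist_real_def elim!: allE[of _ "e / 2"] eventually_mono)
    then obtain i where i: "(LINT x|N. \<bar>f x - s i x\<bar>) < e / 2" by (meson eventually_sequentially order_refl)
    have "e / 2 > 0" using e by simp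
    then obtain g where g: "continuous_on UNIV g" "integrable N g" "(LINT x|N. \<bar>s i x - g x\<bar>) < e / 2"
      using lim by blast
    have "(LINT x|N. \<bar>f x - g x\<bar>) \<le> (LINT x|N. \<bar>f x - s i x\<bar> + \<bar>s i x - g x\<bar>)"
      using lim g by (intro integral_mono) auto
    also have "\<dots> = (LINT x|N. \<bar>f x - s i x\<bar>) + (LINT x|N. \<bar>s i x - g x\<bar>)"
      using lim g by (intro Bochner_Integration.integral_add) auto
    also have "\<dots> < e" using i g by simp
    finally show "\<exists>g. continuous_on UNIV g \<and> integrable N g \<and> (LINT x|N. \<bar>f x - g x\<bar>) < e"
      using g by blast
  qed
qed

text \<open>The sum of two finite measures. It serves to approximate with respect to \<open>\<mu>\<close> and to the uniform
  measure by one and the same continuous function.\<close>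

lemma finite_measure_dominating:
  assumes "finite_measure M" "finite_measure N" "sets M = sets N"
  obtains L where "finite_measure L" "sets L = sets M" "M \<le> L" "N \<le> L"
proof -
  interpret M: finite_measure M by fact
  interpret N: finite_measure N by fact
  define L where "L = measure_of (space M) (sets M) (\<lambda>A. emeasure M A + emeasure N A)"
  have sets: "sets L = sets M" and space: "space L = space M" by (simp_all add: L_def)
  have em: "emeasure L A = emeasure M A + emeasure N A" if "A \<in> sets M" for A
  proof (rule emeasure_measure_of[OF L_def])
    show "countably_additive (sets L) (\<lambda>A. emeasure M A + emeasure N A)"
      unfolding countably_additive_def
      using assms(3) by (auto simp: sets suminf_emeasure simp flip: suminf_add)
  qed (use that sets.space_closed in \<open>auto simp: sets positive_def\<close>)
  have "finite_measure L"
    by standard (simp add: space em[OF sets.top])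
  moreover have "M \<le> L" "N \<le> L"
    using assms(3) by (simp_all add: le_measure sets em)
  ultimately show ?thesis using that sets by blast
qed

lemma integral_mono_measure_nonneg:
  fixes f :: "'a \<Rightarrow> real"
  assumes "M \<le> L" "sets M = sets L" "integrable L f" "\<And>x. 0 \<le> f x"
  shows "(LINT x|M. f x) \<le> (LINT x|L. f x)"
proof -
  have L: "f \<in> borel_measurable L" using assms(3) by auto
  have M: "f \<in> borel_measurable M" using L by (simp cong: measurable_cong_sets add: measurable_cong_sets[OF assms(2) refl])
  have "(LINT x|M. f x) = enn2real (\<integral>\<^sup>+x. ennreal (f x) \<partial>M)"
    by (rule integral_eq_nn_integral[OF M]) (simp add: assms)
  also have "\<dots> \<le> enn2real (\<integral>\<^sup>+x. ennreal (f x) \<partial>L)"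
    using assms(3,4) by (intro enn2real_mono nn_integral_mono_measure assms(1,2))
      (auto simp: nn_integral_eq_integral)
  also have "\<dots> = (LINT x|L. f x)"
    by (rule integral_eq_nn_integral[symmetric, OF L]) (simp add: assms)
  finally show ?thesis .
qed

section \<open>The variational inequality for functions bounded above\<close>

lemma measurable_cis_dtheta [measurable]: "cis \<in> measurable dtheta borel"
  by (intro measurable_dtheta borel_measurable_continuous_onI continuous_intros)

context nontrivial_circle_measure
begin

lemma szego_exp_bounded:
  assumes T [measurable]: "T \<in> borel_measurable borel" and C: "\<And>z. \<bar>T z\<bar> \<le> C"
  shows "(LINT z|\<mu>. exp (T z)) \<ge> szego_const * exp (LINT \<theta>|dtheta. T (cis \<theta>))"
proof -
  have id [measurable]: "(\<lambda>z. z) \<in> measurable \<mu> borel" by (rule measurable_mu_borel) simp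
  define M where "M = distr \<mu> borel (\<lambda>z. z)"
  define N where "N = distr dtheta borel cis"
  have "finite_measure M" unfolding M_def by (rule finite_measure_distr) (rule id)
  moreover have "finite_measure N" unfolding N_def by (rule dtheta.finite_measure_distr) measurable
  ultimately obtain L where L: "finite_measure L" "sets L = sets M" "M \<le> L" "N \<le> L"
    using finite_measure_dominating[of M N] by (auto simp: M_def N_def)
  interpret L: finite_measure L by fact
  have setsL [measurable_cong]: "sets L = sets borel" using L(2) by (simp add: M_def)
  have TL: "integrable L T" by (rule L.integrable_const_bound[where B = C]) (simp_all add: C measurable_cong_sets[OF setsL refl])
  have C0: "C \<ge> 0" using C[of 0] by linarith
  have key: "szego_const * exp ((LINT \<theta>|dtheta. T (cis \<theta>)) - e) - exp C * e \<le> (LINT z|\<mu>. exp (T z))"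
    if e: "e > 0" for e
  proof -
    obtain g0 where g0: "continuous_on UNIV g0" "integrable L g0" "(LINT x|L. \<bar>T x - g0 x\<bar>) < e"
      using integrable_approx_continuous[OF L(1) setsL TL] e by blast
    \<comment> \<open>Clamping to \<open>[- C, C]\<close> does not increase the distance from \<open>T\<close> in mean.\<close>
    define g where "g z = max (- C) (min C (g0 z))" for z
    have g: "continuous_on UNIV g" unfolding g_def by (intro continuous_intros g0)
    have gC: "\<bar>g z\<bar> \<le> C" for z using C0 by (auto simp: g_def)
    have [measurable]: "g \<in> borel_measurable borel" by (rule borel_measurable_continuous_onI) (rule g)
    have gL: "integrable L g" by (rule L.integrable_const_bound[where B = C]) (simp_all add: gC measurable_cong_sets[OF setsL refl])
    have "(LINT x|L. \<bar>T x - g x\<bar>) \<le> (LINT x|L. \<bar>T x - g0 x\<bar>)"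
    proof (rule integral_mono)
      show "\<bar>T x - g x\<bar> \<le> \<bar>T x - g0 x\<bar>" for x using C[of x] by (auto simp: g_def max_def min_def)
    qed (use TL gL g0 in auto)
    then have d: "(LINT x|L. \<bar>T x - g x\<bar>) \<le> e" using g0 by simp
    have intL: "integrable L (\<lambda>x. \<bar>T x - g x\<bar>)" using TL gL by auto
    have "(LINT x|M. \<bar>T x - g x\<bar>) \<le> e"
      using integral_mono_measure_nonneg[OF L(3) L(2)[symmetric] intL] d by simp
    then have dM: "(LINT x|\<mu>. \<bar>T x - g x\<bar>) \<le> e"
      unfolding M_def by (subst (asm) integral_distr) auto
    have "(LINT x|N. \<bar>T x - g x\<bar>) \<le> e"
      using integral_mono_measure_nonneg[OF L(4) _ intL] d setsL by (simp add: N_def)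
    then have dN: "(LINT \<theta>|dtheta. \<bar>T (cis \<theta>) - g (cis \<theta>)\<bar>) \<le> e"
      unfolding N_def by (subst (asm) integral_distr) auto
    have int\<theta>: "integrable dtheta (\<lambda>\<theta>. T (cis \<theta>))" "integrable dtheta (\<lambda>\<theta>. g (cis \<theta>))"
      by (rule dtheta.integrable_const_bound[where B = C]; simp add: C gC)+
    have T\<mu>: "T \<in> borel_measurable \<mu>" "g \<in> borel_measurable \<mu>" by (auto intro: measurable_mu_borel)
    have int\<mu>: "integrable \<mu> (\<lambda>z. exp (T z))" "integrable \<mu> (\<lambda>z. exp (g z))"
      using C gC T\<mu> by (auto intro!: integrable_const_bound[where B = "exp C"] simp: abs_le_iff)
    have int\<mu>d: "integrable \<mu> (\<lambda>z. \<bar>T z - g z\<bar>)"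
    proof (rule integrable_const_bound[where B = "C + C"])
      have "\<bar>T z - g z\<bar> \<le> C + C" for z using C[of z] gC[of z] by linarith
      then show "AE z in \<mu>. norm \<bar>T z - g z\<bar> \<le> C + C" by simp
    qed (use T\<mu> in simp)
    have "(LINT \<theta>|dtheta. T (cis \<theta>)) - (LINT \<theta>|dtheta. g (cis \<theta>)) \<le> (LINT \<theta>|dtheta. \<bar>T (cis \<theta>) - g (cis \<theta>)\<bar>)"
      unfolding Bochner_Integration.integral_diff[OF int\<theta>, symmetric]
      using int\<theta> by (intro integral_mono) auto
    then have "szego_const * exp ((LINT \<theta>|dtheta. T (cis \<theta>)) - e) \<le> szego_const * exp (LINT \<theta>|dtheta. g (cis \<theta>))"
      using dN szego_const_nonneg by (intro mult_left_mono) auto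
    also have "\<dots> \<le> (LINT z|\<mu>. exp (g z))" by (rule szego_exp_continuous[OF g])
    also have "\<dots> \<le> (LINT z|\<mu>. exp (T z) + exp C * \<bar>T z - g z\<bar>)"
    proof (rule integral_mono)
      show "exp (g z) \<le> exp (T z) + exp C * \<bar>T z - g z\<bar>" for z
      proof -
        have "exp (g z) * (1 + (T z - g z)) \<le> exp (g z) * exp (T z - g z)"
          by (intro mult_left_mono exp_ge_add_one_self) auto
        then have "exp (g z) \<le> exp (T z) + exp (g z) * (g z - T z)"
          by (simp add: algebra_simps flip: exp_add)
        also have "exp (g z) * (g z - T z) \<le> exp (g z) * \<bar>T z - g z\<bar>"
          by (intro mult_left_mono) auto
        also have "\<dots> \<le> exp C * \<bar>T z - g z\<bar>"
          using gC[of z] by (intro mult_right_mono) auto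
        finally show ?thesis by simp
      qed
    qed (use int\<mu> int\<mu>d in auto)
    also have "\<dots> = (LINT z|\<mu>. exp (T z)) + exp C * (LINT z|\<mu>. \<bar>T z - g z\<bar>)"
      using int\<mu> int\<mu>d by (subst Bochner_Integration.integral_add) auto
    also have "\<dots> \<le> (LINT z|\<mu>. exp (T z)) + exp C * e"
      using dM by simp
    finally show ?thesis by simp
  qed
  have "((\<lambda>e. szego_const * exp ((LINT \<theta>|dtheta. T (cis \<theta>)) - e) - exp C * e) \<longlongrightarrow>
      szego_const * exp ((LINT \<theta>|dtheta. T (cis \<theta>)) - 0) - exp C * 0) (at_right 0)"
    by (intro tendsto_intros)
  moreover have "\<forall>\<^sub>F e in at_right 0.
      szego_const * exp ((LINT \<theta>|dtheta. T (cis \<theta>)) - e) - exp C * e \<le> (LINT z|\<mu>. exp (T z))"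
    using key by (auto simp: eventually_at_right_field intro!: exI[of _ 1])
  ultimately have "szego_const * exp ((LINT \<theta>|dtheta. T (cis \<theta>)) - 0) - exp C * 0 \<le> (LINT z|\<mu>. exp (T z))"
    by (intro tendsto_upperbound) auto
  then show ?thesis by simp
qed

text \<open>Truncating \<open>T\<close> from below at \<open>- n\<close> adds at most \<open>exp (- n)\<close> to the left-hand side and does not
  decrease the right-hand side.\<close>

lemma szego_exp_bounded_above:
  assumes T [measurable]: "T \<in> borel_measurable borel" and C: "\<And>z. T z \<le> C"
    and int: "integrable dtheta (\<lambda>\<theta>. T (cis \<theta>))"
  shows "(LINT z|\<mu>. exp (T z)) \<ge> szego_const * exp (LINT \<theta>|dtheta. T (cis \<theta>))"
proof -
  have T\<mu> [measurable]: "T \<in> borel_measurable \<mu>" by (rule measurable_mu_borel) simp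
  have le: "szego_const * exp (LINT \<theta>|dtheta. T (cis \<theta>)) \<le> (LINT z|\<mu>. exp (T z)) + exp (- real n)" for n :: nat
  proof -
    let ?T = "\<lambda>z. max (T z) (- real n)"
    have int\<mu>: "integrable \<mu> (\<lambda>z. exp (T z))" "integrable \<mu> (\<lambda>z. exp (?T z))"
    proof -
      show "integrable \<mu> (\<lambda>z. exp (T z))"
        by (rule integrable_const_bound[where B = "exp C"]) (simp_all add: C)
      have "?T z \<le> max C (- real n)" for z using C[of z] by simp
      then show "integrable \<mu> (\<lambda>z. exp (?T z))"
        by (intro integrable_const_bound[where B = "exp (max C (- real n))"]) (simp_all del: max.bounded_iff)
    qed
    have "(LINT \<theta>|dtheta. T (cis \<theta>)) \<le> (LINT \<theta>|dtheta. ?T (cis \<theta>))"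
      using int by (intro integral_mono) auto
    then have "szego_const * exp (LINT \<theta>|dtheta. T (cis \<theta>)) \<le> szego_const * exp (LINT \<theta>|dtheta. ?T (cis \<theta>))"
      using szego_const_nonneg by (intro mult_left_mono) auto
    also have "\<dots> \<le> (LINT z|\<mu>. exp (?T z))"
    proof (rule szego_exp_bounded)
      show "\<bar>?T z\<bar> \<le> max \<bar>C\<bar> (real n)" for z using C[of z] by (auto simp: max_def abs_if split: if_splits)
    qed measurable
    also have "\<dots> \<le> (LINT z|\<mu>. exp (T z) + exp (- real n))"
      using int\<mu> by (intro integral_mono) (auto simp: max_def)
    also have "\<dots> = (LINT z|\<mu>. exp (T z)) + exp (- real n)"
      using int\<mu> by (subst Bochner_Integration.integral_add) (auto simp: prob_space)
    finally show ?thesis .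
  qed
  have "(\<lambda>n. (LINT z|\<mu>. exp (T z)) + exp (- real n)) \<longlonglongrightarrow> (LINT z|\<mu>. exp (T z)) + 0"
  proof (intro tendsto_add tendsto_const)
    show "(\<lambda>n. exp (- real n)) \<longlonglongrightarrow> 0"
      by (rule filterlim_compose[OF exp_at_bot])
         (simp add: filterlim_uminus_at_bot filterlim_real_sequentially)
  qed
  then have "(\<lambda>n. (LINT z|\<mu>. exp (T z)) + exp (- real n)) \<longlonglongrightarrow> (LINT z|\<mu>. exp (T z))" by simp
  then show ?thesis by (rule LIMSEQ_le_const) (intro exI allI impI le)
qed

end

section \<open>The absolutely continuous part\<close>

text \<open>The inverse of \<open>cis\<close> on \<open>[0, 2 \<pi>)\<close>. The argument of \<open>arccos\<close> is clamped to \<open>[-1, 1]\<close> to obtain a Borel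
  function on the whole plane.\<close>

definition circle_angle :: "complex \<Rightarrow> real" where
  "circle_angle z = (let t = arccos (max (-1) (min 1 (Re z))) in if Im z \<ge> 0 then t else 2 * pi - t)"

lemma measurable_circle_angle [measurable]: "circle_angle \<in> borel_measurable borel"
proof -
  have "continuous_on UNIV (\<lambda>z. arccos (max (-1) (min 1 (Re z))))"
    by (intro continuous_intros) auto
  then have [measurable]: "(\<lambda>z. arccos (max (-1) (min 1 (Re z)))) \<in> borel_measurable borel"
    by (rule borel_measurable_continuous_onI)
  show ?thesis unfolding circle_angle_def Let_def by measurable
qed

lemma circle_angle_cis:
  assumes "0 \<le> \<theta>" "\<theta> < 2 * pi" shows "circle_angle (cis \<theta>) = \<theta>"
proof (cases "\<theta> \<le> pi")
  case True
  then show ?thesis using assms by (simp add: circle_angle_def sin_ge_zero arccos_cos)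
next
  case False
  then have "sin \<theta> < 0" using assms by (intro sin_lt_zero) auto
  moreover have "arccos (cos \<theta>) = 2 * pi - \<theta>"
  proof -
    have "cos \<theta> = cos (2 * pi - \<theta>)" by simp
    then show ?thesis using arccos_cos[of "2 * pi - \<theta>"] assms False by simp
  qed
  ultimately show ?thesis by (simp add: circle_angle_def)
qed

lemma measurable_to_circle: "cis \<in> measurable dtheta circle_borel"
  unfolding circle_borel_def
  by (rule measurable_restrict_space2) auto

lemma ac_density_measurable:
  assumes "is_ac_density \<mu> w"
  shows "w \<in> borel_measurable dtheta"
  using assms by (simp add: is_ac_density_def measurable_cong_sets[OF sets_dtheta refl])

context nontrivial_circle_measure
begin

lemma sets_circle_borel_iff: "E \<in> sets circle_borel \<longleftrightarrow> E \<in> sets borel \<and> E \<subseteq> sphere 0 1"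
  unfolding circle_borel_def by (subst sets_restrict_space_iff) auto

text \<open>Off a set carrying the singular part, the measure is \<open>w d\<theta> / (2 \<pi>)\<close>.\<close>

lemma ac_part:
  assumes "is_ac_density \<mu> w"
  obtains A where "A \<in> sets borel" "AE \<theta> in dtheta. cis \<theta> \<notin> A"
    "\<And>f :: complex \<Rightarrow> ennreal. f \<in> borel_measurable borel \<Longrightarrow>
       (\<integral>\<^sup>+z. f z * indicator (- A) z \<partial>\<mu>) = (\<integral>\<^sup>+\<theta>. ennreal (w \<theta>) * f (cis \<theta>) \<partial>dtheta)"
proof -
  note [measurable] = ac_density_measurable[OF assms] measurable_to_circle
  obtain S where S: "sets S = sets circle_borel" "singular_on_circle S"
    and \<mu>: "\<And>E. E \<in> sets circle_borel \<Longrightarrow>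
      emeasure \<mu> E = emeasure (to_circle (density dtheta (\<lambda>\<theta>. ennreal (w \<theta>)))) E + emeasure S E"
    using assms unfolding is_ac_density_def by blast
  obtain A where A: "A \<in> sets circle_borel" "emeasure (to_circle dtheta) A = 0" "emeasure S (space S - A) = 0"
    using S(2) unfolding singular_on_circle_def by blast
  have A': "A \<in> sets borel" "A \<subseteq> sphere 0 1" using A(1) by (auto simp: sets_circle_borel_iff)
  have spc: "space circle_borel = sphere 0 1" by (simp add: circle_borel_def space_restrict_space)
  define N where "N = to_circle (density dtheta (\<lambda>\<theta>. ennreal (w \<theta>)))"
  have m: "cis \<in> measurable (density dtheta (\<lambda>\<theta>. ennreal (w \<theta>))) circle_borel" by measurable
  have setsN: "sets N = sets circle_borel" by (simp add: N_def to_circle_def)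
  have nonA: "AE \<theta> in dtheta. cis \<theta> \<notin> A"
  proof -
    have "emeasure dtheta (cis -` A \<inter> space dtheta) = 0"
      using A(1,2) by (simp add: to_circle_def emeasure_distr[OF measurable_to_circle])
    moreover have "cis -` A \<inter> space dtheta \<in> sets dtheta"
      using measurable_sets[OF measurable_to_circle A(1)] .
    ultimately have "cis -` A \<inter> space dtheta \<in> null_sets dtheta" by auto
    then show ?thesis by (rule AE_I') auto
  qed
  have NA: "emeasure N A = 0"
  proof -
    have "emeasure N A = (\<integral>\<^sup>+\<theta>. ennreal (w \<theta>) * indicator (cis -` A \<inter> space dtheta) \<theta> \<partial>dtheta)"
      using A(1) measurable_sets[OF measurable_to_circle A(1)]
      by (simp add: N_def to_circle_def emeasure_distr[OF m] emeasure_density)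
    also have "\<dots> = (\<integral>\<^sup>+\<theta>. 0 \<partial>dtheta)"
      by (rule nn_integral_cong_AE) (use nonA in eventually_elim, auto)
    finally show ?thesis by simp
  qed
  have eq: "density \<mu> (indicator (- A)) = N"
  proof (rule measure_eqI)
    show "sets (density \<mu> (indicator (- A))) = sets N" using setsN sets_mu by simp
    fix E assume "E \<in> sets (density \<mu> (indicator (- A)))"
    then have E: "E \<in> sets circle_borel" by (simp add: sets_mu)
    then have EA: "E - A \<in> sets circle_borel" using A(1) by auto
    have "indicator (- A) \<in> borel_measurable \<mu>" using A' by (intro measurable_mu_borel) auto
    then have "emeasure (density \<mu> (indicator (- A))) E = (\<integral>\<^sup>+z. indicator (- A) z * indicator E z \<partial>\<mu>)"
      using E by (subst emeasure_density) (auto simp: sets_mu)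
    also have "\<dots> = (\<integral>\<^sup>+z. indicator (E - A) z \<partial>\<mu>)"
      by (rule nn_integral_cong) (auto simp: indicator_def)
    also have "\<dots> = emeasure \<mu> (E - A)" using EA by (simp add: sets_mu)
    also have "\<dots> = emeasure N (E - A) + emeasure S (E - A)" using \<mu>[OF EA] by (simp add: N_def)
    also have "emeasure S (E - A) = 0"
    proof -
      have "emeasure S (E - A) \<le> emeasure S (space S - A)"
        using E A(1) S(1) sets.sets_into_space[of E S] by (intro emeasure_mono) auto
      then show ?thesis using A(3) by simp
    qed
    also have "emeasure N (E - A) = emeasure N E"
      using E A(1) NA setsN by (intro emeasure_Diff_null_set) auto
    finally show "emeasure (density \<mu> (indicator (- A))) E = emeasure N E" by simp
  qed
  have "(\<integral>\<^sup>+z. f z * indicator (- A) z \<partial>\<mu>) = (\<integral>\<^sup>+\<theta>. ennreal (w \<theta>) * f (cis \<theta>) \<partial>dtheta)"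
    if f: "f \<in> borel_measurable borel" for f :: "complex \<Rightarrow> ennreal"
  proof -
    have f': "f \<in> borel_measurable \<mu>" "indicator (- A) \<in> borel_measurable \<mu>"
      using f A' by (auto intro: measurable_mu_borel)
    have fc: "f \<in> borel_measurable circle_borel" unfolding circle_borel_def using f by (rule measurable_restrict_space1)
    have fd: "(\<lambda>\<theta>. f (cis \<theta>)) \<in> borel_measurable dtheta" using f by measurable
    have "(\<integral>\<^sup>+z. f z * indicator (- A) z \<partial>\<mu>) = (\<integral>\<^sup>+z. f z \<partial>density \<mu> (indicator (- A)))"
      using f' by (subst nn_integral_density) (auto simp: mult.commute)
    also have "\<dots> = (\<integral>\<^sup>+z. f z \<partial>N)" by (simp only: eq)
    also have "\<dots> = (\<integral>\<^sup>+\<theta>. f (cis \<theta>) \<partial>density dtheta (\<lambda>\<theta>. ennreal (w \<theta>)))"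
      unfolding N_def to_circle_def by (rule nn_integral_distr[OF m]) (simp add: fc)
    also have "\<dots> = (\<integral>\<^sup>+\<theta>. ennreal (w \<theta>) * f (cis \<theta>) \<partial>dtheta)"
      using fd by (subst nn_integral_density) auto
    finally show ?thesis .
  qed
  then show ?thesis using that A' nonA by blast
qed

lemma nn_integral_ac_le:
  assumes "is_ac_density \<mu> w" "f \<in> borel_measurable borel"
  shows "(\<integral>\<^sup>+\<theta>. ennreal (w \<theta>) * f (cis \<theta>) \<partial>dtheta) \<le> (\<integral>\<^sup>+z. f z \<partial>\<mu>)"
proof -
  obtain A where "(\<integral>\<^sup>+z. f z * indicator (- A) z \<partial>\<mu>) = (\<integral>\<^sup>+\<theta>. ennreal (w \<theta>) * f (cis \<theta>) \<partial>dtheta)"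
    using ac_part[OF assms(1)] assms(2) by metis
  moreover have "(\<integral>\<^sup>+z. f z * indicator (- A) z \<partial>\<mu>) \<le> (\<integral>\<^sup>+z. f z \<partial>\<mu>)"
    by (intro nn_integral_mono) (auto simp: indicator_def)
  ultimately show ?thesis by simp
qed

lemma ac_density_integrable:
  assumes "is_ac_density \<mu> w"
  shows "integrable dtheta w"
proof (rule integrableI_nonneg)
  show "w \<in> borel_measurable dtheta" by (rule ac_density_measurable[OF assms])
  show "AE \<theta> in dtheta. 0 \<le> w \<theta>"
    using assms by (intro AE_I2) (auto simp: is_ac_density_def space_dtheta)
  have "(\<integral>\<^sup>+\<theta>. ennreal (w \<theta>) * 1 \<partial>dtheta) \<le> (\<integral>\<^sup>+z. 1 \<partial>\<mu>)"
    by (rule nn_integral_ac_le[OF assms]) simp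
  also have "\<dots> = 1" by (simp add: emeasure_space_1)
  finally show "(\<integral>\<^sup>+\<theta>. ennreal (w \<theta>) \<partial>dtheta) < \<infinity>" by (auto intro: le_less_trans)
qed

lemma abs_ln_add_le: "0 \<le> x \<Longrightarrow> 0 < e \<Longrightarrow> \<bar>ln (x + e)\<bar> \<le> \<bar>ln e\<bar> + e + (x :: real)"
proof -
  assume "0 \<le> x" "0 < e"
  then have "ln e \<le> ln (x + e)" "ln (x + e) \<le> x + e" using ln_le_minus_one[of "x + e"] by auto
  then show ?thesis using \<open>0 \<le> x\<close> \<open>0 < e\<close> by linarith
qed

lemma integrable_ln_add:
  assumes "is_ac_density \<mu> w" "e > 0"
  shows "integrable dtheta (\<lambda>\<theta>. ln (w \<theta> + e))"
proof (rule Bochner_Integration.integrable_bound)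
  note [measurable] = ac_density_measurable[OF assms(1)]
  show "integrable dtheta (\<lambda>\<theta>. \<bar>ln e\<bar> + e + w \<theta>)"
    using ac_density_integrable[OF assms(1)] by auto
  show "(\<lambda>\<theta>. ln (w \<theta> + e)) \<in> borel_measurable dtheta" by measurable
  show "AE \<theta> in dtheta. norm (ln (w \<theta> + e)) \<le> norm (\<bar>ln e\<bar> + e + w \<theta>)"
    using assms abs_ln_add_le by (intro AE_I2) (force simp: is_ac_density_def space_dtheta)
qed

text \<open>The singular part of \<open>\<mu>\<close> does not matter, because the test function \<open>T\<close> in the variational
  inequality may be chosen arbitrarily negative on the null set that carries it.\<close>

lemma szego_const_le_exp_ln_add:
  assumes w: "is_ac_density \<mu> w" and e: "e > 0"
  shows "szego_const \<le> exp (LINT \<theta>|dtheta. ln (w \<theta> + e))"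
proof -
  let ?I = "LINT \<theta>|dtheta. ln (w \<theta> + e)"
  have w0: "0 \<le> w \<theta>" if "0 \<le> \<theta>" "\<theta> < 2 * pi" for \<theta> using w that by (auto simp: is_ac_density_def)
  obtain A where A [measurable]: "A \<in> sets borel" and nonA: "AE \<theta> in dtheta. cis \<theta> \<notin> A"
    and acp: "\<And>f :: complex \<Rightarrow> ennreal. f \<in> borel_measurable borel \<Longrightarrow>
       (\<integral>\<^sup>+z. f z * indicator (- A) z \<partial>\<mu>) = (\<integral>\<^sup>+\<theta>. ennreal (w \<theta>) * f (cis \<theta>) \<partial>dtheta)"
    using ac_part[OF w] by blast
  define w' where "w' \<theta> = indicator {0..<2*pi} \<theta> *\<^sub>R w \<theta>" for \<theta>
  have "w \<in> borel_measurable (restrict_space borel {0..<2*pi})" using w by (simp add: is_ac_density_def)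
  then have [measurable]: "w' \<in> borel_measurable borel"
    unfolding w'_def by (subst (asm) borel_measurable_restrict_space_iff) auto
  have w'0: "w' \<theta> \<ge> 0" for \<theta> using w0 by (auto simp: w'_def indicator_def)
  have w'cis: "w' (circle_angle (cis \<theta>)) = w \<theta>" if "\<theta> \<in> space dtheta" for \<theta>
    using that by (simp add: space_dtheta circle_angle_cis w'_def)
  have le: "szego_const * exp (- ?I) \<le> 1 + exp (- real n)" for n
  proof -
    \<comment> \<open>The set \<open>A\<close> is a null set for \<open>d\<theta>\<close> that carries the singular part.\<close>
    define T where "T z = (if z \<in> A then - real n else - ln (w' (circle_angle z) + e))" for z
    have T [measurable]: "T \<in> borel_measurable borel" unfolding T_def by measurable
    have Tb: "T z \<le> max 0 (- ln e)" for z
    proof -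
      have "ln e \<le> ln (w' (circle_angle z) + e)" using e w'0[of "circle_angle z"] by (intro ln_mono) auto
      then show ?thesis by (simp add: T_def max_def)
    qed
    have Tcis: "AE \<theta> in dtheta. T (cis \<theta>) = - ln (w \<theta> + e)"
      using nonA AE_space by eventually_elim (simp add: T_def w'cis)
    have Tm: "(\<lambda>\<theta>. T (cis \<theta>)) \<in> borel_measurable dtheta" by measurable
    have int: "integrable dtheta (\<lambda>\<theta>. T (cis \<theta>))"
      using integrable_ln_add[OF w e] Tcis Tm by (subst integrable_cong_AE[OF _ _ Tcis]) auto
    have "(LINT \<theta>|dtheta. T (cis \<theta>)) = (LINT \<theta>|dtheta. - ln (w \<theta> + e))"
      using integrable_ln_add[OF w e] Tm by (intro integral_cong_AE[OF _ _ Tcis]) auto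
    then have I: "(LINT \<theta>|dtheta. T (cis \<theta>)) = - ?I" by simp
    have "(\<integral>\<^sup>+z. ennreal (exp (T z)) \<partial>\<mu>)
        \<le> (\<integral>\<^sup>+z. ennreal (exp (- real n)) + ennreal (1 / (w' (circle_angle z) + e)) * indicator (- A) z \<partial>\<mu>)"
    proof (rule nn_integral_mono)
      fix z
      have "0 < w' (circle_angle z) + e" using w'0[of "circle_angle z"] e by simp
      then show "ennreal (exp (T z)) \<le> ennreal (exp (- real n)) + ennreal (1 / (w' (circle_angle z) + e)) * indicator (- A) z"
        by (auto simp: T_def indicator_def exp_minus inverse_eq_divide)
    qed
    also have "\<dots> = ennreal (exp (- real n)) + (\<integral>\<^sup>+z. ennreal (1 / (w' (circle_angle z) + e)) * indicator (- A) z \<partial>\<mu>)"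
      by (subst nn_integral_add) (auto intro!: measurable_mu_borel simp: emeasure_space_1)
    also have "(\<integral>\<^sup>+z. ennreal (1 / (w' (circle_angle z) + e)) * indicator (- A) z \<partial>\<mu>)
        = (\<integral>\<^sup>+\<theta>. ennreal (w \<theta>) * ennreal (1 / (w' (circle_angle (cis \<theta>)) + e)) \<partial>dtheta)"
      by (rule acp) measurable
    also have "\<dots> \<le> (\<integral>\<^sup>+\<theta>. 1 \<partial>dtheta)"
    proof (rule nn_integral_mono)
      fix \<theta> assume \<theta>: "\<theta> \<in> space dtheta"
      then have "0 \<le> w \<theta>" using w0 by (simp add: space_dtheta)
      then have "w \<theta> * (1 / (w \<theta> + e)) \<le> 1" using e by (simp add: field_simps)
      then show "ennreal (w \<theta>) * ennreal (1 / (w' (circle_angle (cis \<theta>)) + e)) \<le> 1"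
        using \<open>0 \<le> w \<theta>\<close> e \<theta> by (simp add: w'cis flip: ennreal_mult)
    qed
    also have "\<dots> = 1" by (simp add: dtheta.emeasure_space_1)
    finally have le: "(\<integral>\<^sup>+z. ennreal (exp (T z)) \<partial>\<mu>) \<le> ennreal (exp (- real n) + 1)"
      by (simp add: ennreal_plus)
    have "(LINT z|\<mu>. exp (T z)) = enn2real (\<integral>\<^sup>+z. ennreal (exp (T z)) \<partial>\<mu>)"
      by (rule integral_eq_nn_integral) (auto intro!: measurable_mu_borel)
    also have "\<dots> \<le> exp (- real n) + 1"
      using le by (intro enn2real_leI) auto
    finally show ?thesis using szego_exp_bounded_above[OF T Tb int] I by simp
  qed
  have "(\<lambda>n. 1 + exp (- real n)) \<longlonglongrightarrow> 1 + 0"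
  proof (intro tendsto_add tendsto_const)
    show "(\<lambda>n. exp (- real n)) \<longlonglongrightarrow> 0"
      by (rule filterlim_compose[OF exp_at_bot])
         (simp add: filterlim_uminus_at_bot filterlim_real_sequentially)
  qed
  then have "(\<lambda>n. 1 + exp (- real n)) \<longlonglongrightarrow> 1" by simp
  then have "szego_const * exp (- ?I) \<le> 1"
    by (rule LIMSEQ_le_const) (intro exI allI impI le)
  then show ?thesis by (simp add: exp_minus field_simps)
qed

text \<open>Passage to the limit \<open>\<epsilon> \<rightarrow> 0\<close> by Fatou's lemma. Where \<open>w\<close> vanishes, \<open>- ln (w + \<epsilon>)\<close> tends to
  infinity, so this happens on a null set only; it has to be excluded separately since \<open>ln 0 = 0\<close>.\<close>

lemma ln_density_integrable:
  assumes w: "is_ac_density \<mu> w" and pos: "szego_const > 0"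
  shows "AE \<theta> in dtheta. w \<theta> > 0" "integrable dtheta (\<lambda>\<theta>. ln (w \<theta>))"
    "(LINT \<theta>|dtheta. ln (w \<theta>)) \<ge> ln szego_const"
proof -
  note [measurable] = ac_density_measurable[OF w]
  define f where "f n \<theta> = ln (w \<theta> + 1 / real (Suc n))" for n \<theta>
  have w0: "0 \<le> w \<theta>" if "\<theta> \<in> space dtheta" for \<theta> using w that by (auto simp: is_ac_density_def space_dtheta)
  have intf: "integrable dtheta (f n)" for n unfolding f_def by (rule integrable_ln_add[OF w]) simp
  have If: "ln szego_const \<le> (LINT \<theta>|dtheta. f n \<theta>)" for n
  proof -
    have "szego_const \<le> exp (LINT \<theta>|dtheta. f n \<theta>)"
      unfolding f_def by (rule szego_const_le_exp_ln_add[OF w]) simp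
    then have "ln szego_const \<le> ln (exp (LINT \<theta>|dtheta. f n \<theta>))" using pos by (intro ln_mono) auto
    then show ?thesis by simp
  qed
  have fm: "f n \<theta> \<le> f 0 \<theta>" if "\<theta> \<in> space dtheta" for n \<theta>
  proof -
    have "1 / real (Suc n) \<le> 1" by simp
    moreover have "0 < w \<theta> + 1 / real (Suc n)" using w0[OF that] by (intro add_nonneg_pos) auto
    ultimately show ?thesis unfolding f_def by (intro ln_mono) auto
  qed
  define C where "C = (LINT \<theta>|dtheta. f 0 \<theta>) - ln szego_const"
  have nnb: "(\<integral>\<^sup>+\<theta>. ennreal (f 0 \<theta> - f n \<theta>) \<partial>dtheta) \<le> ennreal C" for n
  proof -
    have "(\<integral>\<^sup>+\<theta>. ennreal (f 0 \<theta> - f n \<theta>) \<partial>dtheta) = ennreal (LINT \<theta>|dtheta. f 0 \<theta> - f n \<theta>)"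
      using intf fm by (intro nn_integral_eq_integral) auto
    also have "(LINT \<theta>|dtheta. f 0 \<theta> - f n \<theta>) \<le> C"
      using intf If[of n] by (simp add: C_def)
    finally show ?thesis by (simp add: ennreal_leI)
  qed
  have fat: "(\<integral>\<^sup>+\<theta>. liminf (\<lambda>n. ennreal (f 0 \<theta> - f n \<theta>)) \<partial>dtheta) \<le> ennreal C"
  proof -
    have "(\<integral>\<^sup>+\<theta>. liminf (\<lambda>n. ennreal (f 0 \<theta> - f n \<theta>)) \<partial>dtheta)
        \<le> liminf (\<lambda>n. \<integral>\<^sup>+\<theta>. ennreal (f 0 \<theta> - f n \<theta>) \<partial>dtheta)"
      by (rule nn_integral_liminf) (simp add: f_def)
    also have "\<dots> \<le> limsup (\<lambda>n. \<integral>\<^sup>+\<theta>. ennreal (f 0 \<theta> - f n \<theta>) \<partial>dtheta)"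
      by (rule Liminf_le_Limsup) simp
    also have "\<dots> \<le> ennreal C" by (rule Limsup_bounded) (simp add: nnb)
    finally show ?thesis .
  qed
  have inv0: "(\<lambda>n. 1 / real (Suc n)) \<longlonglongrightarrow> 0"
    using LIMSEQ_inverse_real_of_nat by (simp add: inverse_eq_divide)
  have liminf_pos: "liminf (\<lambda>n. ennreal (f 0 \<theta> - f n \<theta>)) = ennreal (f 0 \<theta> - ln (w \<theta>))" if "w \<theta> > 0" for \<theta>
  proof -
    have "(\<lambda>n. f n \<theta>) \<longlonglongrightarrow> ln (w \<theta> + 0)"
      unfolding f_def using that by (intro tendsto_ln tendsto_add tendsto_const inv0) simp
    then have "(\<lambda>n. ennreal (f 0 \<theta> - f n \<theta>)) \<longlonglongrightarrow> ennreal (f 0 \<theta> - ln (w \<theta>))"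
      by (intro tendsto_ennrealI tendsto_intros) simp
    then show ?thesis by (intro lim_imp_Liminf) simp_all
  qed
  have liminf_0: "liminf (\<lambda>n. ennreal (f 0 \<theta> - f n \<theta>)) = \<infinity>" if "w \<theta> = 0" for \<theta>
  proof -
    have "f n \<theta> = - ln (real (Suc n))" for n using that by (simp add: f_def ln_div del: of_nat_Suc)
    then have "(\<lambda>n. ennreal (f 0 \<theta> - f n \<theta>)) = (\<lambda>n. ennreal (ln (real (Suc n))))" by simp
    moreover have "filterlim (\<lambda>n. ln (real (Suc n))) at_top sequentially"
      by (rule filterlim_compose[OF ln_at_top])
         (rule filterlim_compose[OF filterlim_real_sequentially filterlim_Suc])
    then have "(\<lambda>n. ennreal (ln (real (Suc n)))) \<longlonglongrightarrow> \<infinity>"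
      by (simp add: ennreal_tendsto_top_eq_at_top)
    ultimately show ?thesis by (intro lim_imp_Liminf) simp_all
  qed
  have "AE \<theta> in dtheta. liminf (\<lambda>n. ennreal (f 0 \<theta> - f n \<theta>)) \<noteq> \<infinity>"
    using fat by (intro nn_integral_noteq_infinite) (auto simp: f_def top_unique)
  then show wpos: "AE \<theta> in dtheta. w \<theta> > 0"
    using AE_space by eventually_elim (use w0 liminf_0 in \<open>force simp: less_le\<close>)
  have ge: "AE \<theta> in dtheta. 0 \<le> f 0 \<theta> - ln (w \<theta>)"
    using wpos by eventually_elim (simp add: f_def ln_mono)
  have "(\<integral>\<^sup>+\<theta>. ennreal (f 0 \<theta> - ln (w \<theta>)) \<partial>dtheta) \<le> ennreal C"
  proof -
    have "(\<integral>\<^sup>+\<theta>. ennreal (f 0 \<theta> - ln (w \<theta>)) \<partial>dtheta)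
        = (\<integral>\<^sup>+\<theta>. liminf (\<lambda>n. ennreal (f 0 \<theta> - f n \<theta>)) \<partial>dtheta)"
      by (rule nn_integral_cong_AE) (use wpos in \<open>eventually_elim, simp add: liminf_pos\<close>)
    then show ?thesis using fat by simp
  qed
  moreover have m: "(\<lambda>\<theta>. f 0 \<theta> - ln (w \<theta>)) \<in> borel_measurable dtheta" by (simp add: f_def)
  ultimately have int: "integrable dtheta (\<lambda>\<theta>. f 0 \<theta> - ln (w \<theta>))"
    by (intro integrableI_nonneg ge) (auto intro: le_less_trans)
  have "integrable dtheta (\<lambda>\<theta>. f 0 \<theta> - (f 0 \<theta> - ln (w \<theta>)))"
    by (intro Bochner_Integration.integrable_diff intf int)
  then show intln: "integrable dtheta (\<lambda>\<theta>. ln (w \<theta>))" by simp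
  have "ennreal (LINT \<theta>|dtheta. f 0 \<theta> - ln (w \<theta>)) \<le> ennreal C"
    using \<open>(\<integral>\<^sup>+\<theta>. ennreal (f 0 \<theta> - ln (w \<theta>)) \<partial>dtheta) \<le> ennreal C\<close>
    by (simp add: nn_integral_eq_integral[OF int ge])
  moreover have "0 \<le> C" using If[of 0] by (simp add: C_def)
  ultimately have "(LINT \<theta>|dtheta. f 0 \<theta> - ln (w \<theta>)) \<le> C" by (simp add: ennreal_le_iff)
  then show "(LINT \<theta>|dtheta. ln (w \<theta>)) \<ge> ln szego_const"
    using intf intln by (simp add: C_def)
qed

end

section \<open>Fourier coefficients of the logarithm of a polynomial\<close>

text \<open>The formal logarithm is determined by its logarithmic derivative and its constant term.\<close>

lemma fps_log_unique:
  fixes F G :: "'a :: field_char_0 fps"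
  assumes F0: "fps_nth F 0 = 1" and G0: "fps_nth G 0 = 0" and G: "fps_deriv G * F = fps_deriv F"
  shows "G = fps_ln 1 oo (F - 1)"
proof -
  let ?H = "fps_ln 1 oo (F - 1)"
  have b0: "fps_nth (F - 1) 0 = 0" using F0 by simp
  have "inverse (1 + fps_X :: 'a fps) oo (F - 1) = inverse ((1 + fps_X) oo (F - 1))"
    by (rule fps_inverse_compose[OF b0]) simp
  also have "(1 + fps_X) oo (F - 1) = F"
    by (simp add: fps_compose_add_distrib fps_X_fps_compose_startby0[OF b0])
  finally have "fps_deriv ?H = inverse F * fps_deriv F"
    by (simp add: fps_compose_deriv[OF b0] fps_ln_deriv)
  moreover have "inverse F * F = 1" using F0 by (simp add: inverse_mult_eq_1)
  ultimately have "fps_deriv G = fps_deriv ?H"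
    unfolding G[symmetric] by (metis (no_types, opaque_lifting) mult.commute mult.left_commute mult_1_right)
  then show ?thesis using G0 by (simp add: fps_deriv_eq_iff)
qed

lemma integral_dtheta_cnj_cis_power:
  "(LINT \<theta>|dtheta. cnj (cis \<theta>) ^ m * cis \<theta> ^ k) = (if k = m then 1 else 0)"
proof -
  have 1: "cnj (cis \<theta>) ^ j * cis \<theta> ^ j = 1" for \<theta> j
    by (simp flip: power_mult_distrib add: complex_norm_square[symmetric] mult.commute)
  have *: "cnj (cis \<theta>) ^ j * cis \<theta> ^ (j + i) = cis \<theta> ^ i" for \<theta> i j
    using 1[of \<theta> j] by (simp add: power_add mult.assoc[symmetric])
  have **: "cnj (cis \<theta>) ^ (j + i) * cis \<theta> ^ j = cnj (cis \<theta> ^ i)" for \<theta> i j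
    using 1[of \<theta> j] by (simp add: power_add mult_ac)
  show ?thesis
  proof (cases "m \<le> k")
    case True
    then obtain i where "k = m + i" using le_Suc_ex by blast
    then show ?thesis by (simp add: * integral_dtheta_cis_power del: complex_cnj_power)
  next
    case False
    then obtain i where i: "m = k + i" "i > 0" using less_imp_add_positive[of k m] by auto
    have "(LINT \<theta>|dtheta. cnj (cis \<theta> ^ i)) = cnj (LINT \<theta>|dtheta. cis \<theta> ^ i)"
      by (rule Bochner_Integration.integral_cnj)
    then show ?thesis using i by (simp add: ** integral_dtheta_cis_power del: complex_cnj_power)
  qed
qed

text \<open>A holomorphic logarithm \<open>L\<close> of \<open>B\<close> with \<open>L 0 = 0\<close> exists on a slightly larger disc, so its power
  series converges absolutely on the circle, and \<open>2 * ln \<bar>B\<bar> = L + cnj L\<close> there.\<close>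

lemma log_poly_fourier:
  fixes B :: "complex poly"
  assumes B0: "coeff B 0 = 1" and nz: "\<And>z. norm z \<le> 1 \<Longrightarrow> poly B z \<noteq> 0"
  shows "(LINT \<theta>|dtheta. ln (norm (poly B (cis \<theta>)))) = 0"
    and "m \<ge> 1 \<Longrightarrow> (LINT \<theta>|dtheta. cnj (cis \<theta>) ^ m * of_real (2 * ln (norm (poly B (cis \<theta>)))))
      = fps_nth (fps_ln 1 oo (fps_of_poly B - 1)) m"
proof -
  obtain e where e: "e > 0" "(\<Union>z\<in>cball 0 1. ball z e) \<subseteq> {z. poly B z \<noteq> 0}"
  proof (rule compact_subset_open_imp_ball_epsilon_subset)
    show "open {z. poly B z \<noteq> 0}" by (intro open_Collect_neq continuous_intros)
    show "cball 0 1 \<subseteq> {z. poly B z \<noteq> 0}" using nz by auto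
  qed auto
  \<comment> \<open>By compactness the disc without zeros can be enlarged.\<close>
  define R where "R = 1 + e"
  have R: "R > 1" using e by (simp add: R_def)
  have nzR: "poly B z \<noteq> 0" if "z \<in> ball 0 R" for z
  proof (cases "norm z \<le> 1")
    case False
    then have "z \<noteq> 0" by auto
    have "dist (z / of_real (norm z)) z = \<bar>1 - norm z\<bar>"
    proof -
      have "z / of_real (norm z) - z = of_real (1 - norm z) * (z / of_real (norm z))"
        using \<open>z \<noteq> 0\<close> by (simp add: field_simps)
      then show ?thesis using \<open>z \<noteq> 0\<close> by (simp add: dist_norm norm_mult norm_divide del: of_real_diff)
    qed
    then have "z \<in> ball (z / of_real (norm z)) e" using that False by (simp add: R_def)
    moreover have "z / of_real (norm z) \<in> cball 0 1" using \<open>z \<noteq> 0\<close> by (simp add: norm_divide)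
    ultimately show ?thesis using e(2) by blast
  qed (use nz in auto)
  obtain g where g: "g holomorphic_on ball 0 R" "\<And>z. z \<in> ball 0 R \<Longrightarrow> exp (g z) = poly B z"
  proof (rule holomorphic_logarithm_exists[of "ball 0 R" "poly B" 0])
    show "poly B holomorphic_on ball 0 R" by (intro holomorphic_intros)
  qed (use R nzR in auto)
  define L where "L z = g z - g 0" for z
  have L: "L holomorphic_on ball 0 R" unfolding L_def by (intro holomorphic_intros g)
  have expL: "exp (L z) = poly B z" if "z \<in> ball 0 R" for z
    using g(2)[OF that] g(2)[of 0] R B0 by (simp add: L_def exp_diff poly_0_coeff_0)
  define G where "G = fps_expansion L 0"
  have LG: "L has_fps_expansion G"
    unfolding G_def by (rule has_fps_expansion_fps_expansion[of "ball 0 R"]) (use R L in auto)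
  have BF: "poly B has_fps_expansion fps_of_poly B"
    using eval_fps_has_fps_expansion[of "fps_of_poly B"] by (simp add: eval_fps_of_poly[abs_def])
  have G0: "fps_nth G 0 = 0" by (simp add: G_def fps_expansion_def L_def)
  have "fps_deriv G * fps_of_poly B = fps_deriv (fps_of_poly B)"
  proof (rule fps_expansion_unique_complex)
    show "(\<lambda>z. deriv L z * poly B z) has_fps_expansion fps_deriv G * fps_of_poly B"
      by (intro has_fps_expansion_mult has_fps_expansion_deriv LG BF)
    have "deriv (poly B) has_fps_expansion fps_deriv (fps_of_poly B)"
      by (intro has_fps_expansion_deriv BF)
    moreover have "\<forall>\<^sub>F z in nhds 0. deriv L z * poly B z = deriv (poly B) z"
    proof -
      have "\<forall>\<^sub>F z in nhds 0. z \<in> ball 0 R" using R by (intro eventually_nhds_in_open) auto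
      then show ?thesis
      proof eventually_elim
        case (elim z)
        have "(L has_field_derivative deriv L z) (at z)"
          using L elim by (intro holomorphic_derivI[of L "ball 0 R"]) auto
        then have "((\<lambda>z. exp (L z)) has_field_derivative exp (L z) * deriv L z) (at z)"
          by (rule DERIV_fun_exp)
        then have "(poly B has_field_derivative exp (L z) * deriv L z) (at z)"
          by (rule has_field_derivative_transform_within_open[of _ _ _ "ball 0 R"]) (use elim expL in auto)
        then show ?case using expL[OF elim] by (simp add: DERIV_imp_deriv mult.commute)
      qed
    qed
    ultimately show "(\<lambda>z. deriv L z * poly B z) has_fps_expansion fps_deriv (fps_of_poly B)"
      by (subst has_fps_expansion_cong[OF _ refl])
  qed
  then have Glog: "G = fps_ln 1 oo (fps_of_poly B - 1)"
    by (intro fps_log_unique) (simp_all add: B0 G0)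
  have ser: "(\<lambda>k. fps_nth G k * z ^ k) sums L z" if "z \<in> ball 0 R" for z
    using holomorphic_power_series[OF L that] by (simp add: G_def fps_expansion_def)
  obtain r where r: "1 < r" "r < R" using R dense by blast
  have "summable (\<lambda>k. norm (fps_nth G k * 1 ^ k))"
    using sums_summable[OF ser[of "of_real r"]] r by (intro powser_insidea[of _ "of_real r"]) auto
  then have sumG: "summable (\<lambda>k. norm (fps_nth G k))" by simp
  have cisR: "cis \<theta> \<in> ball 0 R" for \<theta> using R by simp
  have contL: "continuous_on UNIV (\<lambda>\<theta>. L (cis \<theta>))"
    by (rule continuous_on_compose2[OF holomorphic_on_imp_continuous_on[OF L]])
       (use cisR in \<open>auto intro!: continuous_intros\<close>)
  have intL: "(\<lambda>k. fps_nth G k * (LINT \<theta>|dtheta. u \<theta> * cis \<theta> ^ k)) sums (LINT \<theta>|dtheta. u \<theta> * L (cis \<theta>))"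
    if u: "continuous_on UNIV u" "\<And>\<theta>. norm (u \<theta>) = 1" for u :: "real \<Rightarrow> complex"
  proof -
    have "(\<lambda>k. LINT \<theta>|dtheta. fps_nth G k * (u \<theta> * cis \<theta> ^ k))
        sums (LINT \<theta>|dtheta. (\<Sum>k. fps_nth G k * (u \<theta> * cis \<theta> ^ k)))"
    proof (rule sums_integral)
      show "integrable dtheta (\<lambda>\<theta>. fps_nth G k * (u \<theta> * cis \<theta> ^ k))" for k
        by (intro integrable_dtheta_continuous continuous_intros u)
    qed (use sumG in \<open>simp_all add: norm_mult norm_power u dtheta.prob_space\<close>)
    also have "(\<lambda>\<theta>. \<Sum>k. fps_nth G k * (u \<theta> * cis \<theta> ^ k)) = (\<lambda>\<theta>. u \<theta> * L (cis \<theta>))"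
    proof
      fix \<theta>
      have "(\<lambda>k. u \<theta> * (fps_nth G k * cis \<theta> ^ k)) sums (u \<theta> * L (cis \<theta>))"
        by (intro sums_mult ser cisR)
      then show "(\<Sum>k. fps_nth G k * (u \<theta> * cis \<theta> ^ k)) = u \<theta> * L (cis \<theta>)"
        by (simp add: sums_iff mult_ac)
    qed
    finally show ?thesis by simp
  qed
  have I1: "(LINT \<theta>|dtheta. cnj (cis \<theta>) ^ j * L (cis \<theta>)) = fps_nth G j" for j
  proof -
    have "(\<lambda>k. fps_nth G k * (if k = j then 1 else 0)) sums (LINT \<theta>|dtheta. cnj (cis \<theta>) ^ j * L (cis \<theta>))"
      using intL[of "\<lambda>\<theta>. cnj (cis \<theta>) ^ j"]
      by (simp add: integral_dtheta_cnj_cis_power norm_power continuous_intros del: complex_cnj_power)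
    moreover have "(\<lambda>k. fps_nth G k * (if k = j then 1 else 0)) sums fps_nth G j"
      using sums_If_finite_set[of "{j}" "fps_nth G"] by (simp add: if_distrib cong: if_cong)
    ultimately show ?thesis by (rule sums_unique2)
  qed
  have I2: "(LINT \<theta>|dtheta. cnj (cis \<theta>) ^ j * cnj (L (cis \<theta>))) = 0" for j
  proof -
    have "(\<lambda>k. fps_nth G k * (LINT \<theta>|dtheta. cis \<theta> ^ j * cis \<theta> ^ k)) sums (LINT \<theta>|dtheta. cis \<theta> ^ j * L (cis \<theta>))"
      by (rule intL) (auto intro!: continuous_intros simp: norm_power)
    moreover have "fps_nth G k * (LINT \<theta>|dtheta. cis \<theta> ^ j * cis \<theta> ^ k) = 0" for k
      using G0 by (cases "k = 0") (simp_all add: integral_dtheta_cis_power flip: power_add)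
    ultimately have "(LINT \<theta>|dtheta. cis \<theta> ^ j * L (cis \<theta>)) = 0"
      by (metis (no_types, lifting) sums_unique2 sums_0)
    then have "(LINT \<theta>|dtheta. cnj (cis \<theta> ^ j * L (cis \<theta>))) = 0"
      by (simp only: Bochner_Integration.integral_cnj complex_cnj_zero)
    then show ?thesis by simp
  qed
  have ln: "complex_of_real (2 * ln (norm (poly B (cis \<theta>)))) = L (cis \<theta>) + cnj (L (cis \<theta>))" for \<theta>
  proof -
    have "ln (norm (poly B (cis \<theta>))) = Re (L (cis \<theta>))"
      unfolding expL[OF cisR, symmetric] by (simp add: norm_exp_eq_Re)
    then show ?thesis by (simp add: complex_add_cnj)
  qed
  have I: "(LINT \<theta>|dtheta. cnj (cis \<theta>) ^ j * of_real (2 * ln (norm (poly B (cis \<theta>))))) = fps_nth G j" for j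
  proof -
    have "(LINT \<theta>|dtheta. cnj (cis \<theta>) ^ j * of_real (2 * ln (norm (poly B (cis \<theta>)))))
        = (LINT \<theta>|dtheta. cnj (cis \<theta>) ^ j * L (cis \<theta>) + cnj (cis \<theta>) ^ j * cnj (L (cis \<theta>)))"
      by (simp only: ln distrib_left)
    also have "\<dots> = fps_nth G j + 0"
      unfolding I1[symmetric] I2[of j, symmetric]
      by (intro Bochner_Integration.integral_add integrable_dtheta_continuous continuous_intros contL)
    finally show ?thesis by simp
  qed
  show "m \<ge> 1 \<Longrightarrow> (LINT \<theta>|dtheta. cnj (cis \<theta>) ^ m * of_real (2 * ln (norm (poly B (cis \<theta>)))))
      = fps_nth (fps_ln 1 oo (fps_of_poly B - 1)) m"
    unfolding Glog[symmetric] by (rule I)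
  have "(LINT \<theta>|dtheta. complex_of_real (2 * ln (norm (poly B (cis \<theta>))))) = 0"
    using I[of 0] G0 by simp
  then have "of_real (LINT \<theta>|dtheta. 2 * ln (norm (poly B (cis \<theta>)))) = (0 :: complex)"
    unfolding integral_complex_of_real .
  then show "(LINT \<theta>|dtheta. ln (norm (poly B (cis \<theta>)))) = 0" by simp
qed

section \<open>Convergence of the Fourier coefficients\<close>

text \<open>This turns smallness of the integral of \<open>exp X - 1 - X\<close> into smallness of the integral of \<open>\<bar>X\<bar>\<close>.\<close>

lemma abs_le_exp_minus:
  fixes x :: real
  assumes "e > 0"
  shows "\<bar>x\<bar> \<le> e + (4 / e + 2) * (exp x - 1 - x)"
proof -
  define D where "D = exp x - 1 - x"
  have nn: "D \<ge> 0" using exp_ge_add_one_self[of x] unfolding D_def by linarith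
  have K: "4 / e > 0" using assms by simp
  have "\<bar>x\<bar> \<le> e + (4 / e + 2) * D"
  proof (cases "\<bar>x\<bar> \<le> e")
    case True
    have "(4 / e + 2) * D \<ge> 0" using K nn by (intro mult_nonneg_nonneg) auto
    then show ?thesis using True by linarith
  next
    case ge: False
    have "\<bar>x\<bar> \<le> (4 / e + 2) * D"
    proof (cases "x \<ge> -2")
      case True
      \<comment> \<open>Squaring \<open>1 + x / 2 \<le> exp (x / 2)\<close> gives the quadratic lower bound.\<close>
      have "(1 + x / 2)\<^sup>2 \<le> (exp (x / 2))\<^sup>2"
        using True exp_ge_add_one_self[of "x / 2"] by (intro power_mono) auto
      also have "(exp (x / 2))\<^sup>2 = exp x" by (simp add: power2_eq_square flip: exp_add)
      finally have "x\<^sup>2 / 4 \<le> D" by (simp add: D_def power2_eq_square field_simps)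
      moreover have "e * \<bar>x\<bar> \<le> x\<^sup>2"
        using ge mult_right_mono[of e "\<bar>x\<bar>" "\<bar>x\<bar>"] by (simp add: power2_eq_square)
      ultimately have "e * \<bar>x\<bar> / 4 \<le> D" by linarith
      then have "\<bar>x\<bar> \<le> 4 / e * D" using assms by (simp add: field_simps)
      also have "\<dots> \<le> (4 / e + 2) * D" using nn by (intro mult_right_mono) auto
      finally show ?thesis .
    next
      case False
      have "D > - 1 - x" using exp_gt_zero[of x] by (simp add: D_def)
      then have "\<bar>x\<bar> \<le> 2 * D" using False by linarith
      also have "\<dots> \<le> (4 / e + 2) * D" using nn K by (intro mult_right_mono) auto
      finally show ?thesis .
    qed
    then show ?thesis using assms by linarith
  qed
  then show ?thesis by (simp only: D_def)
qed

context nontrivial_circle_measure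
begin

lemma nsq_szego_rev_pos: "nsq (szego_rev vb n) > 0"
  using nsq_szego_poly_pos by (simp add: nsq_szego_rev)

text \<open>The norm of the reversed polynomial with respect to the absolutely continuous part is at most
  its norm with respect to \<open>\<mu>\<close>.\<close>

lemma integral_rev_sq_le:
  assumes w: "is_ac_density \<mu> w"
  shows "integrable dtheta (\<lambda>\<theta>. w \<theta> * (norm (poly (szego_rev vb n) (cis \<theta>)))\<^sup>2)"
    "(LINT \<theta>|dtheta. w \<theta> * (norm (poly (szego_rev vb n) (cis \<theta>)))\<^sup>2) \<le> nsq (szego_rev vb n)"
proof -
  note [measurable] = ac_density_measurable[OF w]
  let ?f = "\<lambda>\<theta>. w \<theta> * (norm (poly (szego_rev vb n) (cis \<theta>)))\<^sup>2"
  have [measurable]: "(\<lambda>\<theta>. (norm (poly (szego_rev vb n) (cis \<theta>)))\<^sup>2) \<in> borel_measurable dtheta"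
    by (intro measurable_dtheta borel_measurable_continuous_onI continuous_intros)
  have w0: "0 \<le> w \<theta>" if "\<theta> \<in> space dtheta" for \<theta> using w that by (auto simp: is_ac_density_def space_dtheta)
  have "(\<integral>\<^sup>+\<theta>. ennreal (?f \<theta>) \<partial>dtheta)
      = (\<integral>\<^sup>+\<theta>. ennreal (w \<theta>) * ennreal ((norm (poly (szego_rev vb n) (cis \<theta>)))\<^sup>2) \<partial>dtheta)"
    using w0 by (intro nn_integral_cong ennreal_mult) auto
  also have "\<dots> \<le> (\<integral>\<^sup>+z. ennreal ((norm (poly (szego_rev vb n) z))\<^sup>2) \<partial>\<mu>)"
    by (intro nn_integral_ac_le[OF w] measurable_compose[OF _ measurable_ennreal]
        borel_measurable_continuous_onI continuous_intros)
  also have "\<dots> = ennreal (nsq (szego_rev vb n))"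
    unfolding nsq_def by (intro nn_integral_eq_integral nsq_integrable) auto
  finally have le: "(\<integral>\<^sup>+\<theta>. ennreal (?f \<theta>) \<partial>dtheta) \<le> ennreal (nsq (szego_rev vb n))" .
  have nn: "AE \<theta> in dtheta. 0 \<le> ?f \<theta>" using w0 by (intro AE_I2) auto
  show int: "integrable dtheta ?f"
    using le by (intro integrableI_nonneg nn) (auto intro: le_less_trans)
  show "(LINT \<theta>|dtheta. ?f \<theta>) \<le> nsq (szego_rev vb n)"
    using le nsq_nonneg by (simp add: nn_integral_eq_integral[OF int nn])
qed

text \<open>The functions \<open>X n\<close> in the proof are \<open>log g\<^sub>n\<close> with \<open>g\<^sub>n = \<bar>B\<^sub>n\<bar>\<^sup>2 * w / p\<^sub>n\<close>; they tend to \<open>0\<close> in mean.\<close>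

lemma log_fourier_eq_lim:
  assumes w: "is_ac_density \<mu> w" and pos: "szego_const > 0" and m: "m \<ge> 1"
  shows "(\<lambda>n. fps_nth (fps_ln 1 oo (fps_of_poly (szego_rev vb n) - 1)) m) \<longlonglongrightarrow> - log_fourier w m"
proof -
  note [measurable] = ac_density_measurable[OF w]
  let ?b = "\<lambda>n \<theta>. norm (poly (szego_rev vb n) (cis \<theta>))"
  let ?p = "\<lambda>n. nsq (szego_rev vb n)"
  note lnw = ln_density_integrable[OF w pos]
  have b: "?b n \<theta> > 0" for n \<theta>
    using szego_rev_nonzero(1)[of vb "cis \<theta>" n] norm_vb_less_1 by simp
  have p: "?p n > 0" for n by (rule nsq_szego_rev_pos)
  have nz: "poly (szego_rev vb n) z \<noteq> 0" if "norm z \<le> 1" for n z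
    using szego_rev_nonzero(1)[of vb z n] norm_vb_less_1 that by simp
  have intb: "integrable dtheta (\<lambda>\<theta>. ln (?b n \<theta>))" for n
    using nz by (intro integrable_dtheta_continuous continuous_intros) (auto simp: nz)
  define X where "X n \<theta> = ln (w \<theta>) + 2 * ln (?b n \<theta>) - ln (?p n)" for n \<theta>
  have intX: "integrable dtheta (X n)" for n
    unfolding X_def using lnw(2) intb[of n] by auto
  have IX: "(LINT \<theta>|dtheta. X n \<theta>) \<ge> ln szego_const - ln (?p n)" for n
    unfolding X_def using lnw(2,3) intb[of n] log_poly_fourier(1)[of "szego_rev vb n", OF coeff_szego_rev_0 nz]
    by (simp add: dtheta.prob_space)
  have expX: "AE \<theta> in dtheta. exp (X n \<theta>) = w \<theta> * (?b n \<theta>)\<^sup>2 / ?p n" for n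
    using lnw(1)
  proof eventually_elim
    case (elim \<theta>)
    have "exp (2 * ln (?b n \<theta>)) = (?b n \<theta>)\<^sup>2"
      using b[of n \<theta>] by (simp add: exp_of_nat_mult[of 2, simplified])
    then show ?case using elim p[of n] by (simp add: X_def exp_diff exp_add)
  qed
  have bound: "(LINT \<theta>|dtheta. \<bar>X n \<theta>\<bar>) \<le> e + (4 / e + 2) * (ln (?p n) - ln szego_const)" if e: "e > 0" for n e
  proof -
    let ?h = "\<lambda>\<theta>. w \<theta> * (?b n \<theta>)\<^sup>2 / ?p n"
    have inth: "integrable dtheta ?h" using integral_rev_sq_le(1)[OF w, of n] by simp
    have Ih: "(LINT \<theta>|dtheta. ?h \<theta>) \<le> 1" using integral_rev_sq_le(2)[OF w, of n] p[of n] by simp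
    have "(LINT \<theta>|dtheta. \<bar>X n \<theta>\<bar>) \<le> (LINT \<theta>|dtheta. e + (4 / e + 2) * (?h \<theta> - 1 - X n \<theta>))"
    proof (rule integral_mono_AE)
      show "AE \<theta> in dtheta. \<bar>X n \<theta>\<bar> \<le> e + (4 / e + 2) * (?h \<theta> - 1 - X n \<theta>)"
        using expX[of n]
      proof eventually_elim
        case (elim \<theta>)
        then show ?case using abs_le_exp_minus[OF e, of "X n \<theta>"] by simp
      qed
    qed (use intX[of n] inth in auto)
    also have "\<dots> = e + (4 / e + 2) * ((LINT \<theta>|dtheta. ?h \<theta>) - 1 - (LINT \<theta>|dtheta. X n \<theta>))"
    proof -
      have 1: "integrable dtheta (\<lambda>\<theta>. ?h \<theta> - 1 - X n \<theta>)" using intX[of n] inth by auto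
      have "(LINT \<theta>|dtheta. e + (4 / e + 2) * (?h \<theta> - 1 - X n \<theta>))
          = e + (4 / e + 2) * (LINT \<theta>|dtheta. ?h \<theta> - 1 - X n \<theta>)"
        using 1 by (subst Bochner_Integration.integral_add) (auto simp: dtheta.prob_space)
      also have "(LINT \<theta>|dtheta. ?h \<theta> - 1 - X n \<theta>) = (LINT \<theta>|dtheta. ?h \<theta> - 1) - (LINT \<theta>|dtheta. X n \<theta>)"
        using intX[of n] inth by (intro Bochner_Integration.integral_diff) auto
      also have "(LINT \<theta>|dtheta. ?h \<theta> - 1) = (LINT \<theta>|dtheta. ?h \<theta>) - 1"
        using inth by (subst Bochner_Integration.integral_diff) (auto simp: dtheta.prob_space)
      finally show ?thesis .
    qed
    also have "\<dots> \<le> e + (4 / e + 2) * (ln (?p n) - ln szego_const)"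
      using Ih IX[of n] e by (intro add_left_mono mult_left_mono) auto
    finally show ?thesis .
  qed
  have cm: "cnj (cis \<theta>) ^ m = exp (- (\<i> * of_nat m * of_real \<theta>))" for \<theta>
  proof -
    have "cnj (cis \<theta>) = cis (- \<theta>)" by (simp add: complex_eq_iff)
    then show ?thesis by (simp only: Complex.DeMoivre) (simp add: cis_conv_exp mult_ac)
  qed
  have diff: "log_fourier w m + fps_nth (fps_ln 1 oo (fps_of_poly (szego_rev vb n) - 1)) m
      = (LINT \<theta>|dtheta. cnj (cis \<theta>) ^ m * of_real (X n \<theta>))" for n
  proof -
    have mb: "(\<lambda>\<theta>. cnj (cis \<theta>) ^ m) \<in> borel_measurable dtheta"
      by (intro measurable_dtheta borel_measurable_continuous_onI continuous_intros)
    have int: "integrable dtheta (\<lambda>\<theta>. cnj (cis \<theta>) ^ m * of_real (f \<theta>))" if "integrable dtheta f" for f :: "real \<Rightarrow> real"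
    proof (rule Bochner_Integration.integrable_bound[OF that])
      show "(\<lambda>\<theta>. cnj (cis \<theta>) ^ m * of_real (f \<theta>)) \<in> borel_measurable dtheta"
        using that by (intro borel_measurable_times mb borel_measurable_of_real) auto
    qed (auto simp: norm_mult norm_power)
    have i1: "integrable dtheta (\<lambda>\<theta>. cnj (cis \<theta>) ^ m * of_real (ln (w \<theta>)))" by (rule int[OF lnw(2)])
    have i2: "integrable dtheta (\<lambda>\<theta>. cnj (cis \<theta>) ^ m * of_real (2 * ln (?b n \<theta>)))"
      using intb[of n] by (intro int) auto
    have i3: "integrable dtheta (\<lambda>\<theta>. cnj (cis \<theta>) ^ m * of_real (ln (?p n)))" by (intro int) auto
    have "(LINT \<theta>|dtheta. cnj (cis \<theta>) ^ m * of_real (X n \<theta>))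
        = (LINT \<theta>|dtheta. (cnj (cis \<theta>) ^ m * of_real (ln (w \<theta>)) + cnj (cis \<theta>) ^ m * of_real (2 * ln (?b n \<theta>)))
            - cnj (cis \<theta>) ^ m * of_real (ln (?p n)))"
      by (simp only: X_def of_real_add of_real_diff distrib_left right_diff_distrib)
    also have "\<dots> = (LINT \<theta>|dtheta. cnj (cis \<theta>) ^ m * of_real (ln (w \<theta>)))
        + (LINT \<theta>|dtheta. cnj (cis \<theta>) ^ m * of_real (2 * ln (?b n \<theta>)))
        - (LINT \<theta>|dtheta. cnj (cis \<theta>) ^ m * of_real (ln (?p n)))"
      by (simp only: Bochner_Integration.integral_diff[OF Bochner_Integration.integrable_add[OF i1 i2] i3]
          Bochner_Integration.integral_add[OF i1 i2])
    also have "(LINT \<theta>|dtheta. cnj (cis \<theta>) ^ m * of_real (ln (?p n))) = 0"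
      using integral_dtheta_cnj_cis_power[of m 0] m by (simp del: complex_cnj_power)
    also have "(LINT \<theta>|dtheta. cnj (cis \<theta>) ^ m * of_real (2 * ln (?b n \<theta>)))
        = fps_nth (fps_ln 1 oo (fps_of_poly (szego_rev vb n) - 1)) m"
      by (rule log_poly_fourier(2)[OF coeff_szego_rev_0 nz m])
    also have "(LINT \<theta>|dtheta. cnj (cis \<theta>) ^ m * of_real (ln (w \<theta>))) = log_fourier w m"
      by (simp only: log_fourier_def cm)
    finally show ?thesis by simp
  qed
  have "(\<lambda>n. LINT \<theta>|dtheta. \<bar>X n \<theta>\<bar>) \<longlonglongrightarrow> 0"
  proof (rule LIMSEQ_I)
    fix r :: real assume r: "r > 0"
    have "(\<lambda>n. r / 2 + (4 / (r / 2) + 2) * (ln (?p n) - ln szego_const)) \<longlonglongrightarrow>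
        r / 2 + (4 / (r / 2) + 2) * (ln szego_const - ln szego_const)"
      using pos by (intro tendsto_intros nsq_szego_rev_tendsto) auto
    then have "\<forall>\<^sub>F n in sequentially. r / 2 + (4 / (r / 2) + 2) * (ln (?p n) - ln szego_const) < r"
      by (rule order_tendstoD(2)) (use r in simp)
    then have "\<forall>\<^sub>F n in sequentially. norm ((LINT \<theta>|dtheta. \<bar>X n \<theta>\<bar>) - 0) < r"
    proof eventually_elim
      case (elim n)
      then show ?case using bound[of "r / 2" n] r by simp
    qed
    then show "\<exists>N. \<forall>n\<ge>N. norm ((LINT \<theta>|dtheta. \<bar>X n \<theta>\<bar>) - 0) < r"
      by (simp add: eventually_sequentially)
  qed
  then have "(\<lambda>n. log_fourier w m + fps_nth (fps_ln 1 oo (fps_of_poly (szego_rev vb n) - 1)) m) \<longlonglongrightarrow> 0"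
  proof (rule Lim_null_comparison[rotated])
    show "\<forall>\<^sub>F n in sequentially. norm (log_fourier w m + fps_nth (fps_ln 1 oo (fps_of_poly (szego_rev vb n) - 1)) m)
        \<le> (LINT \<theta>|dtheta. \<bar>X n \<theta>\<bar>)"
    proof (rule always_eventually, rule allI)
      fix n
      have "norm (LINT \<theta>|dtheta. cnj (cis \<theta>) ^ m * of_real (X n \<theta>))
          \<le> (LINT \<theta>|dtheta. norm (cnj (cis \<theta>) ^ m * of_real (X n \<theta>)))"
        by (rule integral_norm_bound)
      also have "\<dots> = (LINT \<theta>|dtheta. \<bar>X n \<theta>\<bar>)" by (simp add: norm_mult norm_power)
      finally show "norm (log_fourier w m + fps_nth (fps_ln 1 oo (fps_of_poly (szego_rev vb n) - 1)) m)
        \<le> (LINT \<theta>|dtheta. \<bar>X n \<theta>\<bar>)" unfolding diff .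
    qed
  qed
  from tendsto_diff[OF this tendsto_const[of "log_fourier w m"]] show ?thesis by simp
qed

end

theorem theorem2p4:
  fixes \<mu> :: "complex measure" and w :: "real \<Rightarrow> real" and m :: nat
  assumes "nontrivial_prob_on_circle \<mu>"
    and "is_ac_density \<mu> w"
    and "summable (\<lambda>k. (norm (verblunsky \<mu> k))\<^sup>2)"
    and "m \<ge> 1"
  shows "((\<lambda>P. of_real (N_coeff P) * beta \<mu> P) has_sum log_fourier w m) (cutless m \<infinity>) \<and>
    (\<forall>P \<in> cutless m 0. summable (\<lambda>k. beta \<mu> (shift_coll P (int k)))) \<and>
    log_fourier w m =
      (\<Sum>P \<in> cutless m 0. of_real (N_coeff P) * (\<Sum>k. beta \<mu> (shift_coll P (int k))))"
proof -
  interpret nontrivial_circle_measure \<mu> by standard (rule assms(1))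
  let ?S = "\<lambda>n. \<Sum>P \<in> cutless m 0. of_real (N_coeff P) * (\<Sum>k<n. beta \<mu> (shift_coll P (int k)))"
  let ?L = "\<Sum>P \<in> cutless m 0. of_real (N_coeff P) * (\<Sum>k. beta \<mu> (shift_coll P (int k)))"
  have sm: "summable (\<lambda>k. beta \<mu> (shift_coll P (int k)))" if "P \<in> cutless m 0" for P
  proof -
    have "P \<noteq> {#}" using that by (auto simp: cutless_def coll_def)
    then show ?thesis
      by (intro summable_norm_cancel[OF summable_beta_shift] norm_alpha_le_1 assms(3))
  qed
  have "?S \<longlonglongrightarrow> ?L"
    by (intro tendsto_sum tendsto_mult tendsto_const summable_LIMSEQ sm)
  moreover have "?S \<longlonglongrightarrow> log_fourier w m"
    using tendsto_minus[OF log_fourier_eq_lim[OF assms(2) szego_const_pos[OF assms(3)] assms(4)]]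
    by (simp add: verblunsky_eq[symmetric] log_szego_rev_nth[OF assms(4)])
  ultimately have eq: "log_fourier w m = ?L" by (rule LIMSEQ_unique[rotated])
  have "((\<lambda>P. of_real (N_coeff P) * beta \<mu> P) has_sum ?L) (cutless m \<infinity>)"
    by (rule has_sum_cutless[OF norm_alpha_le_1 assms(3)])
  then show ?thesis using sm eq by simp
qed

end
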